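(* For the online vertex-weighted stochastic matching problem with i.i.d. arrivals (all $D_j$ equal to a common distribution $D$), there exists an unbiased estimator that is $0.731$-competitive as a fractional algorithm, and the integral algorithm obtained by rounding it with the OCS is $0.704$-competitive.
   Context: Problem: there is a finite set $L$ of offline vertices, each $u\in L$ with weight $w_u\ge 0$, and $n$ online vertices $v_1,\dots,v_n$, $v_j$ being the $j$-th to arrive. The type $t_j$ of $v_j$ is drawn independently from a known distribution $D_j$ with finite support $T_j$ (here all $D_j=D$); a type specifies the set of offline neighbours of the vertex. $\mathsf{OPT}(\mathbf{t})$ denotes a maximum-weight matching (weight $=\sum$ of $w_u$ over matched offline $u$) of the realized graph, selected by a fixed (possibly randomized) rule that treats online vertices symmetrically; probabilities involving $\mathsf{OPT}$ are over the types and this rule. A fractional online algorithm, on arrival of $v_j$, chooses $x_j\in[0,1]^L$ as a function of $\mathbf{t}_{\le j}=(t_1,\dots,t_j)$, with $x_{u,j}>0$ only if $u$ is a neighbour of $v_j$ and $\sum_u x_{u,j}\le 1$; with $y_u=\sum_j x_{u,j}$ its value is $\sum_u w_u\min(y_u,1)$. It is an unbiased estimator if moreover $\mathbb{E}_{\mathbf{t}_{\le j}}[x_{u,j}(\mathbf{t}_{\le j})]=\Pr[(u,v_j)\in\mathsf{OPT}]$ for all $u,j$. Rounding with OCS: let $p(y)=1-\exp\!\big(-y-\tfrac12 y^2-\tfrac{4-2\sqrt3}{3}y^3\big)$; on arrival of $v_j$ the multiway online correlated selection of Gao et al. (FOCS 2021) selects one $u$ with $x_{u,j}>0$ (a dummy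 element absorbs mass $1-\sum_u x_{u,j}$) and $v_j$ is matched to $u$ if $u$ is unmatched; it guarantees that for any fixed sequence $x_1,\dots,x_n$ each $u$ is selected at least once with probability at least $p(y_u)$. $\Gamma$-competitive means the expected value is at least $\Gamma$ times the expected weight of $\mathsf{OPT}$ on every instance. *)

theory Defs
  imports "HOL-Probability.Probability" "HOL-Combinatorics.Permutations"
begin

section \<open>Instances and offline optimum\<close>

(* The online vertices are the indices 0, ..., horizon - 1, in order of arrival. *)
record ('u, 't) osm =
  offline   :: "'u set"
  weight    :: "'u \<Rightarrow> real"
  horizon   :: nat
  type_dist :: "'t pmf"
  nbrs      :: "'t \<Rightarrow> 'u set"

definition osm_instance :: "('u, 't) osm \<Rightarrow> bool" where
  "osm_instance I \<longleftrightarrow>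
     finite (offline I) \<and> (\<forall>u\<in>offline I. 0 \<le> weight I u) \<and>
     finite (set_pmf (type_dist I)) \<and> (\<forall>t\<in>set_pmf (type_dist I). nbrs I t \<subseteq> offline I)"

definition types_pmf :: "('u, 't) osm \<Rightarrow> 't list pmf" where
  "types_pmf I = replicate_pmf (horizon I) (type_dist I)"

definition realized_graph :: "('u, 't) osm \<Rightarrow> 't list \<Rightarrow> ('u \<times> nat) set" where
  "realized_graph I ts = {(u, j). j < length ts \<and> u \<in> nbrs I (ts ! j)}"

(* Edges join the two sides of a product type, so injectivity of the two projections says
   that no offline and no online vertex is covered twice. *)
definition is_matching :: "('u \<times> nat) set \<Rightarrow> ('u \<times> nat) set \<Rightarrow> bool" where
  "is_matching G M \<longleftrightarrow> M \<subseteq> G \<and> inj_on fst M \<and> inj_on snd M"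

definition matching_weight :: "('u, 't) osm \<Rightarrow> ('u \<times> nat) set \<Rightarrow> real" where
  "matching_weight I M = (\<Sum>u\<in>fst ` M. weight I u)"

definition max_weight_matching :: "('u, 't) osm \<Rightarrow> 't list \<Rightarrow> ('u \<times> nat) set \<Rightarrow> bool" where
  "max_weight_matching I ts M \<longleftrightarrow>
     is_matching (realized_graph I ts) M \<and>
     (\<forall>M'. is_matching (realized_graph I ts) M' \<longrightarrow> matching_weight I M' \<le> matching_weight I M)"

(* Vertex i of "permute_list p ts" has type ts ! p i, i.e. it is vertex p i of ts.  The second
   clause says that relabelling the online vertices relabels the selected matching, in
   distribution. *)
definition symmetric_opt_rule ::
    "('u, 't) osm \<Rightarrow> ('t list \<Rightarrow> ('u \<times> nat) set pmf) \<Rightarrow> bool" where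
  "symmetric_opt_rule I opt \<longleftrightarrow>
     (\<forall>ts\<in>set_pmf (types_pmf I).
        (\<forall>M\<in>set_pmf (opt ts). max_weight_matching I ts M) \<and>
        (\<forall>p. p permutes {..<horizon I} \<longrightarrow>
           map_pmf (\<lambda>M. (\<lambda>(u, i). (u, p i)) ` M) (opt (permute_list p ts)) = opt ts))"

definition opt_pmf ::
    "('u, 't) osm \<Rightarrow> ('t list \<Rightarrow> ('u \<times> nat) set pmf) \<Rightarrow> ('u \<times> nat) set pmf" where
  "opt_pmf I opt = bind_pmf (types_pmf I) opt"

definition opt_value :: "('u, 't) osm \<Rightarrow> ('t list \<Rightarrow> ('u \<times> nat) set pmf) \<Rightarrow> real" where
  "opt_value I opt = measure_pmf.expectation (opt_pmf I opt) (matching_weight I)"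


section \<open>Fractional algorithms\<close>

definition fractional_vector :: "'u set \<Rightarrow> ('u \<Rightarrow> real) \<Rightarrow> bool" where
  "fractional_vector L x \<longleftrightarrow> (\<forall>u\<in>L. 0 \<le> x u \<and> x u \<le> 1) \<and> (\<Sum>u\<in>L. x u) \<le> 1"

(* A fractional algorithm maps the nonempty prefix of types revealed so far to the vector chosen
   for the vertex that has just arrived, whose type is the last entry of the prefix. *)
definition fractional_algorithm :: "('u, 't) osm \<Rightarrow> ('t list \<Rightarrow> 'u \<Rightarrow> real) \<Rightarrow> bool" where
  "fractional_algorithm I x \<longleftrightarrow>
     (\<forall>ts. ts \<noteq> [] \<and> length ts \<le> horizon I \<and> set ts \<subseteq> set_pmf (type_dist I) \<longrightarrow>
        fractional_vector (offline I) (x ts) \<and>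
        (\<forall>u\<in>offline I. x ts u > 0 \<longrightarrow> u \<in> nbrs I (last ts)))"

definition unbiased_estimator ::
    "('u, 't) osm \<Rightarrow> ('t list \<Rightarrow> ('u \<times> nat) set pmf) \<Rightarrow> ('t list \<Rightarrow> 'u \<Rightarrow> real) \<Rightarrow> bool" where
  "unbiased_estimator I opt x \<longleftrightarrow>
     fractional_algorithm I x \<and>
     (\<forall>u\<in>offline I. \<forall>j<horizon I.
        measure_pmf.expectation (replicate_pmf (Suc j) (type_dist I)) (\<lambda>ts. x ts u) =
        measure_pmf.prob (opt_pmf I opt) {M. (u, j) \<in> M})"

definition fractional_run ::
    "('u, 't) osm \<Rightarrow> ('t list \<Rightarrow> 'u \<Rightarrow> real) \<Rightarrow> 't list \<Rightarrow> ('u \<Rightarrow> real) list" where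
  "fractional_run I x ts = map (\<lambda>j. x (take (Suc j) ts)) [0..<horizon I]"

definition total_mass :: "('u \<Rightarrow> real) list \<Rightarrow> 'u \<Rightarrow> real" where
  "total_mass xs u = (\<Sum>x\<leftarrow>xs. x u)"

definition fractional_value ::
    "('u, 't) osm \<Rightarrow> ('t list \<Rightarrow> 'u \<Rightarrow> real) \<Rightarrow> 't list \<Rightarrow> real" where
  "fractional_value I x ts =
     (\<Sum>u\<in>offline I. weight I u * min (total_mass (fractional_run I x ts) u) 1)"


section \<open>Online correlated selection\<close>

definition ocs_bound :: "real \<Rightarrow> real" where
  "ocs_bound y = 1 - exp (- y - 1 / 2 * y ^ 2 - (4 - 2 * sqrt 3) / 3 * y ^ 3)"

(* A selection procedure is given by the law of its next selection, conditioned on the earlier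
   vectors and selections; every randomized online procedure is of this form up to the joint law
   of its selections.  None is the dummy element. *)
type_synonym 'u selector =
  "'u set \<Rightarrow> (('u \<Rightarrow> real) \<times> 'u option) list \<Rightarrow> ('u \<Rightarrow> real) \<Rightarrow> 'u option pmf"

primrec selections_from ::
    "'u selector \<Rightarrow> 'u set \<Rightarrow> (('u \<Rightarrow> real) \<times> 'u option) list \<Rightarrow> ('u \<Rightarrow> real) list
      \<Rightarrow> 'u option list pmf" where
  "selections_from S L h [] = return_pmf []"
| "selections_from S L h (x # xs) =
     bind_pmf (S L h x) (\<lambda>s. map_pmf ((#) s) (selections_from S L (h @ [(x, s)]) xs))"

definition selections ::
    "'u selector \<Rightarrow> 'u set \<Rightarrow> ('u \<Rightarrow> real) list \<Rightarrow> 'u option list pmf" where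
  "selections S L xs = selections_from S L [] xs"

definition multiway_ocs :: "'u selector \<Rightarrow> bool" where
  "multiway_ocs S \<longleftrightarrow>
     (\<forall>L. finite L \<longrightarrow>
        (\<forall>h x. fractional_vector L x \<longrightarrow>
           set_pmf (S L h x) \<subseteq>
             Some ` {u \<in> L. x u > 0} \<union> (if (\<Sum>u\<in>L. x u) < 1 then {None} else {})) \<and>
        (\<forall>xs. (\<forall>x\<in>set xs. fractional_vector L x) \<longrightarrow>
           (\<forall>u\<in>L. measure_pmf.prob (selections S L xs) {ss. Some u \<in> set ss}
                    \<ge> ocs_bound (total_mass xs u))))"


section \<open>Rounding\<close>

primrec match_selected ::
    "('u \<times> nat) set \<Rightarrow> nat \<Rightarrow> 'u option list \<Rightarrow> ('u \<times> nat) set" where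
  "match_selected M j [] = M"
| "match_selected M j (s # ss) =
     match_selected
       (case s of None \<Rightarrow> M | Some u \<Rightarrow> if u \<in> fst ` M then M else insert (u, j) M) (Suc j) ss"

definition ocs_rounding ::
    "'u selector \<Rightarrow> ('u, 't) osm \<Rightarrow> ('t list \<Rightarrow> 'u \<Rightarrow> real) \<Rightarrow> 't list \<Rightarrow> ('u \<times> nat) set pmf" where
  "ocs_rounding S I x ts =
     map_pmf (match_selected {} 0) (selections S (offline I) (fractional_run I x ts))"


section \<open>Competitive ratio\<close>

(* Algorithms and optimum rules are families indexed by the (known) instance. *)

definition fractional_competitive ::
    "real \<Rightarrow> (('u, 't) osm \<Rightarrow> 't list \<Rightarrow> ('u \<times> nat) set pmf)
      \<Rightarrow> (('u, 't) osm \<Rightarrow> 't list \<Rightarrow> 'u \<Rightarrow> real) \<Rightarrow> bool" where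
  "fractional_competitive \<Gamma> opt x \<longleftrightarrow>
     (\<forall>I. osm_instance I \<longrightarrow>
        measure_pmf.expectation (types_pmf I) (fractional_value I (x I))
          \<ge> \<Gamma> * opt_value I (opt I))"

definition integral_competitive ::
    "real \<Rightarrow> (('u, 't) osm \<Rightarrow> 't list \<Rightarrow> ('u \<times> nat) set pmf)
      \<Rightarrow> (('u, 't) osm \<Rightarrow> 't list \<Rightarrow> ('u \<times> nat) set pmf) \<Rightarrow> bool" where
  "integral_competitive \<Gamma> opt A \<longleftrightarrow>
     (\<forall>I. osm_instance I \<longrightarrow>
        measure_pmf.expectation (bind_pmf (types_pmf I) (A I)) (matching_weight I)
          \<ge> \<Gamma> * opt_value I (opt I))"

end

theory Submission
  imports Defs
begin

text \<open>
  Fix an offline vertex \<open>u\<close> and let \<open>z j t\<close> be the probability that the optimum of the type sequence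
  \<open>t\<close> matches \<open>u\<close> to the \<open>j\<close>-th online vertex.  The estimator \<open>x j\<close> is the conditional expectation of
  \<open>z j\<close> given the types up to \<open>j\<close> when each earlier type is kept with probability \<open>7/10\<close> and
  resampled otherwise.  Resampling preserves the mean and all pointwise linear constraints, so the
  estimator is unbiased and feasible, and it lowers the variance of \<open>y = \<Sum>j. x j\<close>.

  In the Efron--Stein decomposition of the \<open>z j\<close>, symmetry leaves four covariances at each level \<open>k\<close>
  (the size of the index set), and \<open>E y\<^sup>2\<close> is linear in them.  They satisfy linear constraints: products
  of smoothed \<open>z i\<close>, \<open>z j\<close> have nonnegative mean; \<open>\<Sum>j. z j \<le> 1\<close>; and a Lorenz-type inequality, saying
  that \<open>u\<close> is matched to a vertex with type in \<open>A\<close> at most as often as such a type occurs.  A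
  nonnegative combination of the constraints, checked level by level, gives
  \<open>E y\<^sup>2 \<le> 1.031 q + 0.257465 q\<^sup>2\<close> with \<open>q = E y = P[u \<in> OPT]\<close>.  Integrating quadratic minorants of
  \<open>min y 1\<close> and of the OCS bound yields the two ratios, vertex by vertex.
\<close>

section \<open>Quadratic minorants of the OCS bound\<close>

text \<open>The total mass \<open>y\<close> may exceed 1 although the optimum matches
  \<open>u\<close> at most once, and this overshoot is what costs value. At \<open>q = 1\<close> the
  bound leaves variance at most 0.288465, and 1 minus half the standard deviation is just above
  0.731. The retention rate settles a conflict. In \<open>E y^2\<close> the covariances
  \<open>cov_in\<close> and \<open>cov_out\<close>, which are nonnegative, carry even powers of the
  rate, so a small rate shrinks them. The third one, \<open>cov_in_out\<close>, may be negative: an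
  earlier vertex that claims \<open>u\<close> leaves less for later ones. It carries an odd power
  and would be lost at rate 0. The fourth, \<open>cov_in_in\<close>, does not occur in
  \<open>E y^2\<close> but does occur in the constraints. It is controlled because the
  level-\<open>k\<close> components of the sums of \<open>z i\<close> inside and outside an index
  set have a positive semidefinite Gram matrix. Each level is thereby reduced to two sign conditions
  and a 2x2 discriminant, and \<open>n\<close> enters only through aggregated sums, so one
  certificate serves all horizons.\<close>

lemma exp_ge_partial_sum:
  fixes x :: real
  assumes "0 \<le> x"
  shows "(\<Sum>k<n. x ^ k / fact k) \<le> exp x"
proof -
  have "(\<lambda>k. x ^ k / fact k) sums exp x"
    using exp_converges[of x] by (simp add: scaleR_conv_of_real field_simps)
  then show ?thesis
    using assms by (intro sum_le_suminf[of "\<lambda>k. x ^ k / fact k" "{..<n}", THEN order_trans])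
      (auto simp: sums_iff)
qed

text \<open>The sign conditions are those of the coefficients in the Bernstein basis of degree 4.\<close>

lemma quartic_nonneg:
  fixes s :: real
  assumes "0 \<le> s" "s \<le> 1"
    and "0 \<le> c0" "0 \<le> c0 + c1 / 4" "0 \<le> c0 + c1 / 2 + c2 / 6"
    and "0 \<le> c0 + 3 * c1 / 4 + c2 / 2 + c3 / 4" "0 \<le> c0 + c1 + c2 + c3 + c4"
  shows "0 \<le> c0 + c1 * s + c2 * s ^ 2 + c3 * s ^ 3 + c4 * s ^ 4"
proof -
  have "c0 + c1 * s + c2 * s ^ 2 + c3 * s ^ 3 + c4 * s ^ 4 =
      c0 * (1 - s) ^ 4 + 4 * (c0 + c1 / 4) * (s * (1 - s) ^ 3)
      + 6 * (c0 + c1 / 2 + c2 / 6) * (s ^ 2 * (1 - s) ^ 2)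
      + 4 * (c0 + 3 * c1 / 4 + c2 / 2 + c3 / 4) * (s ^ 3 * (1 - s))
      + (c0 + c1 + c2 + c3 + c4) * s ^ 4"
    by algebra
  then show ?thesis
    using assms by simp
qed

text \<open>Substituting \<open>y = l + h * s\<close> carries the interval to
  \<open>0 \<le> s \<le> 1\<close>; \<open>c0\<close> to \<open>c4\<close> are the Taylor
  coefficients at \<open>l\<close>, scaled by powers of \<open>h\<close>. They enter as equations so
  that \<open>refl\<close> instantiates them and what remains is the evaluation of rational
  signs.\<close>

lemma quartic_nonneg_on:
  fixes y :: real
  assumes y: "y \<in> {l..u}" and "l < u" and h: "h = u - l"
    and c: "c0 = a0 + a1 * l + a2 * l ^ 2 + a3 * l ^ 3 + a4 * l ^ 4"
      "c1 = (a1 + 2 * a2 * l + 3 * a3 * l ^ 2 + 4 * a4 * l ^ 3) * h"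
      "c2 = (a2 + 3 * a3 * l + 6 * a4 * l ^ 2) * h ^ 2"
      "c3 = (a3 + 4 * a4 * l) * h ^ 3"
      "c4 = a4 * h ^ 4"
    and pos: "0 \<le> c0" "0 \<le> c0 + c1 / 4" "0 \<le> c0 + c1 / 2 + c2 / 6"
      "0 \<le> c0 + 3 * c1 / 4 + c2 / 2 + c3 / 4" "0 \<le> c0 + c1 + c2 + c3 + c4"
  shows "0 \<le> a0 + a1 * y + a2 * y ^ 2 + a3 * y ^ 3 + a4 * y ^ 4"
proof -
  define s where "s = (y - l) / h"
  have "0 < h"
    using assms by simp
  then have y_eq: "y = l + h * s" and s: "0 \<le> s" "s \<le> 1"
    using assms by (auto simp: s_def field_simps)
  have "a0 + a1 * y + a2 * y ^ 2 + a3 * y ^ 3 + a4 * y ^ 4 =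
      c0 + c1 * s + c2 * s ^ 2 + c3 * s ^ 3 + c4 * s ^ 4"
    unfolding y_eq c by algebra
  then show ?thesis
    using quartic_nonneg[OF s pos] by simp
qed

text \<open>The coefficient \<open>0.1786\<close> is a rational lower bound for \<open>(4 - 2 * sqrt 3) / 3\<close>.\<close>

definition cubic_exponent :: "real \<Rightarrow> real" where
  "cubic_exponent y = y + y ^ 2 / 2 + 0.1786 * y ^ 3"

lemma cubic_exponent_mono:
  assumes "0 \<le> x" "x \<le> y"
  shows "cubic_exponent x \<le> cubic_exponent y"
  unfolding cubic_exponent_def
  using assms by (intro add_mono mult_left_mono divide_right_mono power_mono) auto

lemma ocs_bound_ge:
  assumes "0 \<le> y"
  shows "1 - exp (- cubic_exponent y) \<le> ocs_bound y"
proof -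
  have "sqrt 3 \<le> 1.7321"
    by (rule real_le_lsqrt) (auto simp: power2_eq_square)
  then have "0.1786 * y ^ 3 \<le> (4 - 2 * sqrt 3) / 3 * y ^ 3"
    using assms by (intro mult_right_mono) auto
  then show ?thesis
    by (simp add: ocs_bound_def cubic_exponent_def)
qed

section \<open>Quadratic minorants from monotonicity of
  \<open>R y * exp (cubic_exponent y)\<close>\<close>

context
  fixes r0 r1 r2 :: real and R D :: "real \<Rightarrow> real"
  defines "R \<equiv> \<lambda>y. r0 + r1 * y + r2 * y ^ 2"
    and "D \<equiv> \<lambda>y. (r0 + r1) + (r0 + r1 + 2 * r2) * y + (0.5358 * r0 + r1 + r2) * y ^ 2
      + (0.5358 * r1 + r2) * y ^ 3 + 0.5358 * r2 * y ^ 4"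
begin

text \<open>The exponent has a quadratic derivative, so the product has a derivative whose sign is
  that of the quartic \<open>D\<close>. As \<open>1 - R y\<close> is a minorant wherever the product
  is at least 1, signs of \<open>D\<close> and a few values of the product are enough.\<close>

lemma quadratic_times_exp_deriv:
  "((\<lambda>y. R y * exp (cubic_exponent y)) has_real_derivative exp (cubic_exponent y) * D y) (at y)"
  unfolding R_def D_def cubic_exponent_def
  by (rule derivative_eq_intros refl | simp)+ (simp add: algebra_simps power2_eq_square power3_eq_cube power4_eq_xxxx)

text \<open>The tolerance \<open>e\<close> serves short intervals containing a root of
  \<open>D\<close> whose exact position is unknown: a linear term of slope \<open>B\<close> restores
  monotonicity, at the price \<open>B * (b - a)\<close> in the starting value.\<close>

lemma quadratic_times_exp_increasing:
  assumes "0 \<le> a" "a \<le> y" "y \<le> b" "0 \<le> e"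
    and D: "\<And>x. a \<le> x \<Longrightarrow> x \<le> b \<Longrightarrow> - e \<le> D x"
    and start: "1 + e * exp (cubic_exponent b) * (b - a) \<le> R a * exp (cubic_exponent a)"
  shows "1 \<le> R y * exp (cubic_exponent y)"
proof -
  let ?G = "\<lambda>y. R y * exp (cubic_exponent y)"
  define B where "B = e * exp (cubic_exponent b)"
  have "?G a + B * a \<le> ?G y + B * y"
  proof (rule DERIV_nonneg_imp_nondecreasing[OF \<open>a \<le> y\<close>])
    fix x assume x: "a \<le> x" "x \<le> y"
    have "e * exp (cubic_exponent x) \<le> B"
      unfolding B_def using x assms by (intro mult_left_mono) (auto intro!: cubic_exponent_mono)
    moreover have "exp (cubic_exponent x) * (- e) \<le> exp (cubic_exponent x) * D x"
      using x assms D by (intro mult_left_mono) auto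
    ultimately have "0 \<le> exp (cubic_exponent x) * D x + B"
      by (simp add: mult.commute)
    moreover have "((\<lambda>x. ?G x + B * x) has_real_derivative exp (cubic_exponent x) * D x + B) (at x)"
      by (rule derivative_eq_intros quadratic_times_exp_deriv refl | simp)+
    ultimately show "\<exists>d. ((\<lambda>x. ?G x + B * x) has_real_derivative d) (at x) \<and> 0 \<le> d"
      by blast
  qed
  moreover have "B * (y - a) \<le> B * (b - a)"
    using assms by (intro mult_left_mono) (auto simp: B_def)
  ultimately show ?thesis
    using start by (simp add: B_def algebra_simps)
qed

lemma quadratic_times_exp_decreasing:
  assumes "y \<le> b"
    and D: "\<And>x. y \<le> x \<Longrightarrow> x \<le> b \<Longrightarrow> D x \<le> 0"
    and "1 \<le> R b * exp (cubic_exponent b)"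
  shows "1 \<le> R y * exp (cubic_exponent y)"
proof -
  have "R b * exp (cubic_exponent b) \<le> R y * exp (cubic_exponent y)"
  proof (rule DERIV_nonpos_imp_nonincreasing[OF \<open>y \<le> b\<close>])
    fix x assume "y \<le> x" "x \<le> b"
    then have "exp (cubic_exponent x) * D x \<le> 0"
      using D by (intro mult_nonneg_nonpos) auto
    then show "\<exists>d. ((\<lambda>y. R y * exp (cubic_exponent y)) has_real_derivative d) (at x) \<and> d \<le> 0"
      using quadratic_times_exp_deriv by blast
  qed
  then show ?thesis
    using assms by simp
qed

lemma quadratic_times_exp_at_ge:
  assumes "0 \<le> e" "e \<le> cubic_exponent a" "0 \<le> R a" "v \<le> R a * (\<Sum>k<n. e ^ k / fact k)"
  shows "v \<le> R a * exp (cubic_exponent a)"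
proof -
  have "(\<Sum>k<n. e ^ k / fact k) \<le> exp (cubic_exponent a)"
    using exp_ge_partial_sum[of e n] assms by (auto intro: order_trans)
  from mult_left_mono[OF this \<open>0 \<le> R a\<close>] show ?thesis
    using assms by linarith
qed

lemma ocs_bound_ge_quadratic:
  assumes "0 \<le> y" "1 \<le> R y * exp (cubic_exponent y)"
  shows "1 - R y \<le> ocs_bound y"
proof -
  have "exp (- cubic_exponent y) \<le> R y"
    using assms(2) by (simp add: exp_minus field_simps)
  then show ?thesis
    using ocs_bound_ge[OF assms(1)] by linarith
qed

end

lemma ocs_bound_ge_parabola_through_0:
  assumes "0 \<le> y"
  shows "y - 0.26 * y ^ 2 \<le> ocs_bound y"
proof -
  have "1 \<le> (1 + (-1) * y + 0.26 * y ^ 2) * exp (cubic_exponent y)"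
  proof (rule quadratic_times_exp_increasing[where a = 0 and b = y and e = 0])
    fix x :: real assume "0 \<le> x"
    \<comment> \<open>After splitting off the factor \<open>x\<close> of \<open>D\<close>, the cubic
      is divided by a square centred near its positive critical point; cofactor and remainder have
      nonnegative coefficients.\<close>
    have "0.52 - 0.2042 * x - 0.2758 * x ^ 2 + 0.139308 * x ^ 3 =
        (x - 1.63) ^ 2 * (0.139308 * x + 0.17834408) + (0.0070742756 * x + 0.046157613848)"
      by (simp add: field_simps power2_eq_square power3_eq_cube)
    then have "0 \<le> 0.52 - 0.2042 * x - 0.2758 * x ^ 2 + 0.139308 * x ^ 3"
      using \<open>0 \<le> x\<close> by simp
    then have "0 \<le> x * (0.52 - 0.2042 * x - 0.2758 * x ^ 2 + 0.139308 * x ^ 3)"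
      using \<open>0 \<le> x\<close> by simp
    then show "- 0 \<le> 1 + -1 + (1 + -1 + 2 * 0.26) * x + (0.5358 * 1 + -1 + 0.26) * x\<^sup>2 +
         (0.5358 * -1 + 0.26) * x ^ 3 + 0.5358 * 0.26 * x ^ 4"
      by (simp add: algebra_simps power2_eq_square power3_eq_cube power4_eq_xxxx)
  qed (use assms in \<open>auto simp: cubic_exponent_def\<close>)
  from ocs_bound_ge_quadratic[OF assms this] show ?thesis
    by simp
qed

text \<open>The product nearly touches 1 twice: it has local minima in \<open>[0.38, 0.39]\<close>
  and \<open>[1.44, 1.45]\<close>, with a local maximum in \<open>[1.05, 1.1]\<close> between them.
  On the other four intervals \<open>D\<close> has a constant sign; on these three it is only
  bounded below by a small negative number.\<close>

lemma ocs_bound_ge_parabola: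
  assumes "0 \<le> y"
  shows "- 0.03 + 1.185 * y - 0.35 * y ^ 2 \<le> ocs_bound y"
proof -
  define R where "R y = 1.03 + (-1.185) * y + 0.35 * y ^ 2" for y :: real
  define D where "D y = -0.155 + 0.545 * y + (-0.283126) * y ^ 2 + (-0.284923) * y ^ 3 + 0.18753 * y ^ 4"
    for y :: real
  note inc = quadratic_times_exp_increasing[of _ y _ _ "1.03" "-1.185" "0.35", folded R_def]
  note dec = quadratic_times_exp_decreasing[of y _ "1.03" "-1.185" "0.35", folded R_def]
  note val = quadratic_times_exp_at_ge[of _ _ "1.03" "-1.185" "0.35", folded R_def]
  have D_eq: "1.03 + - 1.185 + (1.03 + - 1.185 + 2 * 0.35) * x + (0.5358 * 1.03 + - 1.185 + 0.35) * x\<^sup>2 +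
    (0.5358 * - 1.185 + 0.35) * x ^ 3 + 0.5358 * 0.35 * x ^ 4 = D x" for x :: real
    by (simp add: D_def)
  note inc = inc[unfolded D_eq] and dec = dec[unfolded D_eq]
  have exp_le: "exp (cubic_exponent b) \<le> 2.72 ^ n" if "cubic_exponent b \<le> real n" for b n
  proof -
    have "exp (cubic_exponent b) \<le> exp (real n)"
      using that by simp
    also have "\<dots> = exp 1 ^ n"
      by (simp add: exp_of_nat_mult[symmetric])
    also have "\<dots> \<le> 2.72 ^ n"
      using e_less_272 by (intro power_mono) auto
    finally show ?thesis .
  qed
  have v1: "1.0003 \<le> R 0.38 * exp (cubic_exponent 0.38)"
    by (rule val[where n = 8 and e = "0.4620"]) (simp_all add: R_def cubic_exponent_def lessThan_nat_numeral fact_numeral power_divide)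
  have v2: "1.0003 \<le> R 0.39 * exp (cubic_exponent 0.39)"
    by (rule val[where n = 8 and e = "0.4766"]) (simp_all add: R_def cubic_exponent_def lessThan_nat_numeral fact_numeral power_divide)
  have v3: "1.03 \<le> R 1.05 * exp (cubic_exponent 1.05)"
    by (rule val[where n = 9 and e = "1.8080"]) (simp_all add: R_def cubic_exponent_def lessThan_nat_numeral fact_numeral power_divide)
  \<comment> \<open>The exponents at 1.44 and 1.45 lie slightly above 3, so \<open>exp 3\<close> is
    split off and a quadratic Taylor bound covers the rest; the margin there is only about
    0.001.\<close>
  have exp3: "20.0855 \<le> exp (3 :: real)"
    using exp_ge_partial_sum[of 3 16] by (simp add: lessThan_nat_numeral fact_numeral)
  have v4: "1.0012 \<le> R 1.44 * exp (cubic_exponent 1.44)"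
  proof -
    have "20.0855 * 1.01014 \<le> exp 3 * exp (0.01009 :: real)"
      using exp3 exp_lower_Taylor_quadratic[of "0.01009"] by (intro mult_mono) (auto simp: power_divide)
    also have "\<dots> \<le> exp (cubic_exponent 1.44)"
      by (simp add: exp_add[symmetric] cubic_exponent_def power_divide)
    finally have "R 1.44 * (20.0855 * 1.01014) \<le> R 1.44 * exp (cubic_exponent 1.44)"
      by (intro mult_left_mono) (simp_all add: R_def power_divide)
    then show ?thesis
      by (simp add: R_def power_divide)
  qed
  have v5: "1.001 \<le> R 1.45 * exp (cubic_exponent 1.45)"
  proof -
    have "20.0855 * 1.0467 \<le> exp 3 * exp (0.0457 :: real)"
      using exp3 exp_lower_Taylor_quadratic[of "0.0457"] by (intro mult_mono) (auto simp: power_divide)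
    also have "\<dots> \<le> exp (cubic_exponent 1.45)"
      by (simp add: exp_add[symmetric] cubic_exponent_def power_divide)
    finally have "R 1.45 * (20.0855 * 1.0467) \<le> R 1.45 * exp (cubic_exponent 1.45)"
      by (intro mult_left_mono) (simp_all add: R_def power_divide)
    then show ?thesis
      by (simp add: R_def power_divide)
  qed
  consider "y \<le> 0.38" | "0.38 \<le> y" "y \<le> 0.39" | "0.39 \<le> y" "y \<le> 1.05" | "1.05 \<le> y" "y \<le> 1.1"
    | "1.1 \<le> y" "y \<le> 1.44" | "1.44 \<le> y" "y \<le> 1.45" | "1.45 \<le> y"
    using linear[of y "0.38"] linear[of y "0.39"] linear[of y "1.05"] linear[of y "1.1"]
      linear[of y "1.44"] linear[of y "1.45"] by blast
  then have "1 \<le> R y * exp (cubic_exponent y)"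
  proof cases
    case 1
    show ?thesis
    proof (rule dec[OF 1])
      fix x :: real assume "y \<le> x" "x \<le> 0.38"
      then have "0 \<le> 0.155 + (-0.545) * x + 0.283126 * x ^ 2 + 0.284923 * x ^ 3 + (-0.18753) * x ^ 4"
        using assms by - (rule quartic_nonneg_on[OF _ _ refl refl refl refl refl refl, where l = 0 and u = "0.38"],
          simp_all add: power_divide)
      then show "D x \<le> 0"
        by (simp add: D_def)
    qed (use v1 in simp)
  next
    case 2
    show ?thesis
    proof (rule inc[OF _ 2, of "0.00052"])
      fix x :: real assume "0.38 \<le> x" "x \<le> 0.39"
      then have "0 \<le> (-0.15448) + 0.545 * x + (-0.283126) * x ^ 2 + (-0.284923) * x ^ 3 + 0.18753 * x ^ 4"
        by - (rule quartic_nonneg_on[OF _ _ refl refl refl refl refl refl, where l = "0.38" and u = "0.39"],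
          simp_all add: power_divide)
      then show "- 0.00052 \<le> D x"
        by (simp add: D_def)
    next
      show "1 + 0.00052 * exp (cubic_exponent 0.39) * (0.39 - 0.38) \<le> R 0.38 * exp (cubic_exponent 0.38)"
        using v1 exp_le[of "0.39" 1] by (simp add: cubic_exponent_def power_divide)
    qed auto
  next
    case 3
    show ?thesis
    proof (rule inc[OF _ 3, of 0])
      fix x :: real assume "0.39 \<le> x" "x \<le> 1.05"
      then have "0 \<le> (-0.155) + 0.545 * x + (-0.283126) * x ^ 2 + (-0.284923) * x ^ 3 + 0.18753 * x ^ 4"
        by - (rule quartic_nonneg_on[OF _ _ refl refl refl refl refl refl, where l = "0.39" and u = "1.05"],
          simp_all add: power_divide)
      then show "- 0 \<le> D x"
        by (simp add: D_def)
    qed (use v2 in auto)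
  next
    case 4
    show ?thesis
    proof (rule inc[OF _ 4, of "0.003"])
      fix x :: real assume "1.05 \<le> x" "x \<le> 1.1"
      then have "0 \<le> (-0.152) + 0.545 * x + (-0.283126) * x ^ 2 + (-0.284923) * x ^ 3 + 0.18753 * x ^ 4"
        by - (rule quartic_nonneg_on[OF _ _ refl refl refl refl refl refl, where l = "1.05" and u = "1.1"],
          simp_all add: power_divide)
      then show "- 0.003 \<le> D x"
        by (simp add: D_def)
    next
      show "1 + 0.003 * exp (cubic_exponent 1.1) * (1.1 - 1.05) \<le> R 1.05 * exp (cubic_exponent 1.05)"
        using v3 exp_le[of "1.1" 2] by (simp add: cubic_exponent_def power_divide)
    qed auto
  next
    case 5
    show ?thesis
    proof (rule dec[OF 5(2)])
      fix x :: real assume "y \<le> x" "x \<le> 1.44"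
      then have "0 \<le> 0.155 + (-0.545) * x + 0.283126 * x ^ 2 + 0.284923 * x ^ 3 + (-0.18753) * x ^ 4"
        using 5 by - (rule quartic_nonneg_on[OF _ _ refl refl refl refl refl refl, where l = "1.1" and u = "1.44"],
          simp_all add: power_divide)
      then show "D x \<le> 0"
        by (simp add: D_def)
    qed (use v4 in simp)
  next
    case 6
    show ?thesis
    proof (rule inc[OF _ 6, of "0.0018"])
      fix x :: real assume "1.44 \<le> x" "x \<le> 1.45"
      then have "0 \<le> (-0.1532) + 0.545 * x + (-0.283126) * x ^ 2 + (-0.284923) * x ^ 3 + 0.18753 * x ^ 4"
        by - (rule quartic_nonneg_on[OF _ _ refl refl refl refl refl refl, where l = "1.44" and u = "1.45"],
          simp_all add: power_divide)
      then show "- 0.0018 \<le> D x"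
        by (simp add: D_def)
    next
      show "1 + 0.0018 * exp (cubic_exponent 1.45) * (1.45 - 1.44) \<le> R 1.44 * exp (cubic_exponent 1.44)"
        using v4 exp_le[of "1.45" 4] by (simp add: cubic_exponent_def power_divide)
    qed auto
  next
    case 7
    show ?thesis
    proof (rule inc[OF _ 7 order_refl, of 0])
      fix x :: real assume "1.45 \<le> x"
      \<comment> \<open>All Taylor coefficients of \<open>D\<close> at 1.45 are positive, which
        settles the unbounded interval.\<close>
      define t where "t = x - 1.45"
      have x: "x = 1.45 + t"
        by (simp add: t_def)
      have "D x = 0.0003317411875 + 0.2136173625 * t + 0.8431499 * t ^ 2 + 0.802751 * t ^ 3 + 0.18753 * t ^ 4"
        unfolding D_def x by (simp add: field_simps power2_eq_square power3_eq_cube power4_eq_xxxx)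
      then show "- 0 \<le> D x"
        using \<open>1.45 \<le> x\<close> by (simp add: t_def)
    qed (use v5 in auto)
  qed
  from ocs_bound_ge_quadratic[OF assms this[unfolded R_def]] show ?thesis
    by simp
qed

section \<open>Second moments under a Lorenz condition\<close>

text \<open>Abel summation: the surplus of the partial sums of \<open>b\<close> over those of
  \<open>a\<close> is nonnegative and is carried along with the weight \<open>g l\<close>, which can
  only decrease.\<close>

lemma sum_mult_le_by_parts:
  fixes a b g :: "nat \<Rightarrow> real"
  assumes partial: "\<And>l. l \<le> n \<Longrightarrow> (\<Sum>i<l. a i) \<le> (\<Sum>i<l. b i)"
    and decr: "\<And>i j. i \<le> j \<Longrightarrow> j < n \<Longrightarrow> g j \<le> g i"
    and nonneg: "\<And>i. i < n \<Longrightarrow> 0 \<le> g i"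
  shows "(\<Sum>i<n. g i * a i) \<le> (\<Sum>i<n. g i * b i)"
proof -
  have *: "g l * (\<Sum>i<Suc l. b i - a i) \<le> (\<Sum>i<Suc l. g i * (b i - a i))" if "l < n" for l
    using that
  proof (induction l)
    case (Suc l)
    have "g (Suc l) * (\<Sum>i<Suc l. b i - a i) \<le> g l * (\<Sum>i<Suc l. b i - a i)"
      using Suc.prems partial[of "Suc l"] decr[of l "Suc l"]
      by (intro mult_right_mono) (auto simp: sum_subtractf)
    with Suc show ?case
      by (simp add: distrib_left)
  qed simp
  show ?thesis
  proof (cases n)
    case (Suc l)
    have "0 \<le> g l * (\<Sum>i<Suc l. b i - a i)"
      using Suc partial[of "Suc l"] nonneg[of l] by (intro mult_nonneg_nonneg) (auto simp: sum_subtractf)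
    with *[of l] Suc show ?thesis
      by (simp add: right_diff_distrib sum_subtractf)
  qed simp
qed

text \<open>Weighted AM-GM: \<open>x ^ n\<close> is the geometric mean of one \<open>1\<close> and
  \<open>n\<close> copies of \<open>x ^ Suc n\<close>.\<close>

lemma power_le_weighted_mean:
  fixes x :: real
  assumes "0 \<le> x"
  shows "real (Suc n) * x ^ n \<le> 1 + real n * x ^ Suc n"
proof (induction n)
  case (Suc n)
  have "0 \<le> (1 - x) * (1 - x ^ Suc n)"
  proof (cases "x \<le> 1")
    case True
    then show ?thesis
      using assms power_le_one[of x "Suc n"] by (intro mult_nonneg_nonneg) auto
  next
    case False
    then show ?thesis
      using one_le_power[of x "Suc n"] by (intro mult_nonpos_nonpos) auto
  qed
  with mult_left_mono[OF Suc assms] show ?case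
    by (simp add: algebra_simps)
qed simp

text \<open>For \<open>x \<noteq> y\<close> the sum is a secant slope of the \<open>m\<close>-th
  power. Added to its reversal, it is bounded termwise by rearrangement; AM-GM then replaces the
  powers \<open>m - 1\<close> by powers \<open>m\<close>, making the bound affine in
  \<open>x ^ m\<close> and \<open>y ^ m\<close>.\<close>

lemma mixed_power_sum_le:
  fixes x y :: real
  assumes "0 \<le> x" "0 \<le> y"
  shows "(\<Sum>k<m. y ^ (m - Suc k) * x ^ k) \<le> 1 + (real m - 1) * (x ^ m + y ^ m) / 2"
proof (cases m)
  case (Suc n)
  let ?s = "\<Sum>k<m. y ^ (m - Suc k) * x ^ k"
  have "?s = (\<Sum>k<m. y ^ k * x ^ (m - Suc k))"
    by (subst sum.nat_diff_reindex[symmetric]) (auto intro!: sum.cong simp: Suc_diff_Suc)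
  then have "2 * ?s = (\<Sum>k<m. y ^ (m - Suc k) * x ^ k + y ^ k * x ^ (m - Suc k))"
    by (simp add: sum.distrib)
  also have "\<dots> \<le> (\<Sum>k<m. x ^ n + y ^ n)"
  proof (rule sum_mono)
    fix k assume "k \<in> {..<m}"
    then obtain l where l: "n = k + l" "m - Suc k = l"
      using Suc by (metis Suc_diff_Suc diff_Suc_Suc le_add_diff_inverse lessThan_iff less_Suc_eq_le)
    have "0 \<le> (x ^ k - y ^ k) * (x ^ l - y ^ l)"
    proof (cases "x \<le> y")
      case True
      then show ?thesis
        using assms by (intro mult_nonpos_nonpos) (auto intro: power_mono)
    next
      case False
      then show ?thesis
        using assms by (intro mult_nonneg_nonneg) (auto intro: power_mono)
    qed
    then show "y ^ (m - Suc k) * x ^ k + y ^ k * x ^ (m - Suc k) \<le> x ^ n + y ^ n"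
      unfolding l by (simp add: power_add algebra_simps)
  qed
  also have "\<dots> = real (Suc n) * x ^ n + real (Suc n) * y ^ n"
    using Suc by (simp add: algebra_simps)
  also have "\<dots> \<le> 2 + real n * (x ^ m + y ^ m)"
    using power_le_weighted_mean[OF assms(1), of n] power_le_weighted_mean[OF assms(2), of n] Suc
    by (simp add: algebra_simps)
  finally show ?thesis
    using Suc by simp
qed (use assms in simp)

text \<open>Midpoint (Hermite-Hadamard) inequality for the convex function
  \<open>max 0 (r - t)\<close> of \<open>t\<close>: the right-hand side is its integral from
  \<open>a\<close> to \<open>b\<close>.\<close>

lemma diff_times_pos_part_le:
  fixes a b r :: real
  assumes "a \<le> b"
  shows "(b - a) * max 0 (r - (a + b) / 2) \<le> ((max 0 (r - a))\<^sup>2 - (max 0 (r - b))\<^sup>2) / 2"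
proof -
  consider "r \<le> a" | "a \<le> r" "r \<le> b" | "b \<le> r"
    by linarith
  then show ?thesis
  proof cases
    case 1
    then show ?thesis
      using assms by simp
  next
    case 2
    have "(b - a) * (r - (a + b) / 2) \<le> (r - a)\<^sup>2 / 2"
      using zero_le_power2[of "r - b"] by (simp add: power2_eq_square field_simps)
    then have "max 0 ((b - a) * (r - (a + b) / 2)) \<le> (r - a)\<^sup>2 / 2"
      by (simp only: max.bounded_iff) simp
    moreover have "(b - a) * max 0 (r - (a + b) / 2) = max 0 ((b - a) * (r - (a + b) / 2))"
      using assms by (simp add: max_mult_distrib_left)
    ultimately have "(b - a) * max 0 (r - (a + b) / 2) \<le> (r - a)\<^sup>2 / 2"
      by linarith
    then show ?thesis
      using 2 by simp
  next
    case 3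
    then show ?thesis
      using assms by (simp add: max_def power2_eq_square field_simps)
  qed
qed

text \<open>Abel summation is used twice: once with weights \<open>\<phi> i\<close>, which replaces \<open>m * w i * \<phi> i\<close> by the increments
  of \<open>1 - (1 - P l) ^ m\<close>, and once with the excess of the secant slopes \<open>s i\<close> over the threshold \<open>\<kappa>\<close>.\<close>

lemma lorenz_second_moment_seq:
  fixes w \<phi> :: "nat \<Rightarrow> real" and m n :: nat
  defines "P \<equiv> \<lambda>l. \<Sum>i<l. w i"
  assumes w: "\<And>i. i < n \<Longrightarrow> 0 \<le> w i" and Pn: "P n \<le> 1" and "1 \<le> m"
    and decr: "\<And>i j. i \<le> j \<Longrightarrow> j < n \<Longrightarrow> \<phi> j \<le> \<phi> i"
    and \<phi>: "\<And>i. i < n \<Longrightarrow> 0 \<le> \<phi> i"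
    and lorenz: "\<And>l. l \<le> n \<Longrightarrow> real m * (\<Sum>i<l. w i * \<phi> i) \<le> 1 - (1 - P l) ^ m"
  shows "real m * (\<Sum>i<n. w i * (\<phi> i)\<^sup>2) + real m * (real m - 1) / 2 * (\<Sum>i<n. w i * \<phi> i)\<^sup>2
    \<le> real m * (\<Sum>i<n. w i * \<phi> i)"
proof -
  define x where "x l = 1 - P l" for l
  define s where "s i = (\<Sum>k<m. x (Suc i) ^ (m - Suc k) * x i ^ k) / m" for i
  define r where "r = real m * (\<Sum>i<n. w i * \<phi> i)"
  define \<beta> where "\<beta> = (real m - 1) / m"
  \<comment> \<open>The slope \<open>s i\<close> will be bounded by \<open>1 - \<beta> * t\<close>,
    where \<open>t\<close> is the midpoint of \<open>1 - x i ^ m\<close> and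
    \<open>1 - x (Suc i) ^ m\<close>; \<open>\<kappa>\<close> is that bound at \<open>t = r\<close>.
    The heuristic extremal profile exhausts the Lorenz bound up to mass \<open>r\<close> and then
    vanishes, so the slopes are cut there.\<close>
  define \<kappa> where "\<kappa> = 1 - \<beta> * r"
  have "0 \<le> \<beta>" "0 \<le> r"
    using \<open>1 \<le> m\<close> w \<phi> by (auto simp: \<beta>_def r_def intro!: mult_nonneg_nonneg sum_nonneg)
  have x_mono: "x j \<le> x i" if "i \<le> j" "j \<le> n" for i j
    using that w by (auto simp: x_def P_def intro!: sum_mono2)
  have x_nonneg: "0 \<le> x i" if "i \<le> n" for i
    using x_mono[OF that] Pn by (simp add: x_def)
  have s_nonneg: "0 \<le> s i" if "i < n" for i
    using that x_nonneg by (auto simp: s_def intro!: divide_nonneg_nonneg sum_nonneg)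
  have s_decr: "s j \<le> s i" if "i \<le> j" "j < n" for i j
    unfolding s_def using that x_nonneg x_mono
    by (intro divide_right_mono sum_mono mult_mono power_mono) auto
  have jump: "x i ^ m - x (Suc i) ^ m = real m * w i * s i" for i
    using \<open>1 \<le> m\<close> power_diff_sumr2[of "x i" m "x (Suc i)"] by (simp add: s_def x_def P_def)
  have jump_sum: "(\<Sum>i<l. x i ^ m - x (Suc i) ^ m) = 1 - (1 - P l) ^ m" for l
    by (subst sum_lessThan_telescope') (simp add: x_def P_def)
  have partial: "(\<Sum>i<l. real m * w i * \<phi> i) \<le> (\<Sum>i<l. x i ^ m - x (Suc i) ^ m)" if "l \<le> n" for l
    using lorenz[OF that] unfolding jump_sum by (simp add: sum_distrib_left mult.assoc)
  have "real m * (\<Sum>i<n. w i * (\<phi> i)\<^sup>2) = (\<Sum>i<n. \<phi> i * (real m * w i * \<phi> i))"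
    by (simp add: sum_distrib_left power2_eq_square ac_simps)
  also have "\<dots> \<le> (\<Sum>i<n. \<phi> i * (x i ^ m - x (Suc i) ^ m))"
    using partial decr \<phi> by (rule sum_mult_le_by_parts)
  also have "\<dots> = (\<Sum>i<n. real m * w i * \<phi> i * s i)"
    by (simp add: jump ac_simps)
  also have "\<dots> \<le> (\<Sum>i<n. real m * w i * \<phi> i * (\<kappa> + max 0 (s i - \<kappa>)))"
    using w \<phi> by (intro sum_mono mult_left_mono) auto
  also have "\<dots> = \<kappa> * r + (\<Sum>i<n. max 0 (s i - \<kappa>) * (real m * w i * \<phi> i))"
    by (simp add: r_def distrib_left sum.distrib sum_distrib_left ac_simps)
  also have "(\<Sum>i<n. max 0 (s i - \<kappa>) * (real m * w i * \<phi> i))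
      \<le> (\<Sum>i<n. max 0 (s i - \<kappa>) * (x i ^ m - x (Suc i) ^ m))"
    using partial by (intro sum_mult_le_by_parts) (auto intro!: max.coboundedI2 s_decr)
  \<comment> \<open>Each summand is at most \<open>\<beta>\<close> times the integral of
    \<open>max 0 (r - t)\<close> over one increment of \<open>1 - x l ^ m\<close>, so the bounds
    telescope.\<close>
  also have "\<dots> \<le> (\<Sum>i<n. \<beta> * (((max 0 (r - (1 - x i ^ m)))\<^sup>2 - (max 0 (r - (1 - x (Suc i) ^ m)))\<^sup>2) / 2))"
  proof (rule sum_mono)
    fix i assume "i \<in> {..<n}"
    then have i: "i < n" by simp
    define a where "a = 1 - x i ^ m"
    define b where "b = 1 - x (Suc i) ^ m"
    have "a \<le> b"
      using i x_nonneg x_mono by (auto simp: a_def b_def intro!: power_mono)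
    have "s i \<le> (1 + (real m - 1) * (x i ^ m + x (Suc i) ^ m) / 2) / m"
      unfolding s_def using i x_nonneg by (intro divide_right_mono mixed_power_sum_le) auto
    also have "\<dots> = 1 - \<beta> * ((a + b) / 2)"
      using \<open>1 \<le> m\<close> by (simp add: a_def b_def \<beta>_def field_simps)
    finally have "s i - \<kappa> \<le> \<beta> * (r - (a + b) / 2)"
      by (simp add: \<kappa>_def algebra_simps)
    then have "max 0 (s i - \<kappa>) \<le> \<beta> * max 0 (r - (a + b) / 2)"
      using \<open>0 \<le> \<beta>\<close> by (auto simp: max_def mult_nonneg_nonneg intro: order_trans mult_left_mono
          dest: mult_nonneg_nonpos[of \<beta> "r - (a + b) / 2"])
    from mult_right_mono[OF this, of "b - a"]
    have "max 0 (s i - \<kappa>) * (b - a) \<le> \<beta> * ((b - a) * max 0 (r - (a + b) / 2))"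
      using \<open>a \<le> b\<close> by (simp only: mult.assoc mult.commute[of "max 0 (r - (a + b) / 2)"])
    also have "\<dots> \<le> \<beta> * (((max 0 (r - a))\<^sup>2 - (max 0 (r - b))\<^sup>2) / 2)"
      using \<open>0 \<le> \<beta>\<close> \<open>a \<le> b\<close> by (intro mult_left_mono diff_times_pos_part_le)
    finally show "max 0 (s i - \<kappa>) * (x i ^ m - x (Suc i) ^ m)
        \<le> \<beta> * (((max 0 (r - (1 - x i ^ m)))\<^sup>2 - (max 0 (r - (1 - x (Suc i) ^ m)))\<^sup>2) / 2)"
      by (simp add: a_def b_def)
  qed
  also have "\<dots> = \<beta> / 2 * ((max 0 (r - (1 - x 0 ^ m)))\<^sup>2 - (max 0 (r - (1 - x n ^ m)))\<^sup>2)"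
    by (subst sum_lessThan_telescope'[symmetric]) (simp add: sum_distrib_left)
  also have "\<dots> \<le> \<beta> / 2 * r\<^sup>2"
    using \<open>0 \<le> \<beta>\<close> \<open>0 \<le> r\<close> by (intro mult_left_mono) (auto simp: x_def P_def max_def)
  finally have "real m * (\<Sum>i<n. w i * (\<phi> i)\<^sup>2) \<le> r - \<beta> * r\<^sup>2 / 2"
    by (simp add: \<kappa>_def power2_eq_square algebra_simps)
  moreover have "\<beta> * r\<^sup>2 / 2 = real m * (real m - 1) / 2 * (\<Sum>i<n. w i * \<phi> i)\<^sup>2"
    using \<open>1 \<le> m\<close> by (simp add: \<beta>_def r_def power2_eq_square)
  ultimately show ?thesis
    by (simp add: r_def)
qed

text \<open>In the application \<open>w\<close> is the law of the types, \<open>\<phi> a\<close> the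
  conditional probability that a given vertex of type \<open>a\<close> is matched to
  \<open>u\<close>, and \<open>1 - (1 - sum w A) ^ m\<close> the chance that one of \<open>m\<close>
  vertices has a type in \<open>A\<close>. After sorting by decreasing \<open>\<phi>\<close>, the
  hypothesis is applied to the prefixes.\<close>

lemma lorenz_second_moment:
  fixes w \<phi> :: "'a \<Rightarrow> real"
  assumes "finite S" and w: "\<And>a. a \<in> S \<Longrightarrow> 0 \<le> w a" and "sum w S \<le> 1" and "1 \<le> m"
    and \<phi>: "\<And>a. a \<in> S \<Longrightarrow> 0 \<le> \<phi> a"
    and lorenz: "\<And>A. A \<subseteq> S \<Longrightarrow> real m * (\<Sum>a\<in>A. w a * \<phi> a) \<le> 1 - (1 - sum w A) ^ m"
  shows "real m * (\<Sum>a\<in>S. w a * (\<phi> a)\<^sup>2) + real m * (real m - 1) / 2 * (\<Sum>a\<in>S. w a * \<phi> a)\<^sup>2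
    \<le> real m * (\<Sum>a\<in>S. w a * \<phi> a)"
proof -
  obtain ys where ys: "set ys = S" "distinct ys"
    using finite_distinct_list[OF \<open>finite S\<close>] by blast
  define xs where "xs = sort_key (\<lambda>a. - \<phi> a) ys"
  have xs: "set xs = S" "distinct xs" "sorted (map (\<lambda>a. - \<phi> a) xs)"
    using ys by (auto simp: xs_def)
  have sum_prefix: "(\<Sum>i<l. f (xs ! i)) = sum f ((!) xs ` {..<l})" if "l \<le> length xs" for l and f :: "'a \<Rightarrow> real"
    using xs(2) that by (subst sum.reindex) (auto simp: inj_on_def nth_eq_iff_index_eq)
  have all: "(!) xs ` {..<length xs} = S"
    using xs(1) by (auto simp: set_conv_nth)
  have sub: "(!) xs ` {..<l} \<subseteq> S" if "l \<le> length xs" for l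
    using that all by auto
  have "real m * (\<Sum>i<length xs. w (xs ! i) * (\<phi> (xs ! i))\<^sup>2)
      + real m * (real m - 1) / 2 * (\<Sum>i<length xs. w (xs ! i) * \<phi> (xs ! i))\<^sup>2
    \<le> real m * (\<Sum>i<length xs. w (xs ! i) * \<phi> (xs ! i))"
  proof (rule lorenz_second_moment_seq)
    show "(\<Sum>i<length xs. w (xs ! i)) \<le> 1"
      using \<open>sum w S \<le> 1\<close> by (simp add: sum_prefix all)
    show "\<phi> (xs ! j) \<le> \<phi> (xs ! i)" if "i \<le> j" "j < length xs" for i j
      using sorted_nth_mono[OF xs(3), of i j] that by simp
    show "real m * (\<Sum>i<l. w (xs ! i) * \<phi> (xs ! i)) \<le> 1 - (1 - (\<Sum>i<l. w (xs ! i))) ^ m"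
      if "l \<le> length xs" for l
      using lorenz[OF sub[OF that]] sum_prefix[OF that, of w] sum_prefix[OF that, of "\<lambda>a. w a * \<phi> a"] by simp
  qed (use w \<phi> xs(1) \<open>1 \<le> m\<close> in \<open>auto simp: set_conv_nth\<close>)
  then show ?thesis
    unfolding sum_prefix[OF order_refl, of "\<lambda>a. w a * (\<phi> a)\<^sup>2"]
      sum_prefix[OF order_refl, of "\<lambda>a. w a * \<phi> a"] all .
qed

section \<open>Tensor products of averaging operators\<close>

locale finite_pmf =
  fixes \<pi> :: "'t pmf"
  assumes finite_support: "finite (set_pmf \<pi>)"
begin

text \<open>Type sequences are total functions on \<open>nat\<close>, so that averaging out a
  coordinate is a function update and every expectation an iterated finite average.\<close>

definition avg :: "nat \<Rightarrow> ((nat \<Rightarrow> 't) \<Rightarrow> real) \<Rightarrow> (nat \<Rightarrow> 't) \<Rightarrow> real" where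
  "avg i f t = (\<Sum>a\<in>set_pmf \<pi>. pmf \<pi> a * f (t(i := a)))"

lemma sum_pmf_support: "(\<Sum>a\<in>set_pmf \<pi>. pmf \<pi> a) = 1"
  using finite_support by (rule sum_pmf_eq_1) simp

lemma avg_add: "avg i (\<lambda>t. f t + g t) t = avg i f t + avg i g t"
  by (simp add: avg_def distrib_left sum.distrib)

lemma avg_diff: "avg i (\<lambda>t. f t - g t) t = avg i f t - avg i g t"
  by (simp add: avg_def right_diff_distrib sum_subtractf)

lemma avg_scale: "avg i (\<lambda>t. r * f t) t = r * avg i f t"
  by (simp add: avg_def sum_distrib_left ac_simps)

lemma avg_const_coord:
  assumes "\<And>a. f (t(i := a)) = f t"
  shows "avg i f t = f t"
  using assms by (simp add: avg_def sum_distrib_right[symmetric] sum_pmf_support)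

lemma avg_mono: "(\<And>t. f t \<le> g t) \<Longrightarrow> avg i f t \<le> avg i g t"
  by (auto simp: avg_def intro!: sum_mono mult_left_mono)

lemma avg_upd [simp]: "avg i f (t(i := a)) = avg i f t"
  by (simp add: avg_def)

lemma avg_avg: "avg i (avg i f) = avg i f"
  by (rule ext) (simp add: avg_const_coord)

lemma avg_commute: "avg i (avg j f) = avg j (avg i f)"
proof (cases "i = j")
  case False
  show ?thesis
  proof
    fix t
    have "avg i (avg j f) t = (\<Sum>a\<in>set_pmf \<pi>. \<Sum>b\<in>set_pmf \<pi>. pmf \<pi> a * (pmf \<pi> b * f (t(i := a, j := b))))"
      by (simp add: avg_def sum_distrib_left)
    also have "\<dots> = (\<Sum>b\<in>set_pmf \<pi>. \<Sum>a\<in>set_pmf \<pi>. pmf \<pi> a * (pmf \<pi> b * f (t(i := a, j := b))))"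
      by (rule sum.swap)
    also have "\<dots> = avg j (avg i f) t"
      using False by (simp add: avg_def sum_distrib_left fun_upd_twist ac_simps)
    finally show "avg i (avg j f) t = avg j (avg i f) t" .
  qed
qed simp

text \<open>The operators are described by their eigenvalues: \<open>\<alpha> i\<close> on the functions with mean zero in
  coordinate \<open>i\<close> and \<open>\<gamma> i\<close> on the functions that do not depend on coordinate \<open>i\<close>.\<close>

definition step ::
    "(nat \<Rightarrow> real) \<Rightarrow> (nat \<Rightarrow> real) \<Rightarrow> nat \<Rightarrow> ((nat \<Rightarrow> 't) \<Rightarrow> real) \<Rightarrow> (nat \<Rightarrow> 't) \<Rightarrow> real" where
  "step \<alpha> \<gamma> i f t = \<alpha> i * (f t - avg i f t) + \<gamma> i * avg i f t"

lemma step_add: "step \<alpha> \<gamma> i (\<lambda>t. f t + g t) = (\<lambda>t. step \<alpha> \<gamma> i f t + step \<alpha> \<gamma> i g t)"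
  by (rule ext) (simp add: step_def avg_add algebra_simps)

lemma step_scale: "step \<alpha> \<gamma> i (\<lambda>t. r * f t) = (\<lambda>t. r * step \<alpha> \<gamma> i f t)"
  by (rule ext) (simp add: step_def avg_scale algebra_simps)

lemma avg_step: "avg i (step \<alpha> \<gamma> j f) = step \<alpha> \<gamma> j (avg i f)"
proof
  fix t
  have "avg i (step \<alpha> \<gamma> j f) t
      = \<alpha> j * (avg i f t - avg i (avg j f) t) + \<gamma> j * avg i (avg j f) t"
    unfolding step_def by (simp add: avg_add avg_scale avg_diff)
  then show "avg i (step \<alpha> \<gamma> j f) t = step \<alpha> \<gamma> j (avg i f) t"
    by (simp add: step_def avg_commute[of i j])
qed

lemma step_commute: "step \<alpha> \<gamma> i (step \<alpha>' \<gamma>' j f) = step \<alpha>' \<gamma>' j (step \<alpha> \<gamma> i f)"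
proof
  fix t
  show "step \<alpha> \<gamma> i (step \<alpha>' \<gamma>' j f) t = step \<alpha>' \<gamma>' j (step \<alpha> \<gamma> i f) t"
    unfolding step_def[of \<alpha> \<gamma> i "step \<alpha>' \<gamma>' j f"] step_def[of \<alpha>' \<gamma>' j "step \<alpha> \<gamma> i f"] avg_step
    by (simp add: step_def avg_commute[of i j] algebra_simps)
qed

lemma step_step: "step \<alpha> \<gamma> i (step \<alpha>' \<gamma>' i f) = step (\<lambda>i. \<alpha> i * \<alpha>' i) (\<lambda>i. \<gamma> i * \<gamma>' i) i f"
proof
  fix t
  show "step \<alpha> \<gamma> i (step \<alpha>' \<gamma>' i f) t = step (\<lambda>i. \<alpha> i * \<alpha>' i) (\<lambda>i. \<gamma> i * \<gamma>' i) i f t"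
    unfolding step_def[of \<alpha> \<gamma> i "step \<alpha>' \<gamma>' i f"] avg_step
    by (simp add: step_def avg_avg algebra_simps)
qed

text \<open>The steps commute, so the fold is the tensor product of one-coordinate operators in any
  order. Composition multiplies eigenvalues, which turns operator identities into
  arithmetic.\<close>

definition tensor ::
    "(nat \<Rightarrow> real) \<Rightarrow> (nat \<Rightarrow> real) \<Rightarrow> nat set \<Rightarrow> ((nat \<Rightarrow> 't) \<Rightarrow> real) \<Rightarrow> (nat \<Rightarrow> 't) \<Rightarrow> real" where
  "tensor \<alpha> \<gamma> A f = Finite_Set.fold (step \<alpha> \<gamma>) f A"

sublocale step: comp_fun_commute "step \<alpha> \<gamma>" for \<alpha> \<gamma>
  by unfold_locales (simp add: fun_eq_iff step_commute)

lemma tensor_empty [simp]: "tensor \<alpha> \<gamma> {} f = f"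
  by (simp add: tensor_def)

lemma tensor_insert:
  "finite A \<Longrightarrow> i \<notin> A \<Longrightarrow> tensor \<alpha> \<gamma> (insert i A) f = step \<alpha> \<gamma> i (tensor \<alpha> \<gamma> A f)"
  by (simp add: tensor_def)

lemma tensor_insert2:
  "finite A \<Longrightarrow> i \<notin> A \<Longrightarrow> tensor \<alpha> \<gamma> (insert i A) f = tensor \<alpha> \<gamma> A (step \<alpha> \<gamma> i f)"
  unfolding tensor_def by (rule step.fold_insert2)

lemma tensor_cong:
  assumes "finite A" "\<And>i. i \<in> A \<Longrightarrow> \<alpha> i = \<alpha>' i" "\<And>i. i \<in> A \<Longrightarrow> \<gamma> i = \<gamma>' i"
  shows "tensor \<alpha> \<gamma> A f = tensor \<alpha>' \<gamma>' A f"
  using assms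
proof (induction A rule: finite_induct)
  case (insert i A)
  then have "tensor \<alpha> \<gamma> A f = tensor \<alpha>' \<gamma>' A f"
    by simp
  with insert show ?case
    by (simp add: tensor_insert step_def)
qed simp

lemma tensor_add:
  "finite A \<Longrightarrow> tensor \<alpha> \<gamma> A (\<lambda>t. f t + g t) = (\<lambda>t. tensor \<alpha> \<gamma> A f t + tensor \<alpha> \<gamma> A g t)"
  by (induction A rule: finite_induct) (simp_all add: tensor_insert step_add)

lemma tensor_scale:
  "finite A \<Longrightarrow> tensor \<alpha> \<gamma> A (\<lambda>t. r * f t) = (\<lambda>t. r * tensor \<alpha> \<gamma> A f t)"
  by (induction A rule: finite_induct) (simp_all add: tensor_insert step_scale)

lemma tensor_zero: "finite A \<Longrightarrow> tensor \<alpha> \<gamma> A (\<lambda>t. 0) = (\<lambda>t. 0)"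
  using tensor_scale[of A \<alpha> \<gamma> 0] by simp

lemma tensor_sum:
  assumes "finite A"
  shows "tensor \<alpha> \<gamma> A (\<lambda>t. \<Sum>x\<in>X. f x t) = (\<lambda>t. \<Sum>x\<in>X. tensor \<alpha> \<gamma> A (f x) t)"
  using assms by (induction X rule: infinite_finite_induct) (simp_all add: tensor_zero tensor_add)

lemma step_tensor:
  "finite A \<Longrightarrow> step \<alpha> \<gamma> i (tensor \<alpha>' \<gamma>' A f) = tensor \<alpha>' \<gamma>' A (step \<alpha> \<gamma> i f)"
  by (induction A rule: finite_induct) (simp_all add: tensor_insert step_commute[of \<alpha> \<gamma> i])

lemma tensor_tensor:
  assumes "finite A"
  shows "tensor \<alpha> \<gamma> A (tensor \<alpha>' \<gamma>' A f) = tensor (\<lambda>i. \<alpha> i * \<alpha>' i) (\<lambda>i. \<gamma> i * \<gamma>' i) A f"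
  using assms
  by (induction A rule: finite_induct)
    (simp_all add: tensor_insert step_tensor[symmetric] step_step mult.commute)

lemma tensor_upd_averaged:
  assumes "finite A" "j \<in> A" "\<alpha> j = 0"
  shows "tensor \<alpha> \<gamma> A f (t(j := a)) = tensor \<alpha> \<gamma> A f t"
proof -
  have "tensor \<alpha> \<gamma> A f = step \<alpha> \<gamma> j (tensor \<alpha> \<gamma> (A - {j}) f)"
    using tensor_insert[of "A - {j}" j] assms by (simp add: insert_absorb)
  then show ?thesis
    using assms by (simp add: step_def)
qed

lemma avg_permute:
  assumes "bij p"
  shows "avg (p i) (\<lambda>t. f (t \<circ> p)) = (\<lambda>t. avg i f (t \<circ> p))"
proof
  fix t :: "nat \<Rightarrow> 't"
  have "(t(p i := a)) \<circ> p = (t \<circ> p)(i := a)" for a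
    using assms by (auto simp: fun_eq_iff bij_def inj_eq)
  then show "avg (p i) (\<lambda>t. f (t \<circ> p)) t = avg i f (t \<circ> p)"
    by (simp add: avg_def)
qed

lemma tensor_permute:
  assumes "finite A" "bij p"
  shows "tensor \<alpha> \<gamma> (p ` A) (\<lambda>t. f (t \<circ> p)) = (\<lambda>t. tensor (\<alpha> \<circ> p) (\<gamma> \<circ> p) A f (t \<circ> p))"
  using assms(1)
proof (induction A rule: finite_induct)
  case (insert i A)
  have "p i \<notin> p ` A"
    using insert assms(2) by (auto simp: bij_def inj_eq)
  have "tensor \<alpha> \<gamma> (p ` insert i A) (\<lambda>t. f (t \<circ> p))
      = step \<alpha> \<gamma> (p i) (\<lambda>t. tensor (\<alpha> \<circ> p) (\<gamma> \<circ> p) A f (t \<circ> p))"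
    unfolding image_insert tensor_insert[OF finite_imageI[OF insert(1)] \<open>p i \<notin> p ` A\<close>] insert.IH ..
  also have "\<dots> = (\<lambda>t. step (\<alpha> \<circ> p) (\<gamma> \<circ> p) i (tensor (\<alpha> \<circ> p) (\<gamma> \<circ> p) A f) (t \<circ> p))"
    by (simp add: step_def fun_eq_iff avg_permute[OF assms(2), of i "tensor (\<alpha> \<circ> p) (\<gamma> \<circ> p) A f"])
  finally show ?case
    unfolding tensor_insert[OF insert(1,2)] .
qed simp

section \<open>Expectation, noise operators and Efron-Stein components\<close>

definition mean :: "nat set \<Rightarrow> ((nat \<Rightarrow> 't) \<Rightarrow> real) \<Rightarrow> (nat \<Rightarrow> 't) \<Rightarrow> real" where
  "mean A = tensor (\<lambda>_. 0) (\<lambda>_. 1) A"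

text \<open>For \<open>0 \<le> \<rho> i \<le> 1\<close>: coordinate \<open>i\<close> is kept with
  probability \<open>\<rho> i\<close> and resampled otherwise.\<close>

definition noise :: "(nat \<Rightarrow> real) \<Rightarrow> nat set \<Rightarrow> ((nat \<Rightarrow> 't) \<Rightarrow> real) \<Rightarrow> (nat \<Rightarrow> 't) \<Rightarrow> real" where
  "noise \<rho> = tensor \<rho> (\<lambda>_. 1)"

text \<open>For \<open>T \<subseteq> A\<close> this is the Efron-Stein (Hoeffding) component at
  \<open>T\<close>: mean zero in every coordinate of \<open>T\<close>, constant in the other
  coordinates of \<open>A\<close>.\<close>

definition part :: "nat set \<Rightarrow> nat set \<Rightarrow> ((nat \<Rightarrow> 't) \<Rightarrow> real) \<Rightarrow> (nat \<Rightarrow> 't) \<Rightarrow> real" where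
  "part T = tensor (\<lambda>i. of_bool (i \<in> T)) (\<lambda>i. of_bool (i \<notin> T))"

lemma step_mean: "step (\<lambda>_. 0) (\<lambda>_. 1) i f = avg i f"
  by (simp add: step_def fun_eq_iff)

lemma mean_empty [simp]: "mean {} f = f"
  by (simp add: mean_def)

lemma mean_insert: "finite A \<Longrightarrow> i \<notin> A \<Longrightarrow> mean (insert i A) f = avg i (mean A f)"
  by (simp add: mean_def tensor_insert step_mean)

lemma mean_insert2: "finite A \<Longrightarrow> i \<notin> A \<Longrightarrow> mean (insert i A) f = mean A (avg i f)"
  by (simp add: mean_def tensor_insert2 step_mean)

lemma mean_avg:
  assumes "finite A" "i \<in> A"
  shows "mean A (avg i f) = mean A f"
  using mean_insert2[of "A - {i}" i] assms by (simp add: insert_absorb avg_avg)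

lemma mean_mono:
  assumes "finite A" "\<And>t. f t \<le> g t"
  shows "mean A f t \<le> mean A g t"
  using assms by (induction A arbitrary: t rule: finite_induct) (auto simp: mean_insert intro!: avg_mono)

lemma mean_const: "finite A \<Longrightarrow> mean A (\<lambda>t. r) t = r"
  by (induction A arbitrary: t rule: finite_induct) (auto simp: mean_insert avg_const_coord fun_eq_iff)

lemma mean_nonneg: "finite A \<Longrightarrow> (\<And>t. 0 \<le> f t) \<Longrightarrow> 0 \<le> mean A f t"
  using mean_mono[of A "\<lambda>_. 0" f t] mean_const[of A 0 t] by simp

lemmas mean_add = tensor_add[of _ "\<lambda>_. 0" "\<lambda>_. 1", folded mean_def]
  and mean_scale = tensor_scale[of _ "\<lambda>_. 0" "\<lambda>_. 1", folded mean_def]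
  and mean_sum = tensor_sum[of _ "\<lambda>_. 0" "\<lambda>_. 1", folded mean_def]

lemma mean_upd: "finite A \<Longrightarrow> j \<in> A \<Longrightarrow> mean A f (t(j := a)) = mean A f t"
  unfolding mean_def by (rule tensor_upd_averaged) auto

lemma mean_eq_noise:
  assumes "finite N" "A \<subseteq> N"
  shows "mean A f = noise (\<lambda>i. of_bool (i \<notin> A)) N f"
proof -
  have fin: "finite A"
    using assms finite_subset by blast
  have "noise (\<lambda>i. of_bool (i \<notin> A)) (A \<union> B) f = mean A f" if "finite B" "B \<inter> A = {}" for B
    using that
  proof (induction B rule: finite_induct)
    case empty
    show ?case
      by (simp add: mean_def noise_def) (rule tensor_cong, use fin in auto)
  next
    case (insert i B)
    then show ?case
      using fin by (simp add: noise_def tensor_insert step_def)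
  qed
  from this[of "N - A"] show ?thesis
    using assms by (simp add: Un_absorb1 Int_commute)
qed

lemma noise_nonneg:
  assumes "finite A" "\<And>i. i \<in> A \<Longrightarrow> 0 \<le> \<rho> i \<and> \<rho> i \<le> 1" "\<And>t. 0 \<le> f t"
  shows "0 \<le> noise \<rho> A f t"
  using assms(1,2)
proof (induction A arbitrary: t rule: finite_induct)
  case (insert i A)
  then have "\<And>t. 0 \<le> noise \<rho> A f t"
    by auto
  then have "0 \<le> avg i (noise \<rho> A f) t"
    using avg_mono[of "\<lambda>_. 0" "noise \<rho> A f" i t] by (simp add: avg_def)
  moreover have "step \<rho> (\<lambda>_. 1) i f t = \<rho> i * f t + (1 - \<rho> i) * avg i f t" for f t
    by (simp add: step_def algebra_simps)
  ultimately show ?case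
    using insert by (auto simp: noise_def tensor_insert)
qed (use assms in \<open>simp add: noise_def\<close>)

lemma noise_const: "finite A \<Longrightarrow> noise \<rho> A (\<lambda>t. r) t = r"
  by (induction A arbitrary: t rule: finite_induct)
    (auto simp: noise_def tensor_insert step_def avg_const_coord fun_eq_iff)

lemma mean_noise:
  assumes "finite A"
  shows "mean A (noise \<rho> A f) = mean A f"
  unfolding mean_def noise_def tensor_tensor[OF assms] by simp

text \<open>Each \<open>avg i\<close> is an orthogonal projection: averaging either product over
  coordinate \<open>i\<close> yields \<open>avg i f * avg i g\<close>. Steps are linear combinations
  of such a projection and the identity.\<close>

lemma mean_tensor_adjoint:
  assumes "finite N" "A \<subseteq> N"
  shows "mean N (\<lambda>t. f t * tensor \<alpha> \<gamma> A g t) = mean N (\<lambda>t. tensor \<alpha> \<gamma> A f t * g t)"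
proof -
  have avg: "mean N (\<lambda>t. f t * avg i g t) = mean N (\<lambda>t. avg i f t * g t)" if "i \<in> N" for i f g
  proof -
    have "avg i (\<lambda>t. f t * avg i g t) = (\<lambda>t. avg i f t * avg i g t)" for f g
      by (simp add: avg_def fun_eq_iff sum_distrib_right mult.assoc)
    from mean_avg[OF assms(1) that, of "\<lambda>t. f t * avg i g t"]
      mean_avg[OF assms(1) that, of "\<lambda>t. g t * avg i f t"] this[of f g] this[of g f]
    show ?thesis
      by (simp add: mult.commute)
  qed
  have diff: "mean N (\<lambda>t. f t - g t) t = mean N f t - mean N g t" for f g t
    using mean_add[OF assms(1), of f "\<lambda>t. (-1) * g t"] mean_scale[OF assms(1), of "-1" g] by simp
  have step: "mean N (\<lambda>t. f t * step \<alpha> \<gamma> i g t) = mean N (\<lambda>t. step \<alpha> \<gamma> i f t * g t)"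
    if "i \<in> N" for i f g
  proof
    fix t
    have "mean N (\<lambda>t. f t * step \<alpha> \<gamma> i g t) t
        = \<alpha> i * mean N (\<lambda>t. f t * g t) t + (\<gamma> i - \<alpha> i) * mean N (\<lambda>t. f t * avg i g t) t"
      by (simp add: step_def algebra_simps mean_add[OF assms(1)] mean_scale[OF assms(1)] diff)
    also have "\<dots> = \<alpha> i * mean N (\<lambda>t. f t * g t) t + (\<gamma> i - \<alpha> i) * mean N (\<lambda>t. avg i f t * g t) t"
      by (simp only: avg[OF that])
    also have "\<dots> = mean N (\<lambda>t. step \<alpha> \<gamma> i f t * g t) t"
      by (simp add: step_def algebra_simps mean_add[OF assms(1)] mean_scale[OF assms(1)] diff)
    finally show "mean N (\<lambda>t. f t * step \<alpha> \<gamma> i g t) t = mean N (\<lambda>t. step \<alpha> \<gamma> i f t * g t) t" .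
  qed
  have "finite A"
    using assms finite_subset by blast
  then show ?thesis
    using assms(2)
  proof (induction A arbitrary: f g rule: finite_induct)
    case (insert i A)
    then show ?case
      by (simp add: tensor_insert step step_tensor)
  qed simp
qed

text \<open>Expansion of the product over \<open>A\<close> of
  \<open>\<rho> i * (id - avg i) + avg i\<close>; taking the first summand exactly at the
  coordinates in \<open>T\<close> gives \<open>part T A\<close>.\<close>

lemma noise_expansion:
  assumes "finite A"
  shows "noise \<rho> A f t = (\<Sum>T\<in>Pow A. prod \<rho> T * part T A f t)"
  using assms
proof (induction A arbitrary: t rule: finite_induct)
  case empty
  show ?case by (simp add: noise_def part_def)
next
  case (insert i A)
  let ?d = "\<lambda>f t. f t - avg i f t"
  have inj: "inj_on (insert i) (Pow A)"
    using insert by (intro inj_onI) (metis Pow_iff insert_ident subsetD)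
  have notin: "part T (insert i A) f t = avg i (part T A f) t" if "T \<in> Pow A" for T t
    using that insert by (auto simp: part_def tensor_insert step_def)
  have ins: "part (insert i T) (insert i A) f t = ?d (part T A f) t" if "T \<in> Pow A" for T t
  proof -
    have "part (insert i T) A f = part T A f"
      unfolding part_def using insert by (intro tensor_cong) auto
    with insert show ?thesis
      by (simp add: part_def tensor_insert step_def)
  qed
  have IH: "noise \<rho> A f = (\<lambda>t. \<Sum>T\<in>Pow A. prod \<rho> T * part T A f t)"
    using insert.IH by (rule ext)
  have avg_sum: "avg i (\<lambda>t. \<Sum>T\<in>Pow A. g T t) t = (\<Sum>T\<in>Pow A. avg i (g T) t)" for g t
    by (simp add: avg_def sum_distrib_left sum.swap[of _ "Pow A"])
  have "noise \<rho> (insert i A) f t = \<rho> i * ?d (noise \<rho> A f) t + avg i (noise \<rho> A f) t"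
    using insert by (simp add: noise_def tensor_insert step_def)
  also have "avg i (noise \<rho> A f) t = (\<Sum>T\<in>Pow A. prod \<rho> T * avg i (part T A f) t)"
    unfolding IH by (simp add: avg_sum avg_scale)
  also have "\<rho> i * (noise \<rho> A f t - \<dots>) = (\<Sum>T\<in>Pow A. \<rho> i * prod \<rho> T * ?d (part T A f) t)"
    unfolding IH by (simp add: sum_distrib_left sum_subtractf[symmetric] algebra_simps)
  also have "\<dots> = (\<Sum>T\<in>Pow A. prod \<rho> (insert i T) * part (insert i T) (insert i A) f t)"
  proof (rule sum.cong[OF refl])
    fix T assume T: "T \<in> Pow A"
    then have "finite T" "i \<notin> T"
      using insert finite_subset by auto
    with ins[OF T] show "\<rho> i * prod \<rho> T * ?d (part T A f) t
        = prod \<rho> (insert i T) * part (insert i T) (insert i A) f t"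
      by simp
  qed
  also have "\<dots> = (\<Sum>T\<in>insert i ` Pow A. prod \<rho> T * part T (insert i A) f t)"
    using inj by (simp add: sum.reindex)
  finally have "noise \<rho> (insert i A) f t = (\<Sum>T\<in>insert i ` Pow A. prod \<rho> T * part T (insert i A) f t)
      + (\<Sum>T\<in>Pow A. prod \<rho> T * part T (insert i A) f t)"
    by (simp add: notin)
  also have "\<dots> = (\<Sum>T\<in>insert i ` Pow A \<union> Pow A. prod \<rho> T * part T (insert i A) f t)"
    using insert by (subst sum.union_disjoint) auto
  finally show ?case
    by (simp add: Pow_insert Un_commute)
qed

end

section \<open>Covariances of a symmetric selection\<close>

lemma sum_Pow_card:
  fixes g :: "nat \<Rightarrow> real"
  assumes "finite A" "card A \<le> n"
  shows "(\<Sum>T\<in>Pow A. g (card T)) = (\<Sum>k\<le>n. real (card A choose k) * g k)"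
proof -
  have "(\<Sum>T\<in>Pow A. g (card T)) = (\<Sum>k\<le>n. \<Sum>T\<in>{T \<in> Pow A. card T = k}. g (card T))"
    using assms by (intro sum.group[symmetric]) (auto intro: order_trans[OF card_mono])
  also have "\<dots> = (\<Sum>k\<le>n. real (card A choose k) * g k)"
    using n_subsets[OF assms(1)] by (intro sum.cong) auto
  finally show ?thesis .
qed

lemma sum_choose_lessThan: "(\<Sum>i<n. i choose k) = n choose Suc k"
  by (induction n) auto

text \<open>Subsets of size \<open>k + 2\<close> counted by their second largest element
  \<open>i\<close>: \<open>k\<close> elements lie below it and one of \<open>n - 1 - i\<close>
  above.\<close>

lemma sum_choose_times_lessThan: "(\<Sum>i<n. (n - 1 - i) * (i choose k)) = n choose Suc (Suc k)"
proof (induction n)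
  case (Suc n)
  have "(\<Sum>i<Suc n. (Suc n - 1 - i) * (i choose k)) = (\<Sum>i<n. (n - 1 - i) * (i choose k) + (i choose k))"
    by (simp, intro sum.cong refl)
      (metis Suc_diff_Suc add.commute diff_Suc_eq_diff_pred lessThan_iff mult_Suc plus_1_eq_Suc)
  also have "\<dots> = (n choose Suc (Suc k)) + (n choose Suc k)"
    by (simp only: sum.distrib Suc sum_choose_lessThan)
  finally show ?case
    by simp
qed simp

text \<open>The probability that a random set, containing each index independently with probability
  \<open>\<theta>\<close>, includes \<open>X\<close> and misses \<open>Y\<close>. Zero factors in
  \<open>f\<close> and \<open>g\<close> encode the event, and the sum over subsets is an expanded
  product.\<close>

lemma sum_subsets_weight:
  fixes \<theta> :: real
  assumes "finite N" "X \<subseteq> N" "Y \<subseteq> N" "X \<inter> Y = {}"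
  shows "(\<Sum>S\<in>Pow N. \<theta> ^ card S * (1 - \<theta>) ^ card (N - S) * of_bool (X \<subseteq> S \<and> S \<inter> Y = {}))
    = \<theta> ^ card X * (1 - \<theta>) ^ card Y"
proof -
  define f where "f i = \<theta> * of_bool (i \<notin> Y)" for i
  define g where "g i = (1 - \<theta>) * of_bool (i \<notin> X)" for i
  have fin: "finite X" "finite Y"
    using assms finite_subset by blast+
  have f: "prod f S = \<theta> ^ card S * of_bool (S \<inter> Y = {})" if "finite S" for S
    using that by (induction S rule: finite_induct) (auto simp: f_def)
  have g: "prod g S = (1 - \<theta>) ^ card S * of_bool (S \<inter> X = {})" if "finite S" for S
    using that by (induction S rule: finite_induct) (auto simp: g_def)
  have "(\<Sum>S\<in>Pow N. \<theta> ^ card S * (1 - \<theta>) ^ card (N - S) * of_bool (X \<subseteq> S \<and> S \<inter> Y = {}))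
      = (\<Sum>S\<in>Pow N. prod f S * prod g (N - S))"
  proof (rule sum.cong[OF refl])
    fix S assume "S \<in> Pow N"
    then have fin: "finite S" and iff: "(N - S) \<inter> X = {} \<longleftrightarrow> X \<subseteq> S"
      using assms finite_subset by auto
    then show "\<theta> ^ card S * (1 - \<theta>) ^ card (N - S) * of_bool (X \<subseteq> S \<and> S \<inter> Y = {})
        = prod f S * prod g (N - S)"
      unfolding f[OF fin] g[OF finite_Diff[OF assms(1)]] iff of_bool_conj by (simp only: ac_simps)
  qed
  also have "\<dots> = (\<Prod>i\<in>N. f i + g i)"
    using prod_add[OF assms(1), of f g] by simp
  also have "\<dots> = (\<Prod>i\<in>X \<union> Y. f i + g i)"
    using assms by (intro prod.mono_neutral_right) (auto simp: f_def g_def)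
  also have "\<dots> = (\<Prod>i\<in>X. f i + g i) * (\<Prod>i\<in>Y. f i + g i)"
    using fin assms by (intro prod.union_disjoint) auto
  also have "(\<Prod>i\<in>X. f i + g i) = (\<Prod>i\<in>X. \<theta>)"
    using assms by (intro prod.cong) (auto simp: f_def g_def)
  also have "(\<Prod>i\<in>Y. f i + g i) = (\<Prod>i\<in>Y. 1 - \<theta>)"
    using assms by (intro prod.cong) (auto simp: f_def g_def)
  finally show ?thesis
    by simp
qed

text \<open>The values \<open>x1\<close> to \<open>x6\<close> belong to the six orbits of index
  pairs under permutations preserving \<open>T\<close>. Working with real \<open>k - 1\<close> and
  \<open>m - 1\<close> keeps the formula valid for empty \<open>T\<close> or empty
  complement.\<close>

lemma sum_pairs_by_membership:
  fixes F :: "nat \<Rightarrow> nat \<Rightarrow> real"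
  assumes T: "T \<subseteq> {..<n}"
    and "\<And>i. i \<in> T \<Longrightarrow> F i i = x1" "\<And>i j. i \<in> T \<Longrightarrow> j \<in> T \<Longrightarrow> i \<noteq> j \<Longrightarrow> F i j = x2"
    and "\<And>i j. i \<in> T \<Longrightarrow> j < n \<Longrightarrow> j \<notin> T \<Longrightarrow> F i j = x3"
    and "\<And>i j. i < n \<Longrightarrow> i \<notin> T \<Longrightarrow> j \<in> T \<Longrightarrow> F i j = x4"
    and "\<And>i. i < n \<Longrightarrow> i \<notin> T \<Longrightarrow> F i i = x5"
    and "\<And>i j. i < n \<Longrightarrow> i \<notin> T \<Longrightarrow> j < n \<Longrightarrow> j \<notin> T \<Longrightarrow> i \<noteq> j \<Longrightarrow> F i j = x6"
    and k: "k = real (card T)" and m: "m = real n - k"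
  shows "(\<Sum>i<n. \<Sum>j<n. F i j) = k * x1 + k * (k - 1) * x2 + k * m * x3 + m * k * x4 + m * x5 + m * (m - 1) * x6"
proof -
  let ?R = "{..<n} - T"
  have fin: "finite T"
    using T finite_subset by blast
  have cR: "real (card ?R) = m"
    using T fin card_mono[of "{..<n}" T] by (simp add: card_Diff_subset k m of_nat_diff)
  have split: "(\<Sum>i<n. f i) = sum f T + sum f ?R" for f :: "nat \<Rightarrow> real"
    using T by (simp add: sum.subset_diff add.commute)
  have inT: "(\<Sum>j\<in>T. F i j) = x1 + (k - 1) * x2" "(\<Sum>j\<in>?R. F i j) = m * x3" if "i \<in> T" for i
  proof -
    have "(\<Sum>j\<in>T. F i j) = F i i + (\<Sum>j\<in>T - {i}. F i j)"
      using that fin by (simp add: sum.remove)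
    also have "(\<Sum>j\<in>T - {i}. F i j) = (\<Sum>j\<in>T - {i}. x2)"
      using that assms by (intro sum.cong) auto
    also have "1 \<le> card T"
      using that fin by (auto simp: Suc_le_eq card_gt_0_iff)
    then have "(\<Sum>j\<in>T - {i}. x2) = (k - 1) * x2"
      using that fin by (simp add: k of_nat_diff)
    finally show "(\<Sum>j\<in>T. F i j) = x1 + (k - 1) * x2"
      using that assms by simp
    have "(\<Sum>j\<in>?R. F i j) = (\<Sum>j\<in>?R. x3)"
      using that assms by (intro sum.cong) auto
    then show "(\<Sum>j\<in>?R. F i j) = m * x3"
      by (simp add: cR)
  qed
  have inR: "(\<Sum>j\<in>T. F i j) = k * x4" "(\<Sum>j\<in>?R. F i j) = x5 + (m - 1) * x6" if "i \<in> ?R" for i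
  proof -
    have "(\<Sum>j\<in>?R. F i j) = F i i + (\<Sum>j\<in>?R - {i}. F i j)"
      using that by (intro sum.remove) auto
    also have "(\<Sum>j\<in>?R - {i}. F i j) = (\<Sum>j\<in>?R - {i}. x6)"
      using that assms by (intro sum.cong) auto
    also have "1 \<le> card ?R"
      using that by (auto simp: Suc_le_eq card_gt_0_iff)
    then have "(\<Sum>j\<in>?R - {i}. x6) = (real (card ?R) - 1) * x6"
      using that by (simp add: of_nat_diff card_Diff_singleton del: card_Diff_insert)
    finally show "(\<Sum>j\<in>?R. F i j) = x5 + (m - 1) * x6"
      using that assms cR by simp
    have "(\<Sum>j\<in>T. F i j) = (\<Sum>j\<in>T. x4)"
      using that assms by (intro sum.cong) auto
    then show "(\<Sum>j\<in>T. F i j) = k * x4"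
      by (simp add: k)
  qed
  have "(\<Sum>i<n. \<Sum>j<n. F i j) = (\<Sum>i\<in>T. \<Sum>j<n. F i j) + (\<Sum>i\<in>?R. \<Sum>j<n. F i j)"
    by (rule split)
  also have "(\<Sum>i\<in>T. \<Sum>j<n. F i j) = (\<Sum>i\<in>T. x1 + (k - 1) * x2 + m * x3)"
    by (rule sum.cong[OF refl]) (simp only: split[of "F _"] inT)
  also have "(\<Sum>i\<in>?R. \<Sum>j<n. F i j) = (\<Sum>i\<in>?R. k * x4 + (x5 + (m - 1) * x6))"
    by (rule sum.cong[OF refl]) (simp only: split[of "F _"] inR)
  also have "(\<Sum>i\<in>T. x1 + (k - 1) * x2 + m * x3) + (\<Sum>i\<in>?R. k * x4 + (x5 + (m - 1) * x6))
      = k * (x1 + (k - 1) * x2 + m * x3) + m * (k * x4 + (x5 + (m - 1) * x6))"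
    by (simp add: cR k)
  finally show ?thesis
    by (simp add: algebra_simps)
qed

text \<open>Bijections on \<open>{i, j}\<close>, on the rest of \<open>T\<close> and on the rest of
  \<open>N\<close> are glued; the membership equivalences make the cardinalities match.\<close>

lemma ex_permutation:
  assumes "finite N" "T \<subseteq> N" "T' \<subseteq> N" "card T = card T'"
    and "i \<in> N" "j \<in> N" "i' \<in> N" "j' \<in> N"
    and iff: "i \<in> T \<longleftrightarrow> i' \<in> T'" "j \<in> T \<longleftrightarrow> j' \<in> T'" "i = j \<longleftrightarrow> i' = j'"
  obtains p where "p permutes N" "p ` T = T'" "p i = i'" "p j = j'"
proof -
  define X where "X = {i, j}"
  define X' where "X' = {i', j'}"
  have fin: "finite T" "finite T'"
    using assms finite_subset by blast+
  define h where "h x = (if x = i then i' else j')" for x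
  have h: "bij_betw h X X'" "bij_betw h (T \<inter> X) (T' \<inter> X')"
    using iff by (auto simp: bij_betw_def inj_on_def h_def X_def X'_def)
  note c1 = bij_betw_same_card[OF h(2)] and c2 = bij_betw_same_card[OF h(1)]
  have "card (T - X) = card (T' - X')"
    using c1 fin assms by (simp add: card_Diff_subset_Int Int_commute)
  then obtain f where f: "bij_betw f (T - X) (T' - X')"
    using fin by (metis finite_Diff finite_same_card_bij)
  have cU: "card (T \<union> X) = card (T' \<union> X')"
    using c1 c2 fin assms card_Un_Int[of T X] card_Un_Int[of T' X'] by (simp add: X_def X'_def)
  have "card (N - (T \<union> X)) = card (N - (T' \<union> X'))"
    using cU assms fin by (subst (1 2) card_Diff_subset) (auto simp: X_def X'_def)
  then obtain g where g: "bij_betw g (N - (T \<union> X)) (N - (T' \<union> X'))"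
    using assms by (metis finite_Diff finite_same_card_bij)
  define p where "p x = (if x \<in> X then h x else if x \<in> T then f x else if x \<in> N then g x else x)" for x
  have pX: "bij_betw p X X'"
    using h(1) by (rule bij_betw_cong[THEN iffD1, rotated]) (simp add: p_def)
  have pT: "bij_betw p (T - X) (T' - X')"
    using f by (rule bij_betw_cong[THEN iffD1, rotated]) (simp add: p_def)
  have pN: "bij_betw p (N - (T \<union> X)) (N - (T' \<union> X'))"
    using g by (rule bij_betw_cong[THEN iffD1, rotated]) (simp add: p_def)
  have XN: "X \<subseteq> N" "X' \<subseteq> N"
    using assms by (auto simp: X_def X'_def)
  have "bij_betw p (X \<union> (T - X)) (X' \<union> (T' - X'))"
    using pX pT by (rule bij_betw_combine) auto
  then have "bij_betw p (X \<union> (T - X) \<union> (N - (T \<union> X))) (X' \<union> (T' - X') \<union> (N - (T' \<union> X')))"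
    using pN by (rule bij_betw_combine) auto
  moreover have "X \<union> (T - X) \<union> (N - (T \<union> X)) = N" "X' \<union> (T' - X') \<union> (N - (T' \<union> X')) = N"
    using XN assms by auto
  ultimately have "bij_betw p N N"
    by simp
  then have perm: "p permutes N"
    by (rule bij_imp_permutes) (use XN assms in \<open>auto simp: p_def\<close>)
  have pij: "p i = i'" "p j = j'"
    using iff by (auto simp: p_def X_def h_def)
  have "p ` T = p ` (T - X) \<union> p ` (T \<inter> X)"
    by auto
  also have "p ` (T - X) = T' - X'"
    using pT by (simp add: bij_betw_def)
  also have "p ` (T \<inter> X) = T' \<inter> X'"
    using iff pij by (auto simp: X_def X'_def)
  finally have "p ` T = T'"
    by auto
  with perm pij that show thesis
    by blast
qed

section \<open>Level covariances of an exchangeable family\<close>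

locale symmetric_selection = finite_pmf \<pi> for \<pi> :: "'t pmf" +
  fixes n :: nat and z :: "nat \<Rightarrow> (nat \<Rightarrow> 't) \<Rightarrow> real"
  assumes z_nonneg: "\<And>i t. 0 \<le> z i t"
    and sum_z_le: "\<And>t. (\<Sum>i<n. z i t) \<le> 1"
    and z_permute: "\<And>p i t. p permutes {..<n} \<Longrightarrow> i < n \<Longrightarrow> z (p i) t = z i (t \<circ> p)"
begin

text \<open>\<open>mean {..<n} f\<close> does not depend on the coordinates below \<open>n\<close>;
  the base point only fixes those from \<open>n\<close> on.\<close>

definition expect :: "((nat \<Rightarrow> 't) \<Rightarrow> real) \<Rightarrow> real" where
  "expect f = mean {..<n} f (\<lambda>_. undefined)"

lemma expect_add: "expect (\<lambda>t. f t + g t) = expect f + expect g"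
  by (simp add: expect_def mean_add)

lemma expect_scale: "expect (\<lambda>t. r * f t) = r * expect f"
  by (simp add: expect_def mean_scale)

lemma expect_sum: "expect (\<lambda>t. \<Sum>x\<in>X. f x t) = (\<Sum>x\<in>X. expect (f x))"
  by (simp add: expect_def mean_sum)

lemma expect_mono: "(\<And>t. f t \<le> g t) \<Longrightarrow> expect f \<le> expect g"
  unfolding expect_def by (intro mean_mono) auto

lemma expect_nonneg: "(\<And>t. 0 \<le> f t) \<Longrightarrow> 0 \<le> expect f"
  unfolding expect_def by (intro mean_nonneg) auto

lemma expect_tensor_adjoint:
  "expect (\<lambda>t. f t * tensor \<alpha> \<gamma> {..<n} g t) = expect (\<lambda>t. tensor \<alpha> \<gamma> {..<n} f t * g t)"
  unfolding expect_def using mean_tensor_adjoint[of "{..<n}" "{..<n}"] by simp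

lemma expect_noise: "expect (noise \<rho> {..<n} f) = expect f"
  by (simp add: expect_def mean_noise)

lemma expect_mean:
  assumes "A \<subseteq> {..<n}"
  shows "expect (mean A f) = expect f"
  using assms by (simp add: mean_eq_noise[of "{..<n}"] expect_noise)

lemma expect_permute:
  assumes "p permutes {..<n}"
  shows "expect (\<lambda>t. f (t \<circ> p)) = expect f"
proof -
  have "mean (p ` {..<n}) (\<lambda>t. f (t \<circ> p)) = (\<lambda>t. mean {..<n} f (t \<circ> p))"
    unfolding mean_def using assms by (subst tensor_permute) (auto simp: permutes_bij comp_def)
  then show ?thesis
    using assms by (simp add: expect_def permutes_image comp_def)
qed

text \<open>Inner product of the components at \<open>T\<close>; since \<open>part T {..<n}\<close>
  is self-adjoint and idempotent, projecting one factor is enough.\<close>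

definition cov :: "nat set \<Rightarrow> ((nat \<Rightarrow> 't) \<Rightarrow> real) \<Rightarrow> ((nat \<Rightarrow> 't) \<Rightarrow> real) \<Rightarrow> real" where
  "cov T f g = expect (\<lambda>t. part T {..<n} f t * g t)"

lemma part_part: "part T {..<n} (part T {..<n} f) = part T {..<n} f"
  unfolding part_def by (subst tensor_tensor) (simp_all add: of_bool_conj[symmetric])

lemma cov_part: "cov T f g = expect (\<lambda>t. part T {..<n} f t * part T {..<n} g t)"
proof -
  have "expect (\<lambda>t. part T {..<n} f t * part T {..<n} g t) = expect (\<lambda>t. part T {..<n} (part T {..<n} f) t * g t)"
    unfolding part_def by (rule expect_tensor_adjoint)
  then show ?thesis
    by (simp add: part_part cov_def)
qed

lemma cov_commute: "cov T f g = cov T g f"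
  unfolding cov_part by (simp add: mult.commute)

lemma cov_nonneg: "0 \<le> cov T f f"
  unfolding cov_part by (rule expect_nonneg) simp

lemma cov_sum_right: "cov T f (\<lambda>t. \<Sum>x\<in>X. r x * g x t) = (\<Sum>x\<in>X. r x * cov T f (g x))"
  by (simp add: cov_def sum_distrib_left mult.left_commute[of _ "r _"] expect_sum expect_scale)

lemma cov_sum_sum:
  "cov T (\<lambda>t. \<Sum>x\<in>X. r x * f x t) (\<lambda>t. \<Sum>x\<in>X. r x * f x t)
    = (\<Sum>x\<in>X. \<Sum>y\<in>X. r x * r y * cov T (f x) (f y))"
  unfolding cov_sum_right
  by (subst cov_commute) (simp add: cov_sum_right sum_distrib_left mult.assoc cov_commute[of T "f _" "f _"])

lemma expect_noise_mult:
  "expect (\<lambda>t. noise \<rho> {..<n} f t * g t) = (\<Sum>T\<in>Pow {..<n}. prod \<rho> T * cov T f g)"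
  by (simp add: noise_expansion cov_def sum_distrib_right mult.assoc expect_sum expect_scale)

lemma expect_mean_mult:
  assumes "A \<subseteq> {..<n}"
  shows "expect (\<lambda>t. mean A f t * g t) = (\<Sum>T\<in>Pow {..<n}. of_bool (T \<inter> A = {}) * cov T f g)"
proof -
  have "prod (\<lambda>i. of_bool (i \<notin> A)) T = (of_bool (T \<inter> A = {}) :: real)" if "T \<in> Pow {..<n}" for T
  proof -
    have "finite T"
      using that finite_subset by auto
    then show ?thesis
      by (induction T rule: finite_induct) auto
  qed
  then show ?thesis
    using assms by (simp add: mean_eq_noise[of "{..<n}"] expect_noise_mult)
qed

lemma cov_permute:
  assumes p: "p permutes {..<n}" and "i < n" "j < n"
  shows "cov (p ` T) (z (p i)) (z (p j)) = cov T (z i) (z j)"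
proof -
  have "part (p ` T) (p ` {..<n}) (\<lambda>t. z i (t \<circ> p)) = (\<lambda>t. part T {..<n} (z i) (t \<circ> p))"
    unfolding part_def using p
    by (subst tensor_permute) (auto simp: permutes_bij comp_def inj_image_mem_iff permutes_inj)
  moreover have "z (p i) = (\<lambda>t. z i (t \<circ> p))"
    using z_permute[OF p \<open>i < n\<close>] by blast
  ultimately have "part (p ` T) {..<n} (z (p i)) = (\<lambda>t. part T {..<n} (z i) (t \<circ> p))"
    using p by (simp only: permutes_image)
  moreover have "z (p j) = (\<lambda>t. z j (t \<circ> p))"
    using z_permute[OF p \<open>j < n\<close>] by blast
  ultimately show ?thesis
    using expect_permute[OF p, of "\<lambda>t. part T {..<n} (z i) t * z j t"] by (simp add: cov_def)
qed

text \<open>The transposition of \<open>i\<close> and \<open>j\<close> fixes \<open>T\<close> and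
  exchanges \<open>z i\<close> with \<open>z j\<close>, while a component at \<open>T\<close>
  ignores coordinates outside \<open>T\<close>. Hence one number \<open>cov_out\<close> covers equal
  and distinct outside indices.\<close>

lemma part_z_outside:
  assumes "i < n" "j < n" "i \<notin> T" "j \<notin> T"
  shows "part T {..<n} (z i) = part T {..<n} (z j)"
proof -
  let ?p = "Transposition.transpose i j"
  have p: "?p permutes {..<n}"
    using assms by (intro permutes_swap_id) auto
  have "?p ` T = T"
    using assms by (simp add: transpose_image_eq)
  moreover have "part (?p ` T) (?p ` {..<n}) (\<lambda>t. z i (t \<circ> ?p)) = (\<lambda>t. part T {..<n} (z i) (t \<circ> ?p))"
    unfolding part_def using p
    by (subst tensor_permute) (auto simp: permutes_bij comp_def inj_image_mem_iff permutes_inj)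
  moreover have "z j = (\<lambda>t. z i (t \<circ> ?p))"
    using z_permute[OF p \<open>i < n\<close>] by auto
  moreover have "part T {..<n} (z i) (t \<circ> ?p) = part T {..<n} (z i) t" for t
  proof -
    have "t \<circ> ?p = t(i := t j, j := t i)"
      by (auto simp: fun_eq_iff Transposition.transpose_def)
    then show ?thesis
      unfolding part_def using assms by (simp add: tensor_upd_averaged)
  qed
  ultimately show ?thesis
    using p by (simp add: permutes_image)
qed

lemma cov_eq:
  assumes "T \<subseteq> {..<n}" "T' \<subseteq> {..<n}" "card T = card T'"
    and "i < n" "j < n" "i' < n" "j' < n"
    and "i \<in> T \<longleftrightarrow> i' \<in> T'" "j \<in> T \<longleftrightarrow> j' \<in> T'" "i = j \<longleftrightarrow> i' = j'"
  shows "cov T (z i) (z j) = cov T' (z i') (z j')"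
proof -
  obtain p where "p permutes {..<n}" "p ` T = T'" "p i = i'" "p j = j'"
    by (rule ex_permutation[of "{..<n}" T T' i j i' j']) (use assms in auto)
  then show ?thesis
    using cov_permute[of p i j T] assms by simp
qed

text \<open>By symmetry \<open>cov T (z i) (z j)\<close> only depends on \<open>card T\<close> and on which of \<open>i\<close>, \<open>j\<close> lie in \<open>T\<close>.\<close>

definition cov_in :: "nat \<Rightarrow> real" where
  "cov_in k = cov {..<k} (z 0) (z 0)"

definition cov_in_in :: "nat \<Rightarrow> real" where
  "cov_in_in k = cov {..<k} (z 0) (z 1)"

definition cov_in_out :: "nat \<Rightarrow> real" where
  "cov_in_out k = cov {..<k} (z 0) (z k)"

definition cov_out :: "nat \<Rightarrow> real" where
  "cov_out k = cov {..<k} (z k) (z k)"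

context
  fixes T :: "nat set"
  assumes T: "T \<subseteq> {..<n}"
begin

lemma card_le_n: "card T \<le> n"
  using card_mono[OF _ T] by simp

lemma card_less_n: "i < n \<Longrightarrow> i \<notin> T \<Longrightarrow> card T < n"
  using psubset_card_mono[of "{..<n}" T] T by auto

lemma finite_T: "finite T"
  using T finite_subset by blast

lemma cov_in_eq:
  assumes "i \<in> T"
  shows "cov T (z i) (z i) = cov_in (card T)"
  unfolding cov_in_def using assms T card_le_n finite_T
  by (intro cov_eq) (auto simp: card_gt_0_iff)

lemma cov_in_in_eq:
  assumes "i \<in> T" "j \<in> T" "i \<noteq> j"
  shows "cov T (z i) (z j) = cov_in_in (card T)"
proof -
  have "card {i, j} \<le> card T"
    using assms finite_T by (intro card_mono) auto
  then have "2 \<le> card T"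
    using assms by simp
  then show ?thesis
    unfolding cov_in_in_def using assms T card_le_n
    by (intro cov_eq) auto
qed

lemma cov_in_out_eq:
  assumes "i \<in> T" "j < n" "j \<notin> T"
  shows "cov T (z i) (z j) = cov_in_out (card T)" "cov T (z j) (z i) = cov_in_out (card T)"
proof -
  show "cov T (z i) (z j) = cov_in_out (card T)"
    unfolding cov_in_out_def using assms T card_less_n[of j] finite_T
    by (intro cov_eq) (auto simp: card_gt_0_iff)
  then show "cov T (z j) (z i) = cov_in_out (card T)"
    by (simp add: cov_commute)
qed

lemma cov_out_eq:
  assumes "i < n" "i \<notin> T" "j < n" "j \<notin> T"
  shows "cov T (z i) (z j) = cov_out (card T)"
proof -
  have "cov T (z i) (z j) = cov T (z i) (z i)"
    unfolding cov_part using part_z_outside[of i j T] assms by simp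
  also have "\<dots> = cov_out (card T)"
    unfolding cov_out_def using assms T card_less_n[of i]
    by (intro cov_eq) auto
  finally show ?thesis .
qed

lemmas cov_eqs = cov_in_eq cov_in_in_eq cov_in_out_eq cov_out_eq

end

end

section \<open>Linear constraints on the covariances\<close>

lemma prod_one_on_const:
  fixes \<theta> :: real
  assumes "finite T"
  shows "(\<Prod>l\<in>T. if l \<in> X then 1 else \<theta>) = \<theta> ^ card (T - X)"
  using assms by (simp add: prod.If_cases Diff_eq)

context finite_pmf
begin

lemma mean_const_coords:
  assumes "finite A" "\<And>j t a. j \<in> A \<Longrightarrow> f (t(j := a)) = f t"
  shows "mean A f = f"
  using assms
proof (induction A rule: finite_induct)
  case (insert i A)
  have "mean A f = f"
    by (rule insert.IH, rule insert.prems) simp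
  then show ?case
    unfolding mean_insert[OF insert(1,2)]
    by (intro ext) (simp add: avg_const_coord insert.prems del: fun_upd_apply)
qed simp

lemma mean_mult_const_coords:
  assumes "finite A" "\<And>j t a. j \<in> A \<Longrightarrow> f (t(j := a)) = f t"
  shows "mean A (\<lambda>t. f t * g t) t = f t * mean A g t"
  using assms
proof (induction A arbitrary: t rule: finite_induct)
  case (insert i A)
  have upd: "f (t(i := a)) = f t" for a
    by (rule insert.prems) simp
  have "mean A (\<lambda>t. f t * g t) = (\<lambda>t. f t * mean A g t)"
    by (rule ext, rule insert.IH) (rule insert.prems, simp)
  then show ?case
    unfolding mean_insert[OF insert(1,2)] by (simp add: avg_def upd sum_distrib_left mult.left_commute)
qed simp

lemma mean_prod:
  assumes "finite A"
  shows "mean A (\<lambda>t. \<Prod>i\<in>A. g (t i)) t = (\<Sum>a\<in>set_pmf \<pi>. pmf \<pi> a * g a) ^ card A"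
  using assms
proof (induction A arbitrary: t rule: finite_induct)
  case (insert i A)
  have "mean A (\<lambda>t. g (t i) * (\<Prod>i\<in>A. g (t i))) = (\<lambda>t. g (t i) * mean A (\<lambda>t. \<Prod>i\<in>A. g (t i)) t)"
    using insert by (intro ext mean_mult_const_coords) auto
  with insert show ?case
    by (simp add: mean_insert avg_def sum_distrib_right mult.assoc)
qed simp

end

context symmetric_selection
begin

definition total :: real where
  "total = (\<Sum>i<n. expect (z i))"

text \<open>Coordinates \<open>i\<close> and \<open>j\<close> are kept and all others kept with
  probability \<open>\<theta>\<close>; this averaging preserves nonnegativity, so its image of
  \<open>z i\<close> times \<open>z j\<close> has nonnegative mean. The exponent is
  \<open>card (T - {i, j})\<close>, and where natural subtraction truncates, the factor
  \<open>k\<close> or \<open>k * (k - 1)\<close> vanishes.\<close>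

lemma nonneg_constraint:
  assumes \<theta>: "0 \<le> \<theta>" "\<theta> \<le> 1"
  shows "0 \<le> (\<Sum>k\<le>n. real (n choose k) * (real k * (real k - 1) * (\<theta> ^ (k - 2) * cov_in_in k)
    + 2 * real k * (real n - real k) * (\<theta> ^ (k - 1) * cov_in_out k)
    + (real n - real k) * (real n - real k - 1) * (\<theta> ^ k * cov_out k)))"
proof -
  define F where "F T i j = (if i = j then 0 else \<theta> ^ card (T - {i, j}) * cov T (z i) (z j))" for T i j
  have nonneg: "0 \<le> (\<Sum>T\<in>Pow {..<n}. F T i j)" for i j
  proof (cases "i = j")
    case False
    have "0 \<le> expect (\<lambda>t. noise (\<lambda>l. if l \<in> {i, j} then 1 else \<theta>) {..<n} (z i) t * z j t)"
      using \<theta> by (intro expect_nonneg mult_nonneg_nonneg noise_nonneg z_nonneg) auto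
    also have "\<dots> = (\<Sum>T\<in>Pow {..<n}. F T i j)"
      unfolding expect_noise_mult using False
      by (intro sum.cong refl) (simp add: F_def prod_one_on_const[OF finite_T] del: insert_iff)
    finally show ?thesis .
  qed (simp add: F_def)
  have "0 \<le> (\<Sum>i<n. \<Sum>j<n. \<Sum>T\<in>Pow {..<n}. F T i j)"
    by (rule sum_nonneg, rule sum_nonneg, rule nonneg)
  also have "\<dots> = (\<Sum>i<n. \<Sum>T\<in>Pow {..<n}. \<Sum>j<n. F T i j)"
    by (intro sum.cong refl sum.swap)
  also have "\<dots> = (\<Sum>T\<in>Pow {..<n}. \<Sum>i<n. \<Sum>j<n. F T i j)"
    by (rule sum.swap)
  also have "\<dots> = (\<Sum>T\<in>Pow {..<n}. real (card T) * (real (card T) - 1) * (\<theta> ^ (card T - 2) * cov_in_in (card T))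
    + 2 * real (card T) * (real n - real (card T)) * (\<theta> ^ (card T - 1) * cov_in_out (card T))
    + (real n - real (card T)) * (real n - real (card T) - 1) * (\<theta> ^ card T * cov_out (card T)))"
  proof (rule sum.cong[OF refl])
    fix T assume "T \<in> Pow {..<n}"
    then have T: "T \<subseteq> {..<n}" by simp
    have "(\<Sum>i<n. \<Sum>j<n. F T i j) = real (card T) * 0
      + real (card T) * (real (card T) - 1) * (\<theta> ^ (card T - 2) * cov_in_in (card T))
      + real (card T) * (real n - real (card T)) * (\<theta> ^ (card T - 1) * cov_in_out (card T))
      + (real n - real (card T)) * real (card T) * (\<theta> ^ (card T - 1) * cov_in_out (card T))
      + (real n - real (card T)) * 0
      + (real n - real (card T)) * (real n - real (card T) - 1) * (\<theta> ^ card T * cov_out (card T))"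
      by (rule sum_pairs_by_membership[OF T])
        (auto simp: F_def cov_eqs[OF T] card_Diff_insert finite_T[OF T] numeral_2_eq_2
          intro: arg_cong2[of _ _ _ _ "\<lambda>x. cov x"])
    then show "(\<Sum>i<n. \<Sum>j<n. F T i j) = real (card T) * (real (card T) - 1) * (\<theta> ^ (card T - 2) * cov_in_in (card T))
    + 2 * real (card T) * (real n - real (card T)) * (\<theta> ^ (card T - 1) * cov_in_out (card T))
    + (real n - real (card T)) * (real n - real (card T) - 1) * (\<theta> ^ card T * cov_out (card T))"
      by (simp add: algebra_simps)
  qed
  also have "\<dots> = (\<Sum>k\<le>n. real (card {..<n} choose k) * (real k * (real k - 1) * (\<theta> ^ (k - 2) * cov_in_in k)
    + 2 * real k * (real n - real k) * (\<theta> ^ (k - 1) * cov_in_out k)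
    + (real n - real k) * (real n - real k - 1) * (\<theta> ^ k * cov_out k)))"
    by (rule sum_Pow_card) auto
  finally show ?thesis
    by simp
qed

text \<open>Smoothed \<open>z i\<close> is nonnegative and is multiplied by the sum of all
  \<open>z j\<close>, which is at most 1. Only coordinate \<open>i\<close> is fully kept, hence the
  two different powers of \<open>\<theta>\<close> at \<open>cov_in_out\<close>.\<close>

lemma total_constraint:
  assumes \<theta>: "0 \<le> \<theta>" "\<theta> \<le> 1"
  shows "(\<Sum>k\<le>n. real (n choose k) * (real k * (\<theta> ^ (k - 1) * cov_in k)
      + real k * (real k - 1) * (\<theta> ^ (k - 1) * cov_in_in k)
      + real k * (real n - real k) * (\<theta> ^ (k - 1) * cov_in_out k)
      + (real n - real k) * real k * (\<theta> ^ k * cov_in_out k)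
      + (real n - real k) * (\<theta> ^ k * cov_out k)
      + (real n - real k) * (real n - real k - 1) * (\<theta> ^ k * cov_out k))) \<le> total"
proof -
  define F where "F T i j = \<theta> ^ card (T - {i}) * cov T (z i) (z j)" for T i j
  let ?N = "\<lambda>i. noise (\<lambda>l. if l \<in> {i} then 1 else \<theta>) {..<n} (z i)"
  have "(\<Sum>j<n. \<Sum>T\<in>Pow {..<n}. F T i j) \<le> expect (z i)" for i
  proof -
    have "(\<Sum>j<n. \<Sum>T\<in>Pow {..<n}. F T i j) = (\<Sum>j<n. expect (\<lambda>t. ?N i t * z j t))"
      unfolding expect_noise_mult
      by (intro sum.cong refl) (simp add: F_def prod_one_on_const[OF finite_T] del: insert_iff)
    also have "\<dots> = expect (\<lambda>t. ?N i t * (\<Sum>j<n. z j t))"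
      by (simp add: sum_distrib_left expect_sum)
    also have "\<dots> \<le> expect (?N i)"
      using \<theta> by (intro expect_mono mult_left_le noise_nonneg sum_z_le z_nonneg) auto
    finally show ?thesis
      by (simp add: expect_noise)
  qed
  then have "(\<Sum>i<n. \<Sum>j<n. \<Sum>T\<in>Pow {..<n}. F T i j) \<le> total"
    unfolding total_def by (intro sum_mono)
  moreover have "(\<Sum>i<n. \<Sum>j<n. \<Sum>T\<in>Pow {..<n}. F T i j) = (\<Sum>i<n. \<Sum>T\<in>Pow {..<n}. \<Sum>j<n. F T i j)"
    by (intro sum.cong refl sum.swap)
  moreover have "\<dots> = (\<Sum>T\<in>Pow {..<n}. \<Sum>i<n. \<Sum>j<n. F T i j)"
    by (rule sum.swap)
  moreover have "\<dots> = (\<Sum>T\<in>Pow {..<n}. real (card T) * (\<theta> ^ (card T - 1) * cov_in (card T))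
      + real (card T) * (real (card T) - 1) * (\<theta> ^ (card T - 1) * cov_in_in (card T))
      + real (card T) * (real n - real (card T)) * (\<theta> ^ (card T - 1) * cov_in_out (card T))
      + (real n - real (card T)) * real (card T) * (\<theta> ^ card T * cov_in_out (card T))
      + (real n - real (card T)) * (\<theta> ^ card T * cov_out (card T))
      + (real n - real (card T)) * (real n - real (card T) - 1) * (\<theta> ^ card T * cov_out (card T)))"
  proof (rule sum.cong[OF refl])
    fix T assume "T \<in> Pow {..<n}"
    then have T: "T \<subseteq> {..<n}" by simp
    show "(\<Sum>i<n. \<Sum>j<n. F T i j) = real (card T) * (\<theta> ^ (card T - 1) * cov_in (card T))
      + real (card T) * (real (card T) - 1) * (\<theta> ^ (card T - 1) * cov_in_in (card T))
      + real (card T) * (real n - real (card T)) * (\<theta> ^ (card T - 1) * cov_in_out (card T))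
      + (real n - real (card T)) * real (card T) * (\<theta> ^ card T * cov_in_out (card T))
      + (real n - real (card T)) * (\<theta> ^ card T * cov_out (card T))
      + (real n - real (card T)) * (real n - real (card T) - 1) * (\<theta> ^ card T * cov_out (card T))"
      by (rule sum_pairs_by_membership[OF T]) (auto simp: F_def cov_eqs[OF T] finite_T[OF T])
  qed
  moreover note sum_Pow_card[of "{..<n}" n "\<lambda>k. real k * (\<theta> ^ (k - 1) * cov_in k)
      + real k * (real k - 1) * (\<theta> ^ (k - 1) * cov_in_in k)
      + real k * (real n - real k) * (\<theta> ^ (k - 1) * cov_in_out k)
      + (real n - real k) * real k * (\<theta> ^ k * cov_in_out k)
      + (real n - real k) * (\<theta> ^ k * cov_out k)
      + (real n - real k) * (real n - real k - 1) * (\<theta> ^ k * cov_out k)"]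
  ultimately show ?thesis
    by simp
qed

text \<open>Once the other vertices of \<open>Q\<close> are averaged out, exchangeability makes the
  conditional match probability at type \<open>a\<close> the same for every vertex of
  \<open>Q\<close>; a transposition shows it.\<close>

lemma mean_z_upd:
  assumes Q: "Q \<subseteq> {..<n}" and ij: "i \<in> Q" "j \<in> Q"
  shows "mean (Q - {j}) (z j) (t(j := a)) = mean (Q - {i}) (z i) (t(i := a))"
proof (cases "i = j")
  case False
  let ?p = "Transposition.transpose i j"
  have p: "?p permutes {..<n}"
    using assms by (intro permutes_swap_id) auto
  have fin: "finite (Q - {i})"
    using Q finite_subset by blast
  have img: "?p ` (Q - {i}) = Q - {j}"
    using False ij by (auto simp: Transposition.transpose_def image_iff split: if_splits)
  have zj: "z j = (\<lambda>t. z i (t \<circ> ?p))"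
    using z_permute[OF p, of i] assms by auto
  have "mean (?p ` (Q - {i})) (\<lambda>t. z i (t \<circ> ?p)) = (\<lambda>t. mean (Q - {i}) (z i) (t \<circ> ?p))"
    unfolding mean_def using p fin by (subst tensor_permute) (auto simp: permutes_bij comp_def)
  then have "mean (Q - {j}) (z j) (t(j := a)) = mean (Q - {i}) (z i) (t(j := a) \<circ> ?p)"
    unfolding img zj by simp
  also have "t(j := a) \<circ> ?p = t(i := a, j := t i)"
    using False by (auto simp: fun_eq_iff Transposition.transpose_def)
  also have "mean (Q - {i}) (z i) (t(i := a, j := t i)) = mean (Q - {i}) (z i) (t(i := a))"
    by (rule mean_upd[OF fin]) (use False ij in simp)
  finally show ?thesis .
qed simp

text \<open>With the coordinates outside \<open>Q\<close> fixed, \<open>lorenz_second_moment\<close>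
  applies to \<open>m = card Q\<close>, the type law and the common conditional match probability
  \<open>\<phi> t\<close>; the result is integrated over \<open>t\<close>.\<close>

lemma lorenz_mean:
  assumes Q: "Q \<subseteq> {..<n}"
  shows "(\<Sum>i\<in>Q. expect (\<lambda>t. (mean (Q - {i}) (z i) t)\<^sup>2))
    + (\<Sum>i\<in>Q. \<Sum>j\<in>Q - {i}. expect (\<lambda>t. mean Q (z i) t * mean Q (z j) t)) / 2
    \<le> (\<Sum>i\<in>Q. expect (z i))"
proof (cases "Q = {}")
  case False
  then obtain i0 where i0: "i0 \<in> Q" by blast
  have fin: "finite Q"
    using Q finite_subset by blast
  define m where "m = card Q"
  have "1 \<le> m"
    using fin False by (simp add: m_def Suc_le_eq card_gt_0_iff)
  define \<phi> where "\<phi> t a = mean (Q - {i0}) (z i0) (t(i0 := a))" for t a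
  have \<phi>: "mean (Q - {i}) (z i) (t(i := a)) = \<phi> t a" if "i \<in> Q" for i t a
    unfolding \<phi>_def using Q i0 that by (rule mean_z_upd)
  have mean_Q: "mean Q f t = avg i (mean (Q - {i}) f) t" if "i \<in> Q" for i f t
    using mean_insert[of "Q - {i}" i f] fin that by (simp add: insert_absorb)
  have mean_z: "mean Q (z i) t = (\<Sum>a\<in>set_pmf \<pi>. pmf \<pi> a * \<phi> t a)" if "i \<in> Q" for i t
    using that by (simp add: mean_Q[OF that] avg_def \<phi>)
  have mean_sq: "mean Q (\<lambda>t. (mean (Q - {i}) (z i) t)\<^sup>2) t = (\<Sum>a\<in>set_pmf \<pi>. pmf \<pi> a * (\<phi> t a)\<^sup>2)"
    if "i \<in> Q" for i t
  proof -
    have "mean (Q - {i}) (\<lambda>t. (mean (Q - {i}) (z i) t)\<^sup>2) = (\<lambda>t. (mean (Q - {i}) (z i) t)\<^sup>2)"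
      using fin by (intro mean_const_coords) (auto simp: mean_upd)
    then show ?thesis
      using that by (simp add: mean_Q[OF that] avg_def \<phi>)
  qed
  have lorenz: "real m * (\<Sum>a\<in>A. pmf \<pi> a * \<phi> t a) \<le> 1 - (1 - sum (pmf \<pi>) A) ^ m"
    if A: "A \<subseteq> set_pmf \<pi>" for A t
  proof -
    have single: "mean Q (\<lambda>t. of_bool (t i \<in> A) * z i t) t = (\<Sum>a\<in>A. pmf \<pi> a * \<phi> t a)" if "i \<in> Q" for i
    proof -
      have "mean (Q - {i}) (\<lambda>t. of_bool (t i \<in> A) * z i t) s = of_bool (s i \<in> A) * mean (Q - {i}) (z i) s" for s
        using fin by (intro mean_mult_const_coords) auto
      then have "mean Q (\<lambda>t. of_bool (t i \<in> A) * z i t) t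
          = (\<Sum>a\<in>set_pmf \<pi>. of_bool (a \<in> A) * (pmf \<pi> a * \<phi> t a))"
        using that by (simp add: mean_Q[OF that] avg_def \<phi> mult.left_commute)
      also have "\<dots> = (\<Sum>a\<in>A. pmf \<pi> a * \<phi> t a)"
        using A finite_support by (intro sum.mono_neutral_cong_right) auto
      finally show ?thesis .
    qed
    have "real m * (\<Sum>a\<in>A. pmf \<pi> a * \<phi> t a) = (\<Sum>i\<in>Q. mean Q (\<lambda>t. of_bool (t i \<in> A) * z i t) t)"
      by (simp add: single m_def)
    also have "\<dots> = mean Q (\<lambda>t. \<Sum>i\<in>Q. of_bool (t i \<in> A) * z i t) t"
      by (simp only: mean_sum[OF fin])
    \<comment> \<open>The sum is at most 1 and vanishes unless some vertex of \<open>Q\<close> has a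
      type in \<open>A\<close>; the right-hand side is the indicator of that event.\<close>
    also have "\<dots> \<le> mean Q (\<lambda>t. 1 + (-1) * (\<Prod>i\<in>Q. of_bool (t i \<notin> A))) t"
    proof (rule mean_mono[OF fin])
      fix s
      have "(\<Sum>i\<in>Q. z i s) \<le> (\<Sum>i<n. z i s)"
        using Q z_nonneg by (intro sum_mono2) auto
      then have "(\<Sum>i\<in>Q. of_bool (s i \<in> A) * z i s) \<le> 1"
        using sum_z_le[of s] z_nonneg sum_mono[of Q "\<lambda>i. of_bool (s i \<in> A) * z i s" "\<lambda>i. z i s"]
        by (force simp: of_bool_def)
      then show "(\<Sum>i\<in>Q. of_bool (s i \<in> A) * z i s) \<le> 1 + (-1) * (\<Prod>i\<in>Q. of_bool (s i \<notin> A))"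
      proof (cases "\<exists>i\<in>Q. s i \<in> A")
        case True
        then have "(\<Prod>i\<in>Q. of_bool (s i \<notin> A)) = (0 :: real)"
          using fin by (intro prod_zero) auto
        then show ?thesis
          using \<open>(\<Sum>i\<in>Q. of_bool (s i \<in> A) * z i s) \<le> 1\<close> by simp
      qed simp
    qed
    also have "\<dots> = 1 + (-1) * mean Q (\<lambda>t. \<Prod>i\<in>Q. of_bool (t i \<notin> A)) t"
      using fin by (simp only: mean_add mean_scale mean_const)
    also have "mean Q (\<lambda>t. \<Prod>i\<in>Q. of_bool (t i \<notin> A)) t = (1 - sum (pmf \<pi>) A) ^ m"
    proof -
      have "(\<Sum>a\<in>set_pmf \<pi>. pmf \<pi> a * of_bool (a \<notin> A)) = (\<Sum>a\<in>set_pmf \<pi> - A. pmf \<pi> a)"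
        using finite_support by (intro sum.mono_neutral_cong_right) auto
      also have "\<dots> = 1 - sum (pmf \<pi>) A"
        using A finite_support sum_pmf_support by (simp add: sum_diff)
      finally show ?thesis
        using mean_prod[OF fin, of "\<lambda>a. of_bool (a \<notin> A)" t] by (simp add: m_def)
    qed
    finally show ?thesis
      by simp
  qed
  have pointwise: "(\<Sum>i\<in>Q. mean Q (\<lambda>t. (mean (Q - {i}) (z i) t)\<^sup>2) t)
      + (1 / 2) * (\<Sum>i\<in>Q. \<Sum>j\<in>Q - {i}. mean Q (z i) t * mean Q (z j) t) \<le> (\<Sum>i\<in>Q. mean Q (z i) t)" for t
  proof -
    have "(\<Sum>i\<in>Q. \<Sum>j\<in>Q - {i}. mean Q (z i) t * mean Q (z j) t)
        = real m * (real m - 1) * (\<Sum>a\<in>set_pmf \<pi>. pmf \<pi> a * \<phi> t a)\<^sup>2"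
      using \<open>1 \<le> m\<close> fin by (simp add: mean_z m_def[symmetric] power2_eq_square of_nat_diff)
    moreover have "(\<Sum>i\<in>Q. mean Q (\<lambda>t. (mean (Q - {i}) (z i) t)\<^sup>2) t)
        = real m * (\<Sum>a\<in>set_pmf \<pi>. pmf \<pi> a * (\<phi> t a)\<^sup>2)"
      by (simp add: mean_sq m_def)
    moreover have "(\<Sum>i\<in>Q. mean Q (z i) t) = real m * (\<Sum>a\<in>set_pmf \<pi>. pmf \<pi> a * \<phi> t a)"
      by (simp add: mean_z m_def)
    ultimately show ?thesis
      using lorenz_second_moment[OF finite_support, of "pmf \<pi>" m "\<phi> t"] \<open>1 \<le> m\<close> lorenz[of _ t]
        sum_pmf_support fin by (simp add: \<phi>_def mean_nonneg z_nonneg)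
  qed
  have "(\<Sum>i\<in>Q. expect (mean Q (\<lambda>t. (mean (Q - {i}) (z i) t)\<^sup>2)))
      + (1 / 2) * (\<Sum>i\<in>Q. \<Sum>j\<in>Q - {i}. expect (\<lambda>t. mean Q (z i) t * mean Q (z j) t))
      \<le> (\<Sum>i\<in>Q. expect (mean Q (z i)))"
    using expect_mono[OF pointwise] by (simp only: expect_add expect_scale expect_sum)
  then show ?thesis
    using Q by (simp add: expect_mean)
qed simp

lemma expect_mean_mean:
  assumes "A \<subseteq> {..<n}"
  shows "expect (\<lambda>t. mean A f t * mean A g t) = (\<Sum>T\<in>Pow {..<n}. of_bool (T \<inter> A = {}) * cov T f g)"
proof -
  have "expect (\<lambda>t. mean A f t * mean A g t)
      = expect (\<lambda>t. noise (\<lambda>i. of_bool (i \<notin> A)) {..<n} (noise (\<lambda>i. of_bool (i \<notin> A)) {..<n} f) t * g t)"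
    using assms by (simp add: mean_eq_noise[of "{..<n}"] noise_def expect_tensor_adjoint)
  also have "noise (\<lambda>i. of_bool (i \<notin> A)) {..<n} (noise (\<lambda>i. of_bool (i \<notin> A)) {..<n} f) = mean A f"
    unfolding noise_def using assms
    by (subst tensor_tensor) (auto simp: of_bool_conj[symmetric] mean_eq_noise[of "{..<n}"] noise_def)
  finally show ?thesis
    using assms by (simp add: expect_mean_mult)
qed

text \<open>This is \<open>lorenz_mean\<close> averaged over the complements \<open>Q\<close> of random sets that contain each index independently with
  probability \<open>\<theta>\<close>; the common factor \<open>1 - \<theta>\<close> is cancelled.\<close>

lemma lorenz_constraint:
  assumes \<theta>: "0 \<le> \<theta>" "\<theta> < 1"
  shows "(\<Sum>k\<le>n. real (n choose k) * (real k * (\<theta> ^ (k - 1) * cov_in k)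
      + (real n - real k) * (\<theta> ^ k * cov_out k)
      + (real n - real k) * (real n - real k - 1) * ((1 - \<theta>) / 2 * (\<theta> ^ k * cov_out k)))) \<le> total"
proof -
  define w where "w S = \<theta> ^ card S * (1 - \<theta>) ^ card ({..<n} - S)" for S
  \<comment> \<open>Coefficient of \<open>cov T (z i) (z j)\<close> in \<open>lorenz_mean\<close>
    for \<open>Q = {..<n} - S\<close>: a mean over \<open>Q - {i}\<close> keeps the components with
    \<open>T - {i} \<subseteq> S\<close>, a mean over \<open>Q\<close> those with
    \<open>T \<subseteq> S\<close>. The half is the one in that lemma.\<close>
  define c where "c S T i j = (if i = j then of_bool (T - {i} \<subseteq> S \<and> S \<inter> {i} = {})
      else of_bool (T \<subseteq> S \<and> S \<inter> {i, j} = {}) / 2 :: real)"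
    for S T :: "nat set" and i j
  \<comment> \<open>The \<open>w\<close>-average of \<open>c\<close> times the covariance; one
    factor \<open>1 - \<theta>\<close> arises for each index that \<open>S\<close> must
    miss.\<close>
  define F where "F T i j = (1 - \<theta>) * (if i = j then \<theta> ^ card (T - {i}) * cov T (z i) (z i)
      else if i \<in> T \<or> j \<in> T then 0 else (1 - \<theta>) / 2 * (\<theta> ^ card T * cov T (z i) (z j)))" for T i j
  have S: "(\<Sum>i<n. \<Sum>j<n. \<Sum>T\<in>Pow {..<n}. c S T i j * cov T (z i) (z j))
      \<le> (\<Sum>i<n. of_bool (S \<inter> {i} = {}) * expect (z i))" if "S \<in> Pow {..<n}" for S
  proof -
    let ?Q = "{..<n} - S"
    have diag: "expect (\<lambda>t. (mean (?Q - {i}) (z i) t)\<^sup>2) = (\<Sum>T\<in>Pow {..<n}. c S T i i * cov T (z i) (z i))"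
      if "i \<in> ?Q" for i
    proof -
      have "expect (\<lambda>t. (mean (?Q - {i}) (z i) t)\<^sup>2)
          = (\<Sum>T\<in>Pow {..<n}. of_bool (T \<inter> (?Q - {i}) = {}) * cov T (z i) (z i))"
        unfolding power2_eq_square by (rule expect_mean_mean) auto
      also have "\<dots> = (\<Sum>T\<in>Pow {..<n}. c S T i i * cov T (z i) (z i))"
        using that by (intro sum.cong refl arg_cong2[of _ _ _ _ "(*)"]) (auto simp: c_def of_bool_def)
      finally show ?thesis .
    qed
    have off: "expect (\<lambda>t. mean ?Q (z i) t * mean ?Q (z j) t)
        = 2 * (\<Sum>T\<in>Pow {..<n}. c S T i j * cov T (z i) (z j))" if "i \<in> ?Q" "j \<in> ?Q - {i}" for i j
    proof -
      have "expect (\<lambda>t. mean ?Q (z i) t * mean ?Q (z j) t)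
          = (\<Sum>T\<in>Pow {..<n}. of_bool (T \<inter> ?Q = {}) * cov T (z i) (z j))"
        by (rule expect_mean_mean) auto
      also have "\<dots> = (\<Sum>T\<in>Pow {..<n}. 2 * (c S T i j * cov T (z i) (z j)))"
        using that by (intro sum.cong refl) (auto simp: c_def of_bool_def)
      finally show ?thesis
        by (simp add: sum_distrib_left)
    qed
    have zero: "(\<Sum>T\<in>Pow {..<n}. c S T i j * cov T (z i) (z j)) = 0" if "i \<in> S \<or> j \<in> S" for i j
      using that by (intro sum.neutral) (auto simp: c_def)
    have "(\<Sum>i<n. \<Sum>j<n. \<Sum>T\<in>Pow {..<n}. c S T i j * cov T (z i) (z j))
        = (\<Sum>i\<in>?Q. \<Sum>j\<in>?Q. \<Sum>T\<in>Pow {..<n}. c S T i j * cov T (z i) (z j))"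
      by (rule sum.mono_neutral_cong_right)
        (auto simp: zero intro!: sum.mono_neutral_right)
    also have "\<dots> = (\<Sum>i\<in>?Q. (\<Sum>T\<in>Pow {..<n}. c S T i i * cov T (z i) (z i))
        + (\<Sum>j\<in>?Q - {i}. \<Sum>T\<in>Pow {..<n}. c S T i j * cov T (z i) (z j)))"
      by (intro sum.cong refl sum.remove) auto
    also have "\<dots> = (\<Sum>i\<in>?Q. expect (\<lambda>t. (mean (?Q - {i}) (z i) t)\<^sup>2)
        + (\<Sum>j\<in>?Q - {i}. expect (\<lambda>t. mean ?Q (z i) t * mean ?Q (z j) t)) / 2)"
    proof (rule sum.cong[OF refl])
      fix i assume i: "i \<in> ?Q"
      show "(\<Sum>T\<in>Pow {..<n}. c S T i i * cov T (z i) (z i))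
        + (\<Sum>j\<in>?Q - {i}. \<Sum>T\<in>Pow {..<n}. c S T i j * cov T (z i) (z j))
        = expect (\<lambda>t. (mean (?Q - {i}) (z i) t)\<^sup>2)
        + (\<Sum>j\<in>?Q - {i}. expect (\<lambda>t. mean ?Q (z i) t * mean ?Q (z j) t)) / 2"
        unfolding diag[OF i] sum_divide_distrib by (intro arg_cong2[of _ _ _ _ "(+)"] refl sum.cong) (simp add: off[OF i])
    qed
    also have "\<dots> \<le> (\<Sum>i\<in>?Q. expect (z i))"
      using lorenz_mean[of ?Q] by (simp add: sum.distrib sum_divide_distrib)
    also have "\<dots> = (\<Sum>i<n. of_bool (S \<inter> {i} = {}) * expect (z i))"
      by (rule sum.mono_neutral_cong_left) auto
    finally show ?thesis .
  qed
  have w_nonneg: "0 \<le> w S" for S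
    using \<theta> by (simp add: w_def)
  have w1: "(\<Sum>S\<in>Pow {..<n}. w S * c S T i j) * cov T (z i) (z j) = F T i j"
    if T: "T \<in> Pow {..<n}" and ij: "i < n" "j < n" for T i j
  proof (cases "i = j")
    case True
    have "(\<Sum>S\<in>Pow {..<n}. w S * c S T i j)
        = (\<Sum>S\<in>Pow {..<n}. w S * of_bool (T - {i} \<subseteq> S \<and> S \<inter> {i} = {}))"
      by (simp only: c_def True if_True simp_thms)
    also have "\<dots> = \<theta> ^ card (T - {i}) * (1 - \<theta>) ^ card {i}"
      unfolding w_def by (rule sum_subsets_weight) (use T ij in auto)
    finally show ?thesis
      using True by (simp add: F_def)
  next
    case False
    show ?thesis
    proof (cases "i \<in> T \<or> j \<in> T")
      case True
      then have "(\<Sum>S\<in>Pow {..<n}. w S * c S T i j) = 0"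
        using False by (intro sum.neutral) (auto simp: c_def)
      with True False show ?thesis
        by (simp add: F_def)
    next
      case outside: False
      have "(\<Sum>S\<in>Pow {..<n}. w S * c S T i j)
          = (\<Sum>S\<in>Pow {..<n}. w S * of_bool (T \<subseteq> S \<and> S \<inter> {i, j} = {})) / 2"
        unfolding sum_divide_distrib by (simp only: c_def False if_False times_divide_eq_right)
      also have "(\<Sum>S\<in>Pow {..<n}. w S * of_bool (T \<subseteq> S \<and> S \<inter> {i, j} = {}))
          = \<theta> ^ card T * (1 - \<theta>) ^ card {i, j}"
        unfolding w_def by (rule sum_subsets_weight) (use T ij outside in auto)
      also have "card {i, j} = 2"
        using False by simp
      finally show ?thesis
        using outside False by (simp add: F_def power2_eq_square)
    qed
  qed
  have "(\<Sum>S\<in>Pow {..<n}. w S * (\<Sum>i<n. \<Sum>j<n. \<Sum>T\<in>Pow {..<n}. c S T i j * cov T (z i) (z j)))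
      \<le> (\<Sum>S\<in>Pow {..<n}. w S * (\<Sum>i<n. of_bool (S \<inter> {i} = {}) * expect (z i)))"
    by (intro sum_mono mult_left_mono S w_nonneg)
  also have "\<dots> = (\<Sum>S\<in>Pow {..<n}. \<Sum>i<n. w S * of_bool (S \<inter> {i} = {}) * expect (z i))"
    by (simp only: sum_distrib_left mult.assoc)
  also have "\<dots> = (\<Sum>i<n. \<Sum>S\<in>Pow {..<n}. w S * of_bool (S \<inter> {i} = {}) * expect (z i))"
    by (rule sum.swap)
  also have "\<dots> = (\<Sum>i<n. (1 - \<theta>) * expect (z i))"
  proof (rule sum.cong[OF refl])
    fix i assume "i \<in> {..<n}"
    then show "(\<Sum>S\<in>Pow {..<n}. w S * of_bool (S \<inter> {i} = {}) * expect (z i)) = (1 - \<theta>) * expect (z i)"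
      using sum_subsets_weight[of "{..<n}" "{}" "{i}" \<theta>] by (simp add: w_def sum_distrib_right[symmetric])
  qed
  also have "\<dots> = (1 - \<theta>) * total"
    by (simp add: total_def sum_distrib_left)
  also have "(\<Sum>S\<in>Pow {..<n}. w S * (\<Sum>i<n. \<Sum>j<n. \<Sum>T\<in>Pow {..<n}. c S T i j * cov T (z i) (z j)))
      = (\<Sum>S\<in>Pow {..<n}. \<Sum>i<n. \<Sum>j<n. \<Sum>T\<in>Pow {..<n}. w S * c S T i j * cov T (z i) (z j))"
    by (simp add: sum_distrib_left mult.assoc)
  also have "\<dots> = (\<Sum>i<n. \<Sum>S\<in>Pow {..<n}. \<Sum>j<n. \<Sum>T\<in>Pow {..<n}. w S * c S T i j * cov T (z i) (z j))"
    by (rule sum.swap)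
  also have "\<dots> = (\<Sum>i<n. \<Sum>j<n. \<Sum>S\<in>Pow {..<n}. \<Sum>T\<in>Pow {..<n}. w S * c S T i j * cov T (z i) (z j))"
    by (intro sum.cong refl sum.swap)
  also have "\<dots> = (\<Sum>i<n. \<Sum>j<n. \<Sum>T\<in>Pow {..<n}. \<Sum>S\<in>Pow {..<n}. w S * c S T i j * cov T (z i) (z j))"
    by (intro sum.cong refl sum.swap)
  also have "\<dots> = (\<Sum>i<n. \<Sum>j<n. \<Sum>T\<in>Pow {..<n}. F T i j)"
    by (intro sum.cong refl) (simp add: w1[symmetric] sum_distrib_right)
  also have "\<dots> = (\<Sum>i<n. \<Sum>T\<in>Pow {..<n}. \<Sum>j<n. F T i j)"
    by (intro sum.cong refl sum.swap)
  also have "\<dots> = (\<Sum>T\<in>Pow {..<n}. \<Sum>i<n. \<Sum>j<n. F T i j)"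
    by (rule sum.swap)
  also have "\<dots> = (\<Sum>T\<in>Pow {..<n}. (1 - \<theta>) * (real (card T) * (\<theta> ^ (card T - 1) * cov_in (card T))
      + (real n - real (card T)) * (\<theta> ^ card T * cov_out (card T))
      + (real n - real (card T)) * (real n - real (card T) - 1) * ((1 - \<theta>) / 2 * (\<theta> ^ card T * cov_out (card T)))))"
  proof (rule sum.cong[OF refl])
    fix T assume "T \<in> Pow {..<n}"
    then have T: "T \<subseteq> {..<n}" by simp
    have factor: "k * (u * x) + k * (k - 1) * 0 + k * m * 0 + m * k * 0 + m * (u * y) + m * (m - 1) * (u * v)
        = u * (k * x + m * y + m * (m - 1) * v)" for k m u v x y :: real
      by (simp add: algebra_simps)
    have "(\<Sum>i<n. \<Sum>j<n. F T i j) = real (card T) * ((1 - \<theta>) * (\<theta> ^ (card T - 1) * cov_in (card T)))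
      + real (card T) * (real (card T) - 1) * 0
      + real (card T) * (real n - real (card T)) * 0 + (real n - real (card T)) * real (card T) * 0
      + (real n - real (card T)) * ((1 - \<theta>) * (\<theta> ^ card T * cov_out (card T)))
      + (real n - real (card T)) * (real n - real (card T) - 1)
        * ((1 - \<theta>) * ((1 - \<theta>) / 2 * (\<theta> ^ card T * cov_out (card T))))"
      by (rule sum_pairs_by_membership[OF T]) (auto simp: F_def cov_eqs[OF T] finite_T[OF T])
    then show "(\<Sum>i<n. \<Sum>j<n. F T i j) = (1 - \<theta>) * (real (card T) * (\<theta> ^ (card T - 1) * cov_in (card T))
      + (real n - real (card T)) * (\<theta> ^ card T * cov_out (card T))
      + (real n - real (card T)) * (real n - real (card T) - 1) * ((1 - \<theta>) / 2 * (\<theta> ^ card T * cov_out (card T))))"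
      by (simp only: factor)
  qed
  also have "\<dots> = (1 - \<theta>) * (\<Sum>k\<le>n. real (card {..<n} choose k) * (real k * (\<theta> ^ (k - 1) * cov_in k)
      + (real n - real k) * (\<theta> ^ k * cov_out k)
      + (real n - real k) * (real n - real k - 1) * ((1 - \<theta>) / 2 * (\<theta> ^ k * cov_out k))))"
    unfolding sum_distrib_left[symmetric] by (intro arg_cong2[of _ _ _ _ "(*)"] refl sum_Pow_card) auto
  finally show ?thesis
    using \<theta> by simp
qed

end

section \<open>The second moment of the estimator\<close>

text \<open>The trace of a product of two positive semidefinite 2x2 matrices is nonnegative.
  Completing the square at \<open>x = b / (2 * c)\<close> makes this explicit.\<close>

lemma quadratic_form_nonneg:
  fixes S h g a b c :: real
  assumes psd: "\<And>x y. 0 \<le> x\<^sup>2 * S + 2 * x * y * h + y\<^sup>2 * g"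
    and "0 < c" "b\<^sup>2 \<le> 4 * a * c"
  shows "0 \<le> a * S + b * h + c * g"
proof -
  define x where "x = b / (2 * c)"
  have "0 \<le> S"
    using psd[of 1 0] by simp
  moreover have "x\<^sup>2 * c \<le> a"
    using assms by (simp add: x_def power2_eq_square field_simps)
  ultimately have "0 \<le> (a - x\<^sup>2 * c) * S"
    by simp
  moreover have "0 \<le> c * (x\<^sup>2 * S + 2 * x * 1 * h + 1\<^sup>2 * g)"
    using psd[of x 1] \<open>0 < c\<close> by simp
  moreover have "2 * c * x = b"
    using \<open>0 < c\<close> by (simp add: x_def)
  then have "a * S + b * h + c * g = (a - x\<^sup>2 * c) * S + c * (x\<^sup>2 * S + 2 * x * 1 * h + 1\<^sup>2 * g)"
    by (simp add: algebra_simps)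
  ultimately show ?thesis
    by simp
qed

lemma power_le_power_times_ratio:
  fixes a b :: real
  assumes "0 \<le> a" "a \<le> b" "0 < b" "n \<le> k" "a ^ n \<le> c * b ^ n"
  shows "a ^ k \<le> c * b ^ k"
proof -
  have "a ^ k = a ^ n * a ^ (k - n)"
    using assms by (simp add: power_add[symmetric])
  also have "\<dots> \<le> (c * b ^ n) * b ^ (k - n)"
    using assms by (intro mult_mono power_mono) (auto intro: order_trans[of _ "a ^ n"])
  also have "\<dots> = c * b ^ k"
    using assms by (simp add: power_add[symmetric])
  finally show ?thesis .
qed

text \<open>The two inequalities in \<open>r\<close>, \<open>u\<close>, \<open>s\<close> are the
  coefficients of the diagonal sums \<open>a\<close> and \<open>d\<close> of
  \<open>certificate\<close>; the others are the discriminant condition for its \<open>S\<close>,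
  \<open>h\<close>, \<open>g\<close>. Levels below 6 are evaluated, the rest estimated relative to
  \<open>u\<close>.\<close>

lemma certificate_coefficients:
  fixes k :: nat
  assumes "2 \<le> k"
  defines "r \<equiv> (49 / 100) ^ k" and "u \<equiv> (53 / 100) ^ k" and "s \<equiv> (25 / 100) ^ k" and "w \<equiv> (2 / 10) ^ k"
  defines "a \<equiv> (6 / 100) + (395 / 100) * w - (24 / 10) * s"
    and "b \<equiv> (12 / 100) + (474 / 100) * w - (12 / 10) * s - 2 * r / ((7 / 10) * real k * (real k + 1))"
    and "c \<equiv> (6 / 100) + (79 / 100) * w + (42535 / 1000000) * u - (15 / 100) * s - 2 * r / ((real k + 1) * (real k + 2))"
  shows "0 \<le> (181 / 1000) * u / (53 / 100) + (24 / 10) * s - r / ((49 / 100) * real k)"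
    and "0 \<le> (138465 / 1000000) * u + (15 / 100) * s - r * real k / ((real k + 1) * (real k + 2))"
    and "0 < c" and "b\<^sup>2 \<le> 4 * a * c"
proof -
  have "(0 \<le> (181 / 1000) * u / (53 / 100) + (24 / 10) * s - r / ((49 / 100) * real k))
    \<and> (0 \<le> (138465 / 1000000) * u + (15 / 100) * s - r * real k / ((real k + 1) * (real k + 2)))
    \<and> 0 < c \<and> b\<^sup>2 \<le> 4 * a * c"
  proof (cases "k < 6")
    case True
    then consider "k = 2" | "k = 3" | "k = 4" | "k = 5"
      using assms(1) by linarith
    then show ?thesis
      by cases (simp_all add: r_def u_def s_def w_def a_def b_def c_def power_divide)
  next
    case False
    then have k: "6 \<le> k" and k': "6 \<le> real k"
      by auto
    have nonneg: "0 \<le> r" "0 < u" "0 \<le> s" "0 \<le> w"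
      by (auto simp: r_def u_def s_def w_def)
    \<comment> \<open>Every other base is below 0.53, so the ratios to \<open>u\<close> are largest
      at \<open>k = 6\<close>, where these constants are checked.\<close>
    have r: "r \<le> (6245 / 10000) * u" and s: "s \<le> (111 / 10000) * u" and w: "w \<le> (29 / 10000) * u" and u: "u \<le> (222 / 10000)"
    proof -
      show "r \<le> (6245 / 10000) * u" "s \<le> (111 / 10000) * u" "w \<le> (29 / 10000) * u"
        unfolding r_def s_def w_def u_def
        by (rule power_le_power_times_ratio[OF _ _ _ k]; simp add: power_divide)+
      have "u \<le> (53 / 100) ^ 6"
        unfolding u_def by (rule power_decreasing[OF k]) auto
      then show "u \<le> (222 / 10000)"
        by (simp add: power_divide)
    qed
    define e1 where "e1 = 2 * r / ((7 / 10) * real k * (real k + 1))"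
    define e2 where "e2 = 2 * r / ((real k + 1) * (real k + 2))"
    have e1: "0 \<le> e1" "e1 \<le> (425 / 10000) * u"
    proof -
      show "0 \<le> e1"
        using nonneg by (simp add: e1_def)
      have "6 * 7 \<le> real k * (real k + 1)"
        using k' by (intro mult_mono) auto
      then have "(2 * r / (7 / 10)) / (real k * (real k + 1)) \<le> (2 * r / (7 / 10)) / 42"
        using nonneg by (intro divide_left_mono) auto
      then have "e1 \<le> (2 * r / (7 / 10)) / 42"
        by (simp add: e1_def mult.assoc)
      also have "(2 * r / (7 / 10)) / 42 = r * (10 / 147)"
        by simp
      finally show "e1 \<le> (425 / 10000) * u"
        using r nonneg by linarith
    qed
    have e2: "0 \<le> e2" "e2 \<le> e1"
    proof -
      show "0 \<le> e2"
        using nonneg by (simp add: e2_def)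
      have "(7 / 10) * real k * (real k + 1) \<le> (real k + 1) * (real k + 2)"
        using k' mult_nonneg_nonneg[of "real k" "real k"] by (simp add: algebra_simps)
      then show "e2 \<le> e1"
        unfolding e1_def e2_def using nonneg k' by (intro divide_left_mono mult_pos_pos) auto
    qed
    have "e2 \<le> (3 / 100) * u"
    proof -
      have "7 * 8 \<le> (real k + 1) * (real k + 2)"
        using k' by (intro mult_mono) auto
      then have "e2 \<le> 2 * r / 56"
        unfolding e2_def using nonneg by (intro divide_left_mono) auto
      then show ?thesis
        using r nonneg by linarith
    qed
    have abc: "a = (6 / 100) + (395 / 100) * w - (24 / 10) * s" "b = (12 / 100) + (474 / 100) * w - (12 / 10) * s - e1"
      "c = (6 / 100) + (79 / 100) * w + (42535 / 1000000) * u - (15 / 100) * s - e2"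
      by (simp_all add: a_def b_def c_def e1_def e2_def)
    have c: "(59 / 1000) \<le> c"
      unfolding abc using nonneg s u \<open>e2 \<le> (3 / 100) * u\<close> by linarith
    \<comment> \<open>As \<open>k\<close> grows, \<open>a\<close>, \<open>b\<close>,
      \<open>c\<close> tend to 0.06, 0.12, 0.06, where the discriminant degenerates. Rewriting
      \<open>4 * a * c - b\<^sup>2\<close> through \<open>a - b + c\<close> and
      \<open>b - 2 * c\<close> separates a gain of order \<open>u\<close> from a loss of order
      \<open>u^2\<close>; the multiples of \<open>w\<close> cancel in
      \<open>a - b + c\<close>.\<close>
    have "(27 / 1000) * u \<le> a - b + c"
      unfolding abc using nonneg s e2 by linarith
    then have "4 * ((27 / 1000) * u) * (59 / 1000) \<le> 4 * (a - b + c) * c"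
      using c nonneg by (intro mult_mono) auto
    moreover have "b - 2 * c = (316 / 100) * w - (9 / 10) * s - (8507 / 100000) * u - e1 + 2 * e2"
      unfolding abc by (simp add: field_simps)
    then have "\<bar>b - 2 * c\<bar> \<le> (15 / 100) * u"
      using nonneg s w e1 e2 \<open>e2 \<le> (3 / 100) * u\<close> by linarith
    then have "(b - 2 * c)\<^sup>2 \<le> ((15 / 100) * u)\<^sup>2"
      using nonneg by (simp add: abs_le_square_iff[symmetric])
    moreover have "((15 / 100) * u)\<^sup>2 \<le> (225 / 10000) * (u * (222 / 10000))"
      using nonneg u by (simp add: power2_eq_square)
    moreover have "4 * a * c - b\<^sup>2 = 4 * (a - b + c) * c - (b - 2 * c)\<^sup>2"
      by (simp add: power2_eq_square algebra_simps)
    ultimately have "b\<^sup>2 \<le> 4 * a * c"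
      using nonneg by linarith
    moreover have "r / ((49 / 100) * real k) \<le> r / (294 / 100)"
      using nonneg k' by (intro divide_left_mono) auto
    then have "r / ((49 / 100) * real k) \<le> r * (100 / 294)"
      by simp
    then have "0 \<le> (181 / 530) * u + (24 / 10) * s - r / ((49 / 100) * real k)"
      using r nonneg by linarith
    then have "0 \<le> (181 / 1000) * u / (53 / 100) + (24 / 10) * s - r / ((49 / 100) * real k)"
      by simp
    moreover have "r * real k / ((real k + 1) * (real k + 2)) \<le> r * (1 / 9)"
    proof -
      have "real k / ((real k + 1) * (real k + 2)) \<le> 1 / 9"
      proof -
        have "9 * real k \<le> (real k + 1) * (real k + 2)"
        proof -
          have "6 * real k \<le> real k * real k"
            using k' by (intro mult_right_mono) auto
          moreover have "(real k + 1) * (real k + 2) = real k * real k + 3 * real k + 2"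
            by (simp add: algebra_simps)
          ultimately show ?thesis
            by linarith
        qed
        moreover have "0 < (real k + 1) * (real k + 2)"
          by simp
        ultimately show ?thesis
          by (simp only: pos_divide_le_eq)
      qed
      from mult_left_mono[OF this nonneg(1)] show ?thesis
        by simp
    qed
    then have "0 \<le> (138465 / 1000000) * u + (15 / 100) * s - r * real k / ((real k + 1) * (real k + 2))"
      using r nonneg by linarith
    ultimately show ?thesis
      using c by linarith
  qed
  then show "0 \<le> (181 / 1000) * u / (53 / 100) + (24 / 10) * s - r / ((49 / 100) * real k)"
    "0 \<le> (138465 / 1000000) * u + (15 / 100) * s - r * real k / ((real k + 1) * (real k + 2))"
    "0 < c" "b\<^sup>2 \<le> 4 * a * c"
    by blast+
qed

text \<open>At level \<open>k\<close> the left-hand side is the contribution to the second moment.  The right-hand side combines the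
  Lorenz, nonnegativity and total constraints with \<open>\<theta> = 0.53\<close>, \<open>0.25\<close>, \<open>0.2\<close> and \<open>1\<close> and with numerically
  optimised multipliers \<open>0.181\<close>, \<open>0.15\<close>, \<open>0.79\<close>, \<open>0.06\<close>; those of the three upper
  bounds add up to the coefficient \<open>1.031\<close>.\<close>

lemma certificate:
  fixes k :: nat and a S h g d :: real
  assumes "1 \<le> k" and "0 \<le> a" "0 \<le> d"
    and psd: "\<And>x y. 0 \<le> x\<^sup>2 * S + 2 * x * y * h + y\<^sup>2 * g"
    and one: "k = 1 \<Longrightarrow> S = a"
  shows "(7 / 10) ^ (2 * (k - 1)) * a / real k
      + 2 * (7 / 10) ^ (2 * k - 1) * h / (real k * (real k + 1))
      + (7 / 10) ^ (2 * k) * (2 * g + real k * d) / ((real k + 1) * (real k + 2))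
    \<le> (181 / 1000) * ((53 / 100) ^ (k - 1) * a + (53 / 100) ^ k * d + (235 / 1000) * (53 / 100) ^ k * (g - d))
      - (15 / 100) * ((25 / 100) ^ (k - 2) * (S - a) + 2 * (25 / 100) ^ (k - 1) * h + (25 / 100) ^ k * (g - d))
      + (79 / 100) * ((2 / 10) ^ (k - 1) * (S + h) + (2 / 10) ^ k * (h + g)) + (6 / 100) * (S + 2 * h + g)"
proof (cases "k = 1")
  case True
  \<comment> \<open>At \<open>k = 1\<close> the exponent \<open>k - 2\<close> truncates to 0 and the
    uniform power formulas fail; the affected term disappears because \<open>S = a\<close>.\<close>
  have "0 \<le> (31 / 1000) * S + (68 / 1000) * h + (397 / 10000) * g"
    by (rule quadratic_form_nonneg[OF psd]) (simp_all add: power_divide)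
  moreover have "0 \<le> g"
    using psd[of 0 1] by simp
  ultimately have "(7 / 10) / 2 * 2 * h + (49 / 100) * (2 * g + d) / 6 + a
    \<le> (181 / 1000) * (a + (53 / 100) * d + (235 / 1000) * (53 / 100) * (g - d)) - (15 / 100) * (2 * h + (25 / 100) * (g - d))
      + (79 / 100) * (a + h + (2 / 10) * (h + g)) + (6 / 100) * (a + 2 * h + g)"
    using one[OF True] \<open>0 \<le> d\<close> by (simp add: field_simps)
  then show ?thesis
    using one[OF True] by (simp add: True power_divide)
next
  case False
  then have "2 \<le> k"
    using assms(1) by simp
  then obtain l where l: "k = Suc (Suc l)"
    by (metis add_2_eq_Suc le_Suc_ex)
  define r u s w :: real where "r = (49 / 100) ^ k" "u = (53 / 100) ^ k" "s = (25 / 100) ^ k" "w = (2 / 10) ^ k"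
  note coeff = certificate_coefficients[OF \<open>2 \<le> k\<close>, folded r_u_s_w_def]
  have sq: "(7 / 10 :: real) ^ (2 * i) = (49 / 100) ^ i" for i
    by (simp add: power_mult power_divide)
  have "2 * k - 1 = Suc (2 * Suc l)"
    by (simp add: l)
  then have odd: "(7 / 10 :: real) ^ (2 * k - 1) = (7 / 10) * (49 / 100) ^ Suc l"
    by (simp only: power_Suc sq)
  have pow: "(7 / 10 :: real) ^ (2 * (k - 1)) = r / (49 / 100)" "(7 / 10 :: real) ^ (2 * k - 1) = r / (7 / 10)"
    "(7 / 10 :: real) ^ (2 * k) = r"
    "((53 / 100) :: real) ^ (k - 1) = u / (53 / 100)" "((53 / 100) :: real) ^ k = u"
    "((25 / 100) :: real) ^ (k - 2) = 16 * s" "((25 / 100) :: real) ^ (k - 1) = 4 * s" "((25 / 100) :: real) ^ k = s"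
    "((2 / 10) :: real) ^ (k - 1) = 5 * w" "((2 / 10) :: real) ^ k = w"
    unfolding odd sq r_u_s_w_def by (simp_all add: l)
  define x1 x2 x3 x4 where "x1 = r / ((49 / 100) * real k)" "x2 = 2 * r / ((7 / 10) * real k * (real k + 1))"
    "x3 = 2 * r / ((real k + 1) * (real k + 2))" "x4 = r * real k / ((real k + 1) * (real k + 2))"
  note coeff = coeff[folded x1_x2_x3_x4_def]
  have "r / (49 / 100) * a / real k = x1 * a" "2 * (r / (7 / 10)) * h / (real k * (real k + 1)) = x2 * h"
    "r * (2 * g + real k * d) / ((real k + 1) * (real k + 2)) = x3 * g + x4 * d"
    subgoal by (simp add: x1_x2_x3_x4_def)
    subgoal by (simp add: x1_x2_x3_x4_def mult.assoc mult.commute[of _ h] mult.left_commute)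
    subgoal by (simp add: x1_x2_x3_x4_def add_divide_distrib algebra_simps)
    done
  moreover have "0 \<le> ((6 / 100) + (395 / 100) * w - (24 / 10) * s) * S + ((12 / 100) + (474 / 100) * w - (12 / 10) * s - x2) * h
      + ((6 / 100) + (79 / 100) * w + (42535 / 1000000) * u - (15 / 100) * s - x3) * g" (is "0 \<le> ?f")
    by (rule quadratic_form_nonneg[OF psd coeff(3,4)])
  moreover have "0 \<le> ((181 / 1000) * u / (53 / 100) + (24 / 10) * s - x1) * a" "0 \<le> ((138465 / 1000000) * u + (15 / 100) * s - x4) * d"
    using coeff(1,2) assms(2,3) by simp_all
  moreover have "(181 / 1000) * (u / (53 / 100) * a + u * d + (235 / 1000) * u * (g - d))
      - (15 / 100) * (16 * s * (S - a) + 2 * (4 * s) * h + s * (g - d))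
      + (79 / 100) * (5 * w * (S + h) + w * (h + g)) + (6 / 100) * (S + 2 * h + g) - x1 * a - x2 * h - (x3 * g + x4 * d)
    = ((181 / 1000) * u / (53 / 100) + (24 / 10) * s - x1) * a + ((138465 / 1000000) * u + (15 / 100) * s - x4) * d + ?f"
    by (simp add: field_simps)
  ultimately show ?thesis
    unfolding pow by linarith
qed

text \<open>The own type is kept, earlier ones are kept with probability \<open>c\<close>, and later
  ones are averaged out, so the estimator can be computed online.\<close>

definition keep :: "real \<Rightarrow> nat \<Rightarrow> nat \<Rightarrow> real" where
  "keep c j l = (if l < j then c else if l = j then 1 else 0)"

context symmetric_selection
begin

definition estimate :: "real \<Rightarrow> nat \<Rightarrow> (nat \<Rightarrow> 't) \<Rightarrow> real" where
  "estimate c j = noise (keep c j) {..<n} (z j)"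

text \<open>Moving one noise operator across the product multiplies retention probabilities:
  \<open>c^2\<close> below \<open>i\<close>, zero above \<open>i\<close>, and at \<open>i\<close>
  itself 1 or \<open>c\<close> according to whether \<open>i = j\<close>. The sets \<open>T\<close>
  are then split by membership of \<open>i\<close>.\<close>

lemma expect_estimate_mult:
  assumes "i \<le> j" "j < n"
  shows "expect (\<lambda>t. estimate c i t * estimate c j t)
    = (\<Sum>k\<le>n. real (i choose k) * (c ^ (2 * k) * (cov_out k
        + (if i = j then cov_in (Suc k) else c * cov_in_out (Suc k)))))"
proof -
  define \<rho> where "\<rho> l = keep c j l * keep c i l" for l
  have "expect (\<lambda>t. estimate c i t * estimate c j t)
      = expect (\<lambda>t. noise (keep c j) {..<n} (noise (keep c i) {..<n} (z i)) t * z j t)"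
    unfolding estimate_def noise_def by (rule expect_tensor_adjoint)
  also have "noise (keep c j) {..<n} (noise (keep c i) {..<n} (z i)) = noise \<rho> {..<n} (z i)"
    unfolding noise_def \<rho>_def by (subst tensor_tensor) simp_all
  also have "expect (\<lambda>t. noise \<rho> {..<n} (z i) t * z j t) = (\<Sum>T\<in>Pow {..<n}. prod \<rho> T * cov T (z i) (z j))"
    by (rule expect_noise_mult)
  also have "\<dots> = (\<Sum>T\<in>Pow {..<Suc i}. prod \<rho> T * cov T (z i) (z j))"
  proof (rule sum.mono_neutral_right)
    show "\<forall>T\<in>Pow {..<n} - Pow {..<Suc i}. prod \<rho> T * cov T (z i) (z j) = 0"
    proof
      fix T assume T: "T \<in> Pow {..<n} - Pow {..<Suc i}"
      then obtain l where "l \<in> T" "l \<notin> {..<Suc i}"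
        by blast
      then have "l \<in> T" "i < l"
        by auto
      moreover have "finite T"
        using T finite_subset by auto
      ultimately have "prod \<rho> T = 0"
        by (intro prod_zero) (auto simp: \<rho>_def keep_def)
      then show "prod \<rho> T * cov T (z i) (z j) = 0"
        by simp
    qed
  qed (use assms in auto)
  also have "Pow {..<Suc i} = Pow {..<i} \<union> insert i ` Pow {..<i}"
    by (simp add: lessThan_Suc Pow_insert)
  also have "(\<Sum>T\<in>\<dots>. prod \<rho> T * cov T (z i) (z j)) = (\<Sum>T\<in>Pow {..<i}. prod \<rho> T * cov T (z i) (z j))
      + (\<Sum>T\<in>insert i ` Pow {..<i}. prod \<rho> T * cov T (z i) (z j))"
    by (rule sum.union_disjoint) auto
  also have "(\<Sum>T\<in>insert i ` Pow {..<i}. prod \<rho> T * cov T (z i) (z j))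
      = (\<Sum>T\<in>Pow {..<i}. prod \<rho> (insert i T) * cov (insert i T) (z i) (z j))"
  proof (subst sum.reindex)
    show "inj_on (insert i) (Pow {..<i})"
      by (intro inj_onI) (metis PowD insert_ident lessThan_iff less_irrefl subsetD)
  qed simp
  also have "(\<Sum>T\<in>Pow {..<i}. prod \<rho> T * cov T (z i) (z j))
      + (\<Sum>T\<in>Pow {..<i}. prod \<rho> (insert i T) * cov (insert i T) (z i) (z j))
      = (\<Sum>T\<in>Pow {..<i}. c ^ (2 * card T) * (cov_out (card T)
        + (if i = j then cov_in (Suc (card T)) else c * cov_in_out (Suc (card T)))))"
    unfolding sum.distrib[symmetric]
  proof (rule sum.cong[OF refl])
    fix T assume "T \<in> Pow {..<i}"
    then have T: "T \<subseteq> {..<i}" by simp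
    then have fin: "finite T" and notin: "i \<notin> T" "j \<notin> T"
      using finite_subset assms by auto
    have Tn: "T \<subseteq> {..<n}" "insert i T \<subseteq> {..<n}"
      using T assms by auto
    have "prod \<rho> T = (\<Prod>l\<in>T. c\<^sup>2)"
      using T assms by (intro prod.cong) (auto simp: \<rho>_def keep_def power2_eq_square)
    then have "prod \<rho> T = c ^ (2 * card T)"
      by (simp add: power_mult)
    moreover have "\<rho> i = (if i = j then 1 else c)"
      using assms by (auto simp: \<rho>_def keep_def)
    moreover have "cov T (z i) (z j) = cov_out (card T)"
      using cov_out_eq[OF Tn(1)] notin assms by simp
    moreover have "cov (insert i T) (z i) (z j)
        = (if i = j then cov_in (Suc (card T)) else cov_in_out (Suc (card T)))"
      using cov_in_eq[OF Tn(2), of i] cov_in_out_eq(1)[OF Tn(2), of i j] notin fin assms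
      by (cases "i = j") simp_all
    ultimately show "prod \<rho> T * cov T (z i) (z j) + prod \<rho> (insert i T) * cov (insert i T) (z i) (z j)
      = c ^ (2 * card T) * (cov_out (card T)
        + (if i = j then cov_in (Suc (card T)) else c * cov_in_out (Suc (card T))))"
      using fin notin by (simp add: algebra_simps)
  qed
  also have "\<dots> = (\<Sum>k\<le>n. real (card {..<i} choose k) * (c ^ (2 * k) * (cov_out k
        + (if i = j then cov_in (Suc k) else c * cov_in_out (Suc k)))))"
    using assms by (intro sum_Pow_card) auto
  finally show ?thesis
    by simp
qed

end

lemma sum_symmetric_pairs:
  fixes f :: "nat \<Rightarrow> nat \<Rightarrow> real"
  assumes "\<And>i j. f i j = f j i"
  shows "(\<Sum>i<n. \<Sum>j<n. f i j) = (\<Sum>i<n. f i i) + 2 * (\<Sum>i<n. \<Sum>j\<in>{Suc i..<n}. f i j)"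
proof (induction n)
  case (Suc n)
  have "(\<Sum>i<Suc n. \<Sum>j\<in>{Suc i..<Suc n}. f i j) = (\<Sum>i<n. (\<Sum>j\<in>{Suc i..<n}. f i j) + f i n)"
    by (simp add: sum.atLeastLessThan_Suc)
  moreover have "(\<Sum>j<n. f n j) = (\<Sum>j<n. f j n)"
    by (rule sum.cong[OF refl]) (rule assms)
  ultimately show ?case
    using Suc by (simp add: sum.distrib)
qed simp

context symmetric_selection
begin

text \<open>\<open>n choose Suc k\<close> counts an index together with \<open>k\<close> smaller
  ones; \<open>n choose Suc (Suc k)\<close> counts these with one further, larger index.\<close>

lemma second_moment_estimate:
  "expect (\<lambda>t. (\<Sum>j<n. estimate c j t)\<^sup>2)
    = (\<Sum>k\<le>n. real (n choose Suc k) * (c ^ (2 * k) * (cov_out k + cov_in (Suc k))))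
    + 2 * (\<Sum>k\<le>n. real (n choose Suc (Suc k)) * (c ^ (2 * k) * (cov_out k + c * cov_in_out (Suc k))))"
proof -
  define E where "E i j = expect (\<lambda>t. estimate c i t * estimate c j t)" for i j
  have "expect (\<lambda>t. (\<Sum>j<n. estimate c j t)\<^sup>2) = (\<Sum>i<n. \<Sum>j<n. E i j)"
    by (simp add: power2_eq_square sum_product expect_sum E_def)
  also have "\<dots> = (\<Sum>i<n. E i i) + 2 * (\<Sum>i<n. \<Sum>j\<in>{Suc i..<n}. E i j)"
    by (rule sum_symmetric_pairs) (simp add: E_def mult.commute)
  also have "(\<Sum>i<n. E i i) = (\<Sum>i<n. \<Sum>k\<le>n. real (i choose k) * (c ^ (2 * k) * (cov_out k + cov_in (Suc k))))"
    by (intro sum.cong) (auto simp: E_def expect_estimate_mult)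
  also have "\<dots> = (\<Sum>k\<le>n. real (\<Sum>i<n. i choose k) * (c ^ (2 * k) * (cov_out k + cov_in (Suc k))))"
    by (subst sum.swap) (simp add: sum_distrib_right)
  also have "(\<Sum>i<n. \<Sum>j\<in>{Suc i..<n}. E i j)
      = (\<Sum>i<n. \<Sum>k\<le>n. real ((n - 1 - i) * (i choose k)) * (c ^ (2 * k) * (cov_out k + c * cov_in_out (Suc k))))"
  proof (rule sum.cong[OF refl])
    fix i assume "i \<in> {..<n}"
    have "(\<Sum>j\<in>{Suc i..<n}. E i j) = (\<Sum>j\<in>{Suc i..<n}. \<Sum>k\<le>n. real (i choose k) * (c ^ (2 * k) * (cov_out k + c * cov_in_out (Suc k))))"
      by (intro sum.cong) (auto simp: E_def expect_estimate_mult)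
    then show "(\<Sum>j\<in>{Suc i..<n}. E i j)
      = (\<Sum>k\<le>n. real ((n - 1 - i) * (i choose k)) * (c ^ (2 * k) * (cov_out k + c * cov_in_out (Suc k))))"
      by (simp add: sum_distrib_left mult.assoc)
  qed
  also have "\<dots> = (\<Sum>k\<le>n. real (\<Sum>i<n. (n - 1 - i) * (i choose k)) * (c ^ (2 * k) * (cov_out k + c * cov_in_out (Suc k))))"
    by (subst sum.swap) (simp add: sum_distrib_right)
  finally show ?thesis
    by (simp only: sum_choose_lessThan sum_choose_times_lessThan)
qed

lemma total_square: "total\<^sup>2 = (real n)\<^sup>2 * cov_out 0"
proof -
  have "cov {} (z i) (z j) = expect (z i) * expect (z j)" for i j
  proof -
    have "part {} {..<n} f = mean {..<n} f" for f
      unfolding part_def mean_def by (rule tensor_cong) auto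
    then have "cov {} (z i) (z j) = mean {..<n} (\<lambda>t. mean {..<n} (z i) t * z j t) (\<lambda>_. undefined)"
      by (simp add: cov_def expect_def)
    also have "\<dots> = mean {..<n} (z i) (\<lambda>_. undefined) * mean {..<n} (z j) (\<lambda>_. undefined)"
      by (rule mean_mult_const_coords) (auto simp: mean_upd)
    finally show ?thesis
      by (simp add: expect_def)
  qed
  then have "total\<^sup>2 = (\<Sum>i<n. \<Sum>j<n. cov {} (z i) (z j))"
    by (simp add: total_def power2_eq_square sum_product)
  also have "\<dots> = (\<Sum>i<n. \<Sum>j<n. cov_out 0)"
    using cov_out_eq[of "{}"] by (intro sum.cong) auto
  finally show ?thesis
    by (simp add: power2_eq_square)
qed

text \<open>Mean square of the component at \<open>{..<k}\<close> of the sum of all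
  \<open>z i\<close> with weight \<open>x\<close> for indices inside that set and \<open>y\<close>
  for those outside.\<close>

lemma covariance_form_nonneg:
  fixes x y :: real
  assumes "k \<le> n"
  shows "0 \<le> x\<^sup>2 * (real k * cov_in k + real k * (real k - 1) * cov_in_in k)
    + 2 * x * y * (real k * (real n - real k) * cov_in_out k) + y\<^sup>2 * ((real n - real k)\<^sup>2 * cov_out k)"
proof -
  define r where "r i = (if i < k then x else y)" for i
  have T: "{..<k} \<subseteq> {..<n}"
    using assms by auto
  have "0 \<le> cov {..<k} (\<lambda>t. \<Sum>i<n. r i * z i t) (\<lambda>t. \<Sum>i<n. r i * z i t)"
    by (rule cov_nonneg)
  also have "\<dots> = (\<Sum>i<n. \<Sum>j<n. r i * r j * cov {..<k} (z i) (z j))"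
    by (rule cov_sum_sum)
  also have "\<dots> = real k * (x\<^sup>2 * cov_in k) + real k * (real k - 1) * (x\<^sup>2 * cov_in_in k)
      + real k * (real n - real k) * (x * y * cov_in_out k) + (real n - real k) * real k * (x * y * cov_in_out k)
      + (real n - real k) * (y\<^sup>2 * cov_out k) + (real n - real k) * (real n - real k - 1) * (y\<^sup>2 * cov_out k)"
    by (rule sum_pairs_by_membership[OF T]) (auto simp: r_def cov_eqs[OF T] power2_eq_square)
  finally show ?thesis
    by (simp add: power2_eq_square algebra_simps)
qed

end

lemma choose_Suc_eq:
  assumes "k \<le> n"
  shows "real (n choose Suc k) = real (n choose k) * ((real n - real k) / (real k + 1))"
proof -
  have "Suc k * (n choose Suc k) = (n - k) * (n choose k)"
    by (simp only: binomial_absorption binomial_absorb_comp)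
  then have "real (Suc k) * real (n choose Suc k) = real (n - k) * real (n choose k)"
    by (metis of_nat_mult)
  then show ?thesis
    using assms by (simp add: field_simps of_nat_diff)
qed

lemma sum_atMost_shift:
  fixes g :: "nat \<Rightarrow> real"
  assumes "g 0 = 0" "g (Suc n) = 0"
  shows "(\<Sum>k\<le>n. g (Suc k)) = (\<Sum>k\<le>n. g k)"
  using sum.atMost_Suc_shift[of g n] sum.atMost_Suc[of g n] assms by simp

context symmetric_selection
begin

lemma second_moment_le:
  "expect (\<lambda>t. (\<Sum>j<n. estimate (7 / 10) j t)\<^sup>2) \<le> (1031 / 1000) * total + (257465 / 1000000) * total\<^sup>2"
proof -
  define c :: real where "c = 7 / 10"
  define C where "C k = real (n choose k)" for k
  define m where "m k = real n - real k" for k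
  define L where "L k = real k * ((53 / 100) ^ (k - 1) * cov_in k) + m k * ((53 / 100) ^ k * cov_out k)
    + m k * (m k - 1) * ((235 / 1000) * ((53 / 100) ^ k * cov_out k))" for k
  define P where "P k = real k * (real k - 1) * ((25 / 100) ^ (k - 2) * cov_in_in k)
    + 2 * real k * m k * ((25 / 100) ^ (k - 1) * cov_in_out k) + m k * (m k - 1) * ((25 / 100) ^ k * cov_out k)" for k
  define N where "N \<theta> k = real k * (\<theta> ^ (k - 1) * cov_in k) + real k * (real k - 1) * (\<theta> ^ (k - 1) * cov_in_in k)
      + real k * m k * (\<theta> ^ (k - 1) * cov_in_out k) + m k * real k * (\<theta> ^ k * cov_in_out k)
      + m k * (\<theta> ^ k * cov_out k) + m k * (m k - 1) * (\<theta> ^ k * cov_out k)" for \<theta> k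
  \<comment> \<open>Contribution of level \<open>k\<close> to the second moment, divided by
    \<open>C k\<close>. The \<open>cov_in\<close> and \<open>cov_in_out\<close> terms are reindexed
    from \<open>Suc k\<close>; \<open>of_bool (k \<noteq> 0)\<close> records that this reaches no
    level 0.\<close>
  define v where "v k = of_bool (k \<noteq> 0) * (c ^ (2 * (k - 1)) * cov_in k)
    + (m k / (real k + 1) * (c ^ (2 * k) * cov_out k)
    + 2 * (m k / (real k + 1) * (of_bool (k \<noteq> 0) * (c ^ (2 * k - 1) * cov_in_out k))
    + m k / (real k + 1) * ((m k - 1) / (real k + 2)) * (c ^ (2 * k) * cov_out k)))" for k
  define w where "w k = (181 / 1000) * L k - (15 / 100) * P k + (79 / 100) * N (2 / 10) k + (6 / 100) * N 1 k" for k
  have C_Suc: "C (Suc k) = C k * (m k / (real k + 1))" if "k \<le> n" for k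
    using choose_Suc_eq[OF that] by (simp add: C_def m_def)
  have C_Suc_Suc: "C (Suc (Suc k)) = C k * (m k / (real k + 1) * ((m k - 1) / (real k + 2)))" if "k \<le> n" for k
  proof (cases "k = n")
    case False
    with that show ?thesis
      using choose_Suc_eq[of "Suc k" n] C_Suc[of k] by (simp add: C_def m_def add.commute)
  qed (simp add: C_def m_def)
  have "expect (\<lambda>t. (\<Sum>j<n. estimate c j t)\<^sup>2)
      = (\<Sum>k\<le>n. C (Suc k) * (c ^ (2 * k) * cov_out k))
      + (\<Sum>k\<le>n. C (Suc k) * (c ^ (2 * k) * cov_in (Suc k)))
      + 2 * ((\<Sum>k\<le>n. C (Suc (Suc k)) * (c ^ (2 * k) * cov_out k))
        + (\<Sum>k\<le>n. C (Suc (Suc k)) * (c ^ (2 * k + 1) * cov_in_out (Suc k))))"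
    unfolding second_moment_estimate C_def by (simp add: distrib_left sum.distrib mult.assoc mult.left_commute)
  also have "(\<Sum>k\<le>n. C (Suc k) * (c ^ (2 * k) * cov_in (Suc k)))
      = (\<Sum>k\<le>n. C k * (of_bool (k \<noteq> 0) * (c ^ (2 * (k - 1)) * cov_in k)))"
    using sum_atMost_shift[of "\<lambda>k. C k * (of_bool (k \<noteq> 0) * (c ^ (2 * (k - 1)) * cov_in k))" n]
    by (simp add: C_def)
  also have "(\<Sum>k\<le>n. C (Suc (Suc k)) * (c ^ (2 * k + 1) * cov_in_out (Suc k)))
      = (\<Sum>k\<le>n. C (Suc k) * (of_bool (k \<noteq> 0) * (c ^ (2 * k - 1) * cov_in_out k)))"
    using sum_atMost_shift[of "\<lambda>k. C (Suc k) * (of_bool (k \<noteq> 0) * (c ^ (2 * k - 1) * cov_in_out k))" n]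
    by (simp add: C_def)
  finally have "expect (\<lambda>t. (\<Sum>j<n. estimate c j t)\<^sup>2)
      = (\<Sum>k\<le>n. C (Suc k) * (c ^ (2 * k) * cov_out k)
        + C k * (of_bool (k \<noteq> 0) * (c ^ (2 * (k - 1)) * cov_in k))
        + 2 * (C (Suc (Suc k)) * (c ^ (2 * k) * cov_out k)
          + C (Suc k) * (of_bool (k \<noteq> 0) * (c ^ (2 * k - 1) * cov_in_out k))))"
    by (simp only: sum.distrib sum_distrib_left[symmetric])
  also have "\<dots> = (\<Sum>k\<le>n. C k * v k)"
  proof (rule sum.cong[OF refl])
    fix k assume "k \<in> {..n}"
    then have k: "k \<le> n" by simp
    have "x * q * X + x * A + 2 * (x * (q * e) * X + x * q * D) = x * (A + (q * X + 2 * (q * D + q * e * X)))"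
      for x q X A e D :: real
      by (simp add: algebra_simps)
    then show "C (Suc k) * (c ^ (2 * k) * cov_out k)
        + C k * (of_bool (k \<noteq> 0) * (c ^ (2 * (k - 1)) * cov_in k))
        + 2 * (C (Suc (Suc k)) * (c ^ (2 * k) * cov_out k)
          + C (Suc k) * (of_bool (k \<noteq> 0) * (c ^ (2 * k - 1) * cov_in_out k))) = C k * v k"
      unfolding C_Suc[OF k] C_Suc_Suc[OF k] v_def .
  qed
  finally have V: "expect (\<lambda>t. (\<Sum>j<n. estimate c j t)\<^sup>2) = (\<Sum>k\<le>n. C k * v k)" .
  have vw: "v k \<le> w k" if k: "1 \<le> k" "k \<le> n" for k
  proof -
    have "0 \<le> m k" "real k \<noteq> 0"
      using k by (auto simp: m_def)
    have "0 \<le> cov_in k" "0 \<le> cov_out k"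
      by (simp_all add: cov_in_def cov_out_def cov_nonneg)
    note cert = certificate[OF k(1), of "real k * cov_in k" "m k * cov_out k"
        "real k * cov_in k + real k * (real k - 1) * cov_in_in k"
        "real k * m k * cov_in_out k" "(m k)\<^sup>2 * cov_out k", folded c_def]
    have lhs: "c ^ (2 * (k - 1)) * (real k * cov_in k) / real k
        + 2 * c ^ (2 * k - 1) * (real k * m k * cov_in_out k) / (real k * (real k + 1))
        + c ^ (2 * k) * (2 * ((m k)\<^sup>2 * cov_out k) + real k * (m k * cov_out k)) / ((real k + 1) * (real k + 2)) = v k"
    proof -
      have "X * (r * A) / r + 2 * Y * (r * q * D) / (r * (r + 1)) + Z * (2 * (q\<^sup>2 * G) + r * (q * G)) / ((r + 1) * (r + 2))
        = X * A + (q / (r + 1) * (Z * G) + 2 * (q / (r + 1) * (Y * D) + q / (r + 1) * ((q - 1) / (r + 2)) * (Z * G)))"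
        if "0 < r" for r q X Y Z A D G :: real
      proof -
        have "r + 1 \<noteq> 0" "r + 2 \<noteq> 0"
          using that by auto
        then have "Z * (2 * (q\<^sup>2 * G) + r * (q * G)) / ((r + 1) * (r + 2))
            = q / (r + 1) * (Z * G) + 2 * (q / (r + 1) * ((q - 1) / (r + 2)) * (Z * G))"
          by (simp add: frac_eq_eq add_frac_eq) (simp add: power2_eq_square algebra_simps)
        then show ?thesis
          using that by simp
      qed
      from this[of "real k" "c ^ (2 * (k - 1))" "cov_in k" "c ^ (2 * k - 1)" "m k" "cov_in_out k" "c ^ (2 * k)" "cov_out k"]
      show ?thesis
        using k(1) by (simp add: v_def)
    qed
    have rhs: "(181 / 1000) * ((53 / 100) ^ (k - 1) * (real k * cov_in k) + (53 / 100) ^ k * (m k * cov_out k)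
        + (235 / 1000) * (53 / 100) ^ k * ((m k)\<^sup>2 * cov_out k - m k * cov_out k))
      - (15 / 100) * ((25 / 100) ^ (k - 2) * (real k * cov_in k + real k * (real k - 1) * cov_in_in k - real k * cov_in k)
        + 2 * (25 / 100) ^ (k - 1) * (real k * m k * cov_in_out k)
        + (25 / 100) ^ k * ((m k)\<^sup>2 * cov_out k - m k * cov_out k))
      + (79 / 100) * ((2 / 10) ^ (k - 1) * (real k * cov_in k + real k * (real k - 1) * cov_in_in k + real k * m k * cov_in_out k)
        + (2 / 10) ^ k * (real k * m k * cov_in_out k + (m k)\<^sup>2 * cov_out k))
      + (6 / 100) * (real k * cov_in k + real k * (real k - 1) * cov_in_in k + 2 * (real k * m k * cov_in_out k)
        + (m k)\<^sup>2 * cov_out k) = w k"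
    proof -
      have "l * (p1 * (K * A) + p2 * (q * G) + h * p2 * (q\<^sup>2 * G - q * G))
          - al * (p3 * (K * A + K * (K - 1) * B - K * A) + 2 * p4 * (K * q * D) + p5 * (q\<^sup>2 * G - q * G))
          + nu * (p6 * (K * A + K * (K - 1) * B + K * q * D) + p7 * (K * q * D + q\<^sup>2 * G))
          + ga * (K * A + K * (K - 1) * B + 2 * (K * q * D) + q\<^sup>2 * G)
        = l * (K * (p1 * A) + q * (p2 * G) + q * (q - 1) * (h * (p2 * G)))
          - al * (K * (K - 1) * (p3 * B) + 2 * K * q * (p4 * D) + q * (q - 1) * (p5 * G))
          + nu * (K * (p6 * A) + K * (K - 1) * (p6 * B) + K * q * (p6 * D) + q * K * (p7 * D)
            + q * (p7 * G) + q * (q - 1) * (p7 * G))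
          + ga * (K * (1 * A) + K * (K - 1) * (1 * B) + K * q * (1 * D) + q * K * (1 * D)
            + q * (1 * G) + q * (q - 1) * (1 * G))"
        for l al nu ga h p1 p2 p3 p4 p5 p6 p7 K q A B D G :: real
        by (simp add: power2_eq_square algebra_simps)
      then show ?thesis
        unfolding w_def L_def P_def N_def power_one .
    qed
    show ?thesis
      unfolding lhs[symmetric] rhs[symmetric]
    proof (rule cert)
      show "0 \<le> x\<^sup>2 * (real k * cov_in k + real k * (real k - 1) * cov_in_in k)
          + 2 * x * y * (real k * m k * cov_in_out k) + y\<^sup>2 * ((m k)\<^sup>2 * cov_out k)" for x y
        using covariance_form_nonneg[OF k(2), of x y] by (simp only: m_def)
    qed (use \<open>0 \<le> m k\<close> \<open>0 \<le> cov_in k\<close> \<open>0 \<le> cov_out k\<close> in simp_all)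
  qed
  \<comment> \<open>Level 0 stays outside the certificate: \<open>v 0 - w 0\<close> gives
    \<open>total\<^sup>2\<close> the coefficient
    \<open>0.257465 = 1 - (0.79 + 0.06 - 0.15 + 0.181 * 0.235)\<close>, plus a nonpositive multiple
    of \<open>real n * cov_out 0\<close>.\<close>
  have split: "(\<Sum>k\<le>n. f k) = f 0 + (\<Sum>k\<in>{1..n}. f k)" for f :: "nat \<Rightarrow> real"
    by (simp add: sum.atMost_shift sum.atLeast1_atMost_eq)
  have "(\<Sum>k\<le>n. C k * v k) = v 0 + (\<Sum>k\<in>{1..n}. C k * v k)"
    by (subst split) (simp add: C_def)
  also have "(\<Sum>k\<in>{1..n}. C k * v k) \<le> (\<Sum>k\<in>{1..n}. C k * w k)"
    using vw by (intro sum_mono mult_left_mono) (auto simp: C_def)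
  also have "\<dots> = (\<Sum>k\<le>n. C k * w k) - w 0"
    by (subst split) (simp add: C_def)
  also have "(\<Sum>k\<le>n. C k * w k) = (181 / 1000) * (\<Sum>k\<le>n. C k * L k) - (15 / 100) * (\<Sum>k\<le>n. C k * P k)
      + (79 / 100) * (\<Sum>k\<le>n. C k * N (2 / 10) k) + (6 / 100) * (\<Sum>k\<le>n. C k * N 1 k)"
  proof -
    have "C k * w k = (181 / 1000) * (C k * L k) - (15 / 100) * (C k * P k)
        + (79 / 100) * (C k * N (2 / 10) k) + (6 / 100) * (C k * N 1 k)" for k
      by (simp add: w_def algebra_simps)
    then show ?thesis
      by (simp only: sum.distrib sum_subtractf sum_distrib_left)
  qed
  also have "\<dots> \<le> (181 / 1000) * total - (15 / 100) * 0 + (79 / 100) * total + (6 / 100) * total"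
  proof -
    have "(\<Sum>k\<le>n. C k * L k) \<le> total"
      using lorenz_constraint[of "53 / 100"] by (simp add: L_def C_def m_def)
    moreover have "0 \<le> (\<Sum>k\<le>n. C k * P k)"
      using nonneg_constraint[of "25 / 100"] by (simp add: P_def C_def m_def)
    moreover have "(\<Sum>k\<le>n. C k * N \<theta> k) \<le> total" if "0 \<le> \<theta>" "\<theta> \<le> 1" for \<theta>
      using total_constraint[OF that] by (simp add: N_def C_def m_def)
    from this[of "2 / 10"] this[of 1]
    have "(\<Sum>k\<le>n. C k * N (2 / 10) k) \<le> total" "(\<Sum>k\<le>n. C k * N 1 k) \<le> total"
      by simp_all
    ultimately show ?thesis
      by linarith
  qed
  finally have "(\<Sum>k\<le>n. C k * v k) \<le> (1031 / 1000) * total + (v 0 - w 0)"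
    by simp
  moreover have "v 0 - w 0 = (257465 / 1000000) * ((real n)\<^sup>2 * cov_out 0) - (288465 / 1000000) * (real n * cov_out 0)"
    by (simp add: v_def w_def L_def P_def N_def m_def power2_eq_square field_simps)
  moreover have "0 \<le> real n * cov_out 0"
    by (simp add: cov_out_def cov_nonneg)
  ultimately show ?thesis
    using V by (simp add: c_def total_square)
qed

end

section \<open>From functions of infinite type sequences to the product law on lists\<close>

definition depends_on :: "nat set \<Rightarrow> ((nat \<Rightarrow> 't) \<Rightarrow> real) \<Rightarrow> bool" where
  "depends_on X f \<longleftrightarrow> (\<forall>t t'. (\<forall>i\<in>X. t i = t' i) \<longrightarrow> f t = f t')"

lemma depends_onD: "depends_on X f \<Longrightarrow> (\<And>i. i \<in> X \<Longrightarrow> t i = t' i) \<Longrightarrow> f t = f t'"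
  by (auto simp: depends_on_def)

lemma depends_on_mono: "depends_on X f \<Longrightarrow> X \<subseteq> Y \<Longrightarrow> depends_on Y f"
  by (auto simp: depends_on_def subset_iff)

context finite_pmf
begin

lemma depends_on_avg:
  assumes "depends_on X f"
  shows "depends_on (X - {i}) (avg i f)"
  unfolding depends_on_def
proof (intro allI impI)
  fix t t' :: "nat \<Rightarrow> 't"
  assume "\<forall>l\<in>X - {i}. t l = t' l"
  then have "f (t(i := a)) = f (t'(i := a))" for a
    by (intro depends_onD[OF assms]) auto
  then show "avg i f t = avg i f t'"
    by (simp add: avg_def)
qed

lemma depends_on_noise:
  assumes "finite A" "depends_on X f"
  shows "depends_on (X - {i \<in> A. \<rho> i = 0}) (noise \<rho> A f)"
  using assms(1)
proof (induction A rule: finite_induct)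
  case empty
  show ?case
    using assms(2) by (simp add: noise_def)
next
  case (insert i A)
  have eq: "noise \<rho> (insert i A) f t = \<rho> i * noise \<rho> A f t + (1 - \<rho> i) * avg i (noise \<rho> A f) t" for t
    using insert by (simp add: noise_def tensor_insert step_def algebra_simps)
  note avg = depends_on_avg[OF insert.IH, of i]
  show ?case
  proof (cases "\<rho> i = 0")
    case True
    then have "noise \<rho> (insert i A) f = avg i (noise \<rho> A f)"
      by (simp add: eq fun_eq_iff)
    then show ?thesis
      using avg True by (auto elim: depends_on_mono)
  next
    case False
    then have X: "{l \<in> insert i A. \<rho> l = 0} = {l \<in> A. \<rho> l = 0}"
      by auto
    show ?thesis
      unfolding X depends_on_def eq
    proof (intro allI impI)
      fix t t' :: "nat \<Rightarrow> 't"
      assume agree: "\<forall>l\<in>X - {l \<in> A. \<rho> l = 0}. t l = t' l"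
      have "noise \<rho> A f t = noise \<rho> A f t'"
        by (rule depends_onD[OF insert.IH]) (use agree in auto)
      moreover have "avg i (noise \<rho> A f) t = avg i (noise \<rho> A f) t'"
        by (rule depends_onD[OF avg]) (use agree in auto)
      ultimately show "\<rho> i * noise \<rho> A f t + (1 - \<rho> i) * avg i (noise \<rho> A f) t
          = \<rho> i * noise \<rho> A f t' + (1 - \<rho> i) * avg i (noise \<rho> A f) t'"
        by simp
    qed
  qed
qed

lemma mean_superset:
  assumes "finite A" "X \<subseteq> A" "depends_on X f"
  shows "mean A f = mean X f"
proof -
  have "mean (X \<union> B) f = mean X f" if "finite B" "B \<inter> X = {}" for B
    using that
  proof (induction B rule: finite_induct)
    case (insert i B)
    have "avg i f t = f t" for t
      using insert by (intro avg_const_coord depends_onD[OF assms(3)]) auto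
    then have "avg i f = f" ..
    moreover have "finite (X \<union> B)" "i \<notin> X \<union> B"
      using insert assms finite_subset by auto
    ultimately show ?case
      using insert by (simp add: mean_insert2)
  qed simp
  from this[of "A - X"] show ?thesis
    using assms by (simp add: Un_absorb1 Int_commute)
qed

text \<open>The last entry is split off, since removing the head would shift all indices. Dependence
  on \<open>{..<m}\<close> alone makes the unspecified entries beyond the list irrelevant.\<close>

lemma expectation_replicate_pmf:
  assumes "depends_on {..<m} g"
  shows "measure_pmf.expectation (replicate_pmf m \<pi>) (\<lambda>ts. g ((!) ts)) = mean {..<m} g t"
  using assms
proof (induction m arbitrary: g)
  case 0
  have "g ((!) []) = g t"
    by (rule depends_onD[OF 0]) simp
  then show ?case
    by simp
next
  case (Suc m)
  have fin: "finite (set_pmf (replicate_pmf m \<pi>))"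
    using finite_support by (simp add: set_replicate_pmf finite_lists_length_eq lists_eq_set)
  have "measure_pmf.expectation (replicate_pmf (Suc m) \<pi>) (\<lambda>ts. g ((!) ts))
      = measure_pmf.expectation (bind_pmf (replicate_pmf m \<pi>) (\<lambda>xs. map_pmf (\<lambda>a. xs @ [a]) \<pi>)) (\<lambda>ts. g ((!) ts))"
    using replicate_pmf_distrib[of m 1 \<pi>]
    by (simp add: map_pmf_def bind_assoc_pmf bind_return_pmf)
  also have "\<dots> = (\<Sum>xs\<in>set_pmf (replicate_pmf m \<pi>). pmf (replicate_pmf m \<pi>) xs *
      measure_pmf.expectation (map_pmf (\<lambda>a. xs @ [a]) \<pi>) (\<lambda>ts. g ((!) ts)))"
    using fin finite_support by (subst pmf_expectation_bind[of "set_pmf (replicate_pmf m \<pi>)"]) auto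
  also have "\<dots> = (\<Sum>xs\<in>set_pmf (replicate_pmf m \<pi>). pmf (replicate_pmf m \<pi>) xs * avg m g ((!) xs))"
  proof (rule sum.cong[OF refl])
    fix xs assume "xs \<in> set_pmf (replicate_pmf m \<pi>)"
    then have "length xs = m"
      by (simp add: set_replicate_pmf)
    then have "g ((!) (xs @ [a])) = g (((!) xs)(m := a))" for a
      by (intro depends_onD[OF Suc.prems]) (auto simp: nth_append)
    then have "measure_pmf.expectation (map_pmf (\<lambda>a. xs @ [a]) \<pi>) (\<lambda>ts. g ((!) ts)) = avg m g ((!) xs)"
      using finite_support by (simp add: integral_measure_pmf_real[of "set_pmf \<pi>"] avg_def mult.commute)
    then show "pmf (replicate_pmf m \<pi>) xs * measure_pmf.expectation (map_pmf (\<lambda>a. xs @ [a]) \<pi>) (\<lambda>ts. g ((!) ts))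
        = pmf (replicate_pmf m \<pi>) xs * avg m g ((!) xs)"
      by simp
  qed
  also have "\<dots> = measure_pmf.expectation (replicate_pmf m \<pi>) (\<lambda>xs. avg m g ((!) xs))"
    using fin by (simp add: integral_measure_pmf_real[of "set_pmf (replicate_pmf m \<pi>)"] mult.commute)
  also have "\<dots> = mean {..<m} (avg m g) t"
  proof (rule Suc.IH)
    show "depends_on {..<m} (avg m g)"
      using depends_on_avg[OF Suc.prems, of m] by (rule depends_on_mono) auto
  qed
  also have "\<dots> = mean {..<Suc m} g t"
    by (simp add: lessThan_Suc mean_insert2)
  finally show ?case .
qed

text \<open>Coordinate \<open>j\<close> is kept surely, so only sequences agreeing with
  \<open>t\<close> at \<open>j\<close> are averaged.\<close>

lemma noise_eq_0:
  assumes "finite A" "\<rho> j = 1" "\<And>s. s j = t j \<Longrightarrow> f s = 0"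
  shows "noise \<rho> A f t = 0"
proof -
  have "noise \<rho> A f s = 0" if "s j = t j" for s
    using assms(1) that
  proof (induction A arbitrary: s rule: finite_induct)
    case (insert i A)
    show ?case
    proof (cases "i = j")
      case True
      then show ?thesis
        using insert assms(2) by (simp add: noise_def tensor_insert step_def)
    next
      case False
      then have "avg i (noise \<rho> A f) s = 0"
        using insert by (simp add: avg_def)
      then show ?thesis
        using insert by (simp add: noise_def tensor_insert step_def)
    qed
  qed (simp add: noise_def assms(3))
  then show ?thesis
    by simp
qed

end

context symmetric_selection
begin

lemma total_nonneg: "0 \<le> total"
  unfolding total_def by (intro sum_nonneg expect_nonneg z_nonneg)

lemma total_le_1: "total \<le> 1"
proof -
  have "total = expect (\<lambda>t. \<Sum>i<n. z i t)"
    by (simp add: total_def expect_sum)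
  also have "\<dots> \<le> expect (\<lambda>t. 1)"
    by (intro expect_mono sum_z_le)
  finally show ?thesis
    by (simp add: expect_def mean_const)
qed

lemma expect_estimate: "expect (estimate c j) = expect (z j)"
  by (simp add: estimate_def expect_noise)

lemma estimate_nonneg: "0 \<le> c \<Longrightarrow> c \<le> 1 \<Longrightarrow> 0 \<le> estimate c j t"
  unfolding estimate_def by (intro noise_nonneg) (auto simp: keep_def z_nonneg)

lemma expect_quadratic_le:
  fixes a b r :: real and f :: "real \<Rightarrow> real"
  assumes f: "\<And>y. 0 \<le> y \<Longrightarrow> a + b * y - r * y\<^sup>2 \<le> f y" and "0 \<le> r"
  shows "a + b * total - r * ((1031 / 1000) * total + (257465 / 1000000) * total\<^sup>2)
    \<le> expect (\<lambda>t. f (\<Sum>j<n. estimate (7 / 10) j t))"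
proof -
  let ?y = "\<lambda>t. \<Sum>j<n. estimate (7 / 10) j t"
  have "a + b * total - r * ((1031 / 1000) * total + (257465 / 1000000) * total\<^sup>2)
      \<le> a + b * total + (- r) * expect (\<lambda>t. (?y t)\<^sup>2)"
    using mult_left_mono[OF second_moment_le \<open>0 \<le> r\<close>] by simp
  also have "\<dots> = expect (\<lambda>t. a + b * ?y t + (- r) * (?y t)\<^sup>2)"
  proof -
    have "expect (\<lambda>t. a) = a"
      by (simp add: expect_def mean_const)
    moreover have "expect ?y = total"
      by (simp add: expect_sum total_def expect_estimate)
    ultimately show ?thesis
      unfolding expect_add expect_scale by simp
  qed
  also have "\<dots> \<le> expect (\<lambda>t. f (?y t))"
    using f by (intro expect_mono) (simp add: sum_nonneg estimate_nonneg)
  finally show ?thesis .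
qed

text \<open>The parabola \<open>y - (y - g)^2 / (4 * \<kappa>)\<close> with
  \<open>g = 1 - \<kappa>\<close> touches the line \<open>y\<close> at \<open>g\<close> and the
  constant 1 at \<open>1 + \<kappa>\<close>. The best \<open>\<kappa>\<close> is the root mean
  square of \<open>y - 1\<close>; for the available bounds this is 1 at \<open>q = 0\<close> and
  about 0.537 at \<open>q = 1\<close>, and \<open>1 - 0.462 * q\<close> interpolates
  linearly.\<close>

lemma expect_min_ge: "(731 / 1000) * total \<le> expect (\<lambda>t. min (\<Sum>j<n. estimate (7 / 10) j t) 1)"
proof -
  define q where "q = total"
  define \<kappa> where "\<kappa> = 1 - (462 / 1000) * q"
  have q: "0 \<le> q" "q \<le> 1"
    by (simp_all add: q_def total_nonneg total_le_1)
  then have "0 < \<kappa>"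
    by (simp add: \<kappa>_def)
  define g where "g = (462 / 1000) * q"
  have "- (g\<^sup>2 / (4 * \<kappa>)) + (1 + 2 * g / (4 * \<kappa>)) * y - (1 / (4 * \<kappa>)) * y\<^sup>2 \<le> min y 1" for y
  proof -
    have "- (g\<^sup>2 / (4 * \<kappa>)) + (1 + 2 * g / (4 * \<kappa>)) * y - (1 / (4 * \<kappa>)) * y\<^sup>2 = y - (y - g)\<^sup>2 / (4 * \<kappa>)"
      using \<open>0 < \<kappa>\<close> by (simp add: power2_eq_square field_simps)
    moreover have "4 * \<kappa> * (y - 1) \<le> (y - g)\<^sup>2"
    proof -
      have "y - g = (y - 1) + \<kappa>"
        by (simp add: g_def \<kappa>_def)
      show ?thesis
        unfolding \<open>y - g = (y - 1) + \<kappa>\<close>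
        using zero_le_power2[of "(y - 1) - \<kappa>"] by (simp add: power2_eq_square algebra_simps)
    qed
    then have "y - 1 \<le> (y - g)\<^sup>2 / (4 * \<kappa>)"
      using \<open>0 < \<kappa>\<close> by (simp add: field_simps)
    ultimately show ?thesis
      using \<open>0 < \<kappa>\<close> by simp
  qed
  from expect_quadratic_le[OF this, folded q_def]
  have "- (g\<^sup>2 / (4 * \<kappa>)) + (1 + 2 * g / (4 * \<kappa>)) * q
      - 1 / (4 * \<kappa>) * ((1031 / 1000) * q + (257465 / 1000000) * q\<^sup>2)
    \<le> expect (\<lambda>t. min (\<Sum>j<n. estimate (7 / 10) j t) 1)"
    using \<open>0 < \<kappa>\<close> by simp
  moreover have "- (g\<^sup>2 / (4 * \<kappa>)) + (1 + 2 * g / (4 * \<kappa>)) * q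
      - 1 / (4 * \<kappa>) * ((1031 / 1000) * q + (257465 / 1000000) * q\<^sup>2)
    = q - (g\<^sup>2 - 2 * g * q + (1031 / 1000) * q + (257465 / 1000000) * q\<^sup>2) / (4 * \<kappa>)"
    using \<open>0 < \<kappa>\<close> by (simp add: field_simps)
  moreover have "(g\<^sup>2 - 2 * g * q + (1031 / 1000) * q + (257465 / 1000000) * q\<^sup>2) / (4 * \<kappa>) \<le> (269 / 1000) * q"
  proof -
    have "q\<^sup>2 \<le> q"
      using q by (simp add: power2_eq_square mult_left_le)
    then have "g\<^sup>2 - 2 * g * q + (1031 / 1000) * q + (257465 / 1000000) * q\<^sup>2 \<le> (269 / 1000) * q * (4 * \<kappa>)"
      using q by (simp add: g_def \<kappa>_def power2_eq_square algebra_simps)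
    moreover have "0 < 4 * \<kappa>"
      using \<open>0 < \<kappa>\<close> by simp
    ultimately show ?thesis
      by (simp only: pos_divide_le_eq)
  qed
  ultimately show ?thesis
    unfolding q_def[symmetric] by linarith
qed

text \<open>For small \<open>q\<close> the minorant must pass through the origin, since a constant
  loss would not be proportional to \<open>q\<close>; for larger \<open>q\<close> the second
  parabola is used. The second case is nearly tight at \<open>q = 1\<close>.\<close>

lemma expect_ocs_bound_ge:
  "(704 / 1000) * total \<le> expect (\<lambda>t. ocs_bound (\<Sum>j<n. estimate (7 / 10) j t))"
proof -
  define q where "q = total"
  have q: "0 \<le> q" "q \<le> 1"
    by (simp_all add: q_def total_nonneg total_le_1)
  show ?thesis
  proof (cases "q \<le> 4 / 10")
    case True
    have "0 + 1 * q - (26 / 100) * ((1031 / 1000) * q + (257465 / 1000000) * q\<^sup>2)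
        \<le> expect (\<lambda>t. ocs_bound (\<Sum>j<n. estimate (7 / 10) j t))"
      unfolding q_def using ocs_bound_ge_parabola_through_0 by (intro expect_quadratic_le) simp_all
    moreover have "q\<^sup>2 \<le> (4 / 10) * q"
      unfolding power2_eq_square using True q by (intro mult_right_mono)
    ultimately show ?thesis
      unfolding q_def[symmetric] using q by (simp add: field_simps)
  next
    case False
    have "- (3 / 100) + (1185 / 1000) * q - (35 / 100) * ((1031 / 1000) * q + (257465 / 1000000) * q\<^sup>2)
        \<le> expect (\<lambda>t. ocs_bound (\<Sum>j<n. estimate (7 / 10) j t))"
      unfolding q_def using ocs_bound_ge_parabola by (intro expect_quadratic_le) simp_all
    \<comment> \<open>The chord of \<open>q^2\<close> over \<open>[0.4, 1]\<close> makes the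
      remaining inequality linear.\<close>
    moreover have "0 \<le> (1 - q) * (q - 4 / 10)"
      using False q by simp
    then have "q\<^sup>2 \<le> (14 / 10) * q - 4 / 10"
      by (simp add: power2_eq_square field_simps)
    ultimately show ?thesis
      unfolding q_def[symmetric] using q by (simp add: field_simps)
  qed
qed

end

section \<open>Expectations over finitely supported laws\<close>

lemma expectation_bind_finite:
  fixes h :: "'b \<Rightarrow> real"
  assumes "finite (set_pmf p)" "\<And>x. x \<in> set_pmf p \<Longrightarrow> finite (set_pmf (f x))"
  shows "measure_pmf.expectation (bind_pmf p f) h = measure_pmf.expectation p (\<lambda>x. measure_pmf.expectation (f x) h)"
  using assms by (simp add: pmf_expectation_bind[of "set_pmf p"] integral_measure_pmf_real[of "set_pmf p"] mult.commute)

lemma expectation_sum_finite: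
  fixes g :: "'x \<Rightarrow> 'a \<Rightarrow> real"
  assumes "finite (set_pmf p)"
  shows "measure_pmf.expectation p (\<lambda>y. \<Sum>x\<in>X. c x * g x y) = (\<Sum>x\<in>X. c x * measure_pmf.expectation p (g x))"
  using assms by (subst Bochner_Integration.integral_sum) (auto intro: integrable_measure_pmf_finite)

lemma expectation_mono_finite:
  fixes f g :: "'a \<Rightarrow> real"
  assumes "finite (set_pmf p)" "\<And>x. x \<in> set_pmf p \<Longrightarrow> f x \<le> g x"
  shows "measure_pmf.expectation p f \<le> measure_pmf.expectation p g"
  using assms by (intro integral_mono_AE) (auto intro: integrable_measure_pmf_finite simp: AE_measure_pmf_iff)

lemma expectation_cong_support:
  fixes f g :: "'a \<Rightarrow> real"
  assumes "\<And>x. x \<in> set_pmf p \<Longrightarrow> f x = g x"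
  shows "measure_pmf.expectation p f = measure_pmf.expectation p g"
  using assms by (intro integral_cong_AE) (auto simp: AE_measure_pmf_iff)

lemma sum_prob_disjoint_le_1:
  assumes "finite X" "\<And>M x y. M \<in> set_pmf p \<Longrightarrow> x \<in> X \<Longrightarrow> y \<in> X \<Longrightarrow> M \<in> A x \<Longrightarrow> M \<in> A y \<Longrightarrow> x = y"
  shows "(\<Sum>x\<in>X. measure_pmf.prob p (A x)) \<le> 1"
proof -
  have "(\<Sum>x\<in>X. measure_pmf.prob p (A x)) = (\<Sum>x\<in>X. measure_pmf.prob p (A x \<inter> set_pmf p))"
    by (simp add: measure_Int_set_pmf)
  also have "\<dots> = measure_pmf.prob p (\<Union>x\<in>X. A x \<inter> set_pmf p)"
    using assms by (intro measure_pmf.finite_measure_finite_Union[symmetric])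
      (auto simp: disjoint_family_on_def)
  also have "\<dots> \<le> 1"
    by simp
  finally show ?thesis .
qed

section \<open>The resampling estimator\<close>

text \<open>The first factor is needed because a symmetric rule is unconstrained off the support of the types.\<close>

definition match_prob ::
    "('u, 't) osm \<Rightarrow> ('t list \<Rightarrow> ('u \<times> nat) set pmf) \<Rightarrow> 'u \<Rightarrow> nat \<Rightarrow> (nat \<Rightarrow> 't) \<Rightarrow> real" where
  "match_prob I opt u j t = of_bool (\<forall>i<horizon I. t i \<in> set_pmf (type_dist I))
     * measure_pmf.prob (opt (map t [0..<horizon I])) {M. (u, j) \<in> M}"

text \<open>Entries \<open>ts ! i\<close> with \<open>i \<ge> length ts\<close> are unspecified, but \<open>keep\<close> is 0 there, so they are averaged out.\<close>

definition resampling_estimator ::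
    "('u, 't) osm \<Rightarrow> ('t list \<Rightarrow> ('u \<times> nat) set pmf) \<Rightarrow> 't list \<Rightarrow> 'u \<Rightarrow> real" where
  "resampling_estimator I opt ts u =
     finite_pmf.noise (type_dist I) (keep (7 / 10) (length ts - 1)) {..<horizon I}
       (match_prob I opt u (length ts - 1)) ((!) ts)"

locale osm_rule =
  fixes I :: "('u, 't) osm" and opt :: "'t list \<Rightarrow> ('u \<times> nat) set pmf"
  assumes inst: "osm_instance I" and sym: "symmetric_opt_rule I opt"
begin

sublocale finite_pmf "type_dist I"
  using inst by unfold_locales (simp add: osm_instance_def)

lemma finite_offline: "finite (offline I)"
  using inst by (simp add: osm_instance_def)

lemma weight_nonneg: "u \<in> offline I \<Longrightarrow> 0 \<le> weight I u"
  using inst by (simp add: osm_instance_def)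

lemma set_types_pmf: "set_pmf (types_pmf I) = {ts. set ts \<subseteq> set_pmf (type_dist I) \<and> length ts = horizon I}"
  by (auto simp: types_pmf_def set_replicate_pmf)

lemma finite_types_pmf: "finite (set_pmf (types_pmf I))"
  unfolding set_types_pmf by (rule finite_lists_length_eq[OF finite_support])

lemma opt_matching:
  assumes "ts \<in> set_pmf (types_pmf I)" "M \<in> set_pmf (opt ts)"
  shows "inj_on fst M" "inj_on snd M"
    and "\<And>u j. (u, j) \<in> M \<Longrightarrow> j < horizon I \<and> u \<in> nbrs I (ts ! j) \<and> u \<in> offline I"
proof -
  have "is_matching (realized_graph I ts) M"
    using sym assms by (auto simp: symmetric_opt_rule_def max_weight_matching_def)
  then show "inj_on fst M" "inj_on snd M"
    and edge: "\<And>u j. (u, j) \<in> M \<Longrightarrow> j < horizon I \<and> u \<in> nbrs I (ts ! j) \<and> u \<in> offline I"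
    using assms inst
    by (auto simp: is_matching_def realized_graph_def set_types_pmf osm_instance_def dest!: subsetD nth_mem)
qed

lemma opt_subset:
  assumes "ts \<in> set_pmf (types_pmf I)"
  shows "set_pmf (opt ts) \<subseteq> Pow (offline I \<times> {..<horizon I})"
  using opt_matching(3)[OF assms] by auto

lemma finite_opt:
  assumes "ts \<in> set_pmf (types_pmf I)"
  shows "finite (set_pmf (opt ts))"
  using opt_subset[OF assms] by (rule finite_subset) (simp add: finite_offline)

lemma map_in_types_pmf:
  "(\<forall>i<horizon I. t i \<in> set_pmf (type_dist I)) \<longleftrightarrow> map t [0..<horizon I] \<in> set_pmf (types_pmf I)"
  by (auto simp: set_types_pmf)

lemma match_prob_eq_0: "u \<notin> nbrs I (t j) \<Longrightarrow> match_prob I opt u j t = 0"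
proof (cases "\<forall>i<horizon I. t i \<in> set_pmf (type_dist I)")
  case True
  assume u: "u \<notin> nbrs I (t j)"
  have "(u, j) \<notin> M" if M: "M \<in> set_pmf (opt (map t [0..<horizon I]))" for M
    using opt_matching(3)[OF _ M, of u j] True u by (auto simp: map_in_types_pmf)
  then show ?thesis
    by (auto simp: match_prob_def measure_pmf_zero_iff)
qed (simp add: match_prob_def)

lemma sum_match_prob_offline_le: "(\<Sum>u\<in>offline I. match_prob I opt u j t) \<le> 1"
proof (cases "\<forall>i<horizon I. t i \<in> set_pmf (type_dist I)")
  case True
  then have "(\<Sum>u\<in>offline I. match_prob I opt u j t)
      = (\<Sum>u\<in>offline I. measure_pmf.prob (opt (map t [0..<horizon I])) {M. (u, j) \<in> M})"
    by (simp add: match_prob_def)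
  also have "\<dots> \<le> 1"
  proof (rule sum_prob_disjoint_le_1[OF finite_offline])
    fix M u v
    assume "M \<in> set_pmf (opt (map t [0..<horizon I]))" "M \<in> {M. (u, j) \<in> M}" "M \<in> {M. (v, j) \<in> M}"
    then show "u = v"
      using opt_matching(2)[of "map t [0..<horizon I]" M] True
      by (auto simp: map_in_types_pmf dest: inj_onD[of snd M "(u, j)" "(v, j)"])
  qed
  finally show ?thesis .
next
  case False
  then have "match_prob I opt u j t = 0" for u
    by (simp only: match_prob_def of_bool_def if_False mult_zero_left)
  then show ?thesis
    by simp
qed

text \<open>Symmetry of the rule relabels edges \<open>(u, i)\<close> to \<open>(u, p i)\<close>; as
  \<open>p\<close> is injective, the edge \<open>(u, p i)\<close> lies in the image exactly when
  \<open>(u, i)\<close> lies in the original matching.\<close>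

lemma match_prob_permute:
  assumes p: "p permutes {..<horizon I}" and "i < horizon I"
  shows "match_prob I opt u (p i) t = match_prob I opt u i (t \<circ> p)"
proof -
  let ?ts = "map t [0..<horizon I]"
  have supp: "(\<forall>i<horizon I. t i \<in> set_pmf (type_dist I)) \<longleftrightarrow> (\<forall>i<horizon I. (t \<circ> p) i \<in> set_pmf (type_dist I))"
    using permutes_image[OF p] by (auto simp: image_iff set_eq_iff) (metis lessThan_iff)
  have eq: "measure_pmf.prob (opt ?ts) {M. (u, p i) \<in> M}
      = measure_pmf.prob (opt (map (t \<circ> p) [0..<horizon I])) {M. (u, i) \<in> M}"
    if "\<forall>i<horizon I. t i \<in> set_pmf (type_dist I)"
  proof -
    have "permute_list p ?ts = map (t \<circ> p) [0..<horizon I]"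
      using permutes_in_image[OF p] by (auto simp: permute_list_def intro!: map_cong)
    then have "opt ?ts = map_pmf (\<lambda>M. (\<lambda>(u, i). (u, p i)) ` M) (opt (map (t \<circ> p) [0..<horizon I]))"
      using sym p that unfolding symmetric_opt_rule_def map_in_types_pmf by metis
    then have "measure_pmf.prob (opt ?ts) {M. (u, p i) \<in> M}
        = measure_pmf.prob (opt (map (t \<circ> p) [0..<horizon I]))
            ((\<lambda>M. (\<lambda>(u, i). (u, p i)) ` M) -` {M. (u, p i) \<in> M})"
      by simp
    also have "(\<lambda>M. (\<lambda>(u, i). (u, p i)) ` M) -` {M. (u, p i) \<in> M} = {M. (u, i) \<in> M}"
      using permutes_inj[OF p] by (auto simp: inj_eq image_iff) (metis (no_types, lifting) case_prod_conv)
    finally show ?thesis .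
  qed
  show ?thesis
  proof (cases "\<forall>i<horizon I. t i \<in> set_pmf (type_dist I)")
    case True
    show ?thesis
      unfolding match_prob_def supp[symmetric] eq[OF True] ..
  next
    case False
    show ?thesis
      unfolding match_prob_def supp[symmetric] by (simp only: False of_bool_eq mult_zero_left)
  qed
qed

sublocale sel: symmetric_selection "type_dist I" "horizon I" "match_prob I opt u" for u
proof unfold_locales
  show "0 \<le> match_prob I opt u i t" for i t
    by (simp add: match_prob_def)
  show "match_prob I opt u (p i) t = match_prob I opt u i (t \<circ> p)"
    if "p permutes {..<horizon I}" "i < horizon I" for p i t
    using that by (rule match_prob_permute)
  show "(\<Sum>i<horizon I. match_prob I opt u i t) \<le> 1" for t
  proof (cases "\<forall>i<horizon I. t i \<in> set_pmf (type_dist I)")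
    case True
    then have "(\<Sum>i<horizon I. match_prob I opt u i t)
        = (\<Sum>i<horizon I. measure_pmf.prob (opt (map t [0..<horizon I])) {M. (u, i) \<in> M})"
      by (simp add: match_prob_def)
    also have "\<dots> \<le> 1"
    proof (rule sum_prob_disjoint_le_1)
      fix M i j
      assume "M \<in> set_pmf (opt (map t [0..<horizon I]))" "M \<in> {M. (u, i) \<in> M}" "M \<in> {M. (u, j) \<in> M}"
      then show "i = j"
        using opt_matching(1)[of "map t [0..<horizon I]" M] True
        by (auto simp: map_in_types_pmf dest: inj_onD[of fst M "(u, i)" "(u, j)"])
    qed simp
    finally show ?thesis .
  next
    case False
    then have "match_prob I opt u i t = 0" for i
      by (simp only: match_prob_def of_bool_def if_False mult_zero_left)
    then show ?thesis
      by simp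
  qed
qed

abbreviation est :: "'u \<Rightarrow> nat \<Rightarrow> (nat \<Rightarrow> 't) \<Rightarrow> real" where
  "est u \<equiv> sel.estimate u (7 / 10)"

lemma resampling_estimator_eq: "resampling_estimator I opt ts u = est u (length ts - 1) ((!) ts)"
  by (simp add: resampling_estimator_def sel.estimate_def)

lemma depends_on_match_prob: "depends_on {..<horizon I} (match_prob I opt u j)"
  unfolding depends_on_def
proof (intro allI impI)
  fix t t' :: "nat \<Rightarrow> 't"
  assume "\<forall>i\<in>{..<horizon I}. t i = t' i"
  then have eq: "map t [0..<horizon I] = map t' [0..<horizon I]"
    by simp
  show "match_prob I opt u j t = match_prob I opt u j t'"
    unfolding match_prob_def map_in_types_pmf eq ..
qed

lemma depends_on_est: "depends_on {..<Suc j} (est u j)"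
proof -
  have "depends_on ({..<horizon I} - {i \<in> {..<horizon I}. keep (7 / 10) j i = 0}) (est u j)"
    unfolding sel.estimate_def by (intro depends_on_noise depends_on_match_prob) simp
  then show ?thesis
    by (rule depends_on_mono) (auto simp: keep_def split: if_splits)
qed

lemma resampling_estimator_take:
  assumes "j < length ts"
  shows "resampling_estimator I opt (take (Suc j) ts) u = est u j ((!) ts)"
proof -
  have "length (take (Suc j) ts) - 1 = j"
    using assms by simp
  then have "resampling_estimator I opt (take (Suc j) ts) u = est u j ((!) (take (Suc j) ts))"
    by (simp only: resampling_estimator_eq)
  also have "\<dots> = est u j ((!) ts)"
    by (rule depends_onD[OF depends_on_est]) simp
  finally show ?thesis .
qed

text \<open>The same positive linear operator acts for every \<open>u\<close> and fixes constants;
  it is applied to the nonnegative function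
  \<open>1 - (\<Sum>u\<in>offline I. match_prob I opt u j t)\<close>.\<close>

lemma sum_est_le: "(\<Sum>u\<in>offline I. est u j t) \<le> 1"
proof -
  have "0 \<le> noise (keep (7 / 10) j) {..<horizon I} (\<lambda>t. 1 + (-1) * (\<Sum>u\<in>offline I. match_prob I opt u j t)) t"
    using sum_match_prob_offline_le by (intro noise_nonneg) (auto simp: keep_def)
  also have "\<dots> = 1 + (-1) * (\<Sum>u\<in>offline I. est u j t)"
    unfolding noise_def sel.estimate_def
    by (simp only: tensor_add tensor_scale tensor_sum finite_lessThan noise_const[unfolded noise_def])
  finally show ?thesis
    by simp
qed

lemma fractional_vector_estimator: "fractional_vector (offline I) (resampling_estimator I opt ts)"
  unfolding fractional_vector_def
proof (intro conjI ballI)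
  show sum: "(\<Sum>u\<in>offline I. resampling_estimator I opt ts u) \<le> 1"
    by (simp add: resampling_estimator_eq sum_est_le)
  show nonneg: "0 \<le> resampling_estimator I opt ts u" for u
    by (simp add: resampling_estimator_eq sel.estimate_nonneg)
  fix u assume "u \<in> offline I"
  then have "resampling_estimator I opt ts u \<le> (\<Sum>u\<in>offline I. resampling_estimator I opt ts u)"
    using nonneg finite_offline by (intro member_le_sum) auto
  with sum show "resampling_estimator I opt ts u \<le> 1"
    by simp
qed

lemma fractional_algorithm_estimator: "fractional_algorithm I (resampling_estimator I opt)"
  unfolding fractional_algorithm_def
proof (intro allI impI conjI ballI fractional_vector_estimator)
  fix ts u
  assume ts: "ts \<noteq> [] \<and> length ts \<le> horizon I \<and> set ts \<subseteq> set_pmf (type_dist I)"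
    and pos: "0 < resampling_estimator I opt ts u"
  let ?j = "length ts - 1"
  show "u \<in> nbrs I (last ts)"
  proof (rule ccontr)
    assume "u \<notin> nbrs I (last ts)"
    then have "est u ?j ((!) ts) = 0"
      unfolding sel.estimate_def using ts
      by (intro noise_eq_0) (auto simp: keep_def last_conv_nth match_prob_eq_0)
    with pos show False
      by (simp add: resampling_estimator_eq)
  qed
qed

lemma expectation_types:
  assumes "depends_on {..<horizon I} g"
  shows "measure_pmf.expectation (types_pmf I) (\<lambda>ts. g ((!) ts)) = sel.expect g"
  unfolding types_pmf_def sel.expect_def by (rule expectation_replicate_pmf[OF assms])

lemma expectation_opt:
  fixes h :: "('u \<times> nat) set \<Rightarrow> real"
  shows "measure_pmf.expectation (opt_pmf I opt) h
    = measure_pmf.expectation (types_pmf I) (\<lambda>ts. measure_pmf.expectation (opt ts) h)"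
  unfolding opt_pmf_def using finite_types_pmf finite_opt by (rule expectation_bind_finite)

lemma prob_opt_pmf: "measure_pmf.prob (opt_pmf I opt) {M. (u, j) \<in> M} = sel.expect (match_prob I opt u j)"
proof -
  have "measure_pmf.prob (opt_pmf I opt) {M. (u, j) \<in> M}
      = measure_pmf.expectation (opt_pmf I opt) (indicator {M. (u, j) \<in> M})"
    by simp
  also have "\<dots> = measure_pmf.expectation (types_pmf I) (\<lambda>ts. measure_pmf.prob (opt ts) {M. (u, j) \<in> M})"
    unfolding expectation_opt by simp
  also have "\<dots> = measure_pmf.expectation (types_pmf I) (\<lambda>ts. match_prob I opt u j ((!) ts))"
  proof (rule expectation_cong_support)
    fix ts assume ts: "ts \<in> set_pmf (types_pmf I)"
    then have "map ((!) ts) [0..<horizon I] = ts"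
      using map_nth[of ts] unfolding set_types_pmf by simp
    with ts show "measure_pmf.prob (opt ts) {M. (u, j) \<in> M} = match_prob I opt u j ((!) ts)"
      by (simp add: match_prob_def map_in_types_pmf)
  qed
  also have "\<dots> = sel.expect (match_prob I opt u j)"
    by (rule expectation_types[OF depends_on_match_prob])
  finally show ?thesis .
qed

text \<open>Resampling preserves the mean, and dependence on the prefix alone lets the full product
  law be replaced by that of the first \<open>Suc j\<close> types.\<close>

lemma unbiased_estimator_estimator: "unbiased_estimator I opt (resampling_estimator I opt)"
  unfolding unbiased_estimator_def
proof (intro conjI ballI allI impI fractional_algorithm_estimator)
  fix u j assume "u \<in> offline I" "j < horizon I"
  have "measure_pmf.expectation (replicate_pmf (Suc j) (type_dist I)) (\<lambda>ts. resampling_estimator I opt ts u)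
      = measure_pmf.expectation (replicate_pmf (Suc j) (type_dist I)) (\<lambda>ts. est u j ((!) ts))"
  proof (rule expectation_cong_support)
    fix ts assume "ts \<in> set_pmf (replicate_pmf (Suc j) (type_dist I))"
    then have "length ts - 1 = j"
      by (simp only: set_replicate_pmf) simp
    then show "resampling_estimator I opt ts u = est u j ((!) ts)"
      by (simp add: resampling_estimator_eq)
  qed
  also have "\<dots> = mean {..<Suc j} (est u j) (\<lambda>_. undefined)"
    by (rule expectation_replicate_pmf[OF depends_on_est])
  also have "\<dots> = sel.expect (est u j)"
    unfolding sel.expect_def using \<open>j < horizon I\<close>
    by (subst mean_superset[of "{..<horizon I}" "{..<Suc j}"]) (auto intro: depends_on_est)
  also have "\<dots> = measure_pmf.prob (opt_pmf I opt) {M. (u, j) \<in> M}"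
    by (simp add: sel.expect_estimate prob_opt_pmf)
  finally show "measure_pmf.expectation (replicate_pmf (Suc j) (type_dist I)) (\<lambda>ts. resampling_estimator I opt ts u)
      = measure_pmf.prob (opt_pmf I opt) {M. (u, j) \<in> M}" .
qed

lemma total_mass_run:
  assumes "ts \<in> set_pmf (types_pmf I)"
  shows "total_mass (fractional_run I (resampling_estimator I opt) ts) u = (\<Sum>j<horizon I. est u j ((!) ts))"
proof -
  have "total_mass (fractional_run I (resampling_estimator I opt) ts) u
      = (\<Sum>j\<leftarrow>[0..<horizon I]. resampling_estimator I opt (take (Suc j) ts) u)"
    by (simp add: total_mass_def fractional_run_def comp_def)
  also have "\<dots> = (\<Sum>j<horizon I. resampling_estimator I opt (take (Suc j) ts) u)"
    by (simp add: interv_sum_list_conv_sum_set_nat atLeast0LessThan)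
  also have "\<dots> = (\<Sum>j<horizon I. est u j ((!) ts))"
    using assms by (intro sum.cong refl resampling_estimator_take) (simp add: set_types_pmf)
  finally show ?thesis .
qed

lemma expectation_total_mass:
  fixes f :: "real \<Rightarrow> real"
  shows "measure_pmf.expectation (types_pmf I)
      (\<lambda>ts. f (total_mass (fractional_run I (resampling_estimator I opt) ts) u))
    = sel.expect (\<lambda>t. f (\<Sum>j<horizon I. est u j t))"
proof -
  have "depends_on {..<horizon I} (\<lambda>t. f (\<Sum>j<horizon I. est u j t))"
    unfolding depends_on_def
  proof (intro allI impI)
    fix t t' :: "nat \<Rightarrow> 't"
    assume "\<forall>i\<in>{..<horizon I}. t i = t' i"
    then have "est u j t = est u j t'" if "j < horizon I" for j
      using that by (intro depends_onD[OF depends_on_est]) auto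
    then show "f (\<Sum>j<horizon I. est u j t) = f (\<Sum>j<horizon I. est u j t')"
      by simp
  qed
  from expectation_types[OF this] show ?thesis
    by (subst expectation_cong_support[where g = "\<lambda>ts. f (\<Sum>j<horizon I. est u j ((!) ts))"])
      (simp_all add: total_mass_run)
qed

text \<open>A matching covers \<open>u\<close> at most once, so the event that \<open>u\<close> is
  covered is a sum of edge indicators and its expectation a sum of edge probabilities.\<close>

lemma opt_value_eq: "opt_value I opt = (\<Sum>u\<in>offline I. weight I u * sel.total u)"
proof -
  have finite_opt_pmf: "finite (set_pmf (opt_pmf I opt))"
    using finite_types_pmf finite_opt by (auto simp: opt_pmf_def)
  have "opt_value I opt = measure_pmf.expectation (opt_pmf I opt)
      (\<lambda>M. \<Sum>u\<in>offline I. weight I u * (\<Sum>j<horizon I. 1 * indicator {M. (u, j) \<in> M} M))"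
    unfolding opt_value_def
  proof (rule expectation_cong_support)
    fix M assume "M \<in> set_pmf (opt_pmf I opt)"
    then obtain ts where ts: "ts \<in> set_pmf (types_pmf I)" "M \<in> set_pmf (opt ts)"
      by (auto simp: opt_pmf_def)
    have "(\<Sum>j<horizon I. 1 * indicator {M. (u, j) \<in> M} M) = (of_bool (u \<in> fst ` M) :: real)" for u
    proof (cases "u \<in> fst ` M")
      case True
      then obtain j where j: "(u, j) \<in> M"
        by auto
      then have "(u, k) \<in> M \<longleftrightarrow> k = j" for k
        using inj_onD[OF opt_matching(1)[OF ts], of "(u, k)" "(u, j)"] by auto
      with j show ?thesis
        using True opt_matching(3)[OF ts j] by (simp add: indicator_def of_bool_def)
    next
      case False
      then have "(u, j) \<notin> M" for j
        by force
      with False show ?thesis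
        by simp
    qed
    moreover have "fst ` M \<subseteq> offline I"
      using opt_matching(3)[OF ts] by auto
    ultimately show "matching_weight I M
        = (\<Sum>u\<in>offline I. weight I u * (\<Sum>j<horizon I. 1 * indicator {M. (u, j) \<in> M} M))"
      unfolding matching_weight_def using finite_offline
      by (simp add: of_bool_def if_distrib[of "(*) _"] sum.If_cases Int_absorb1 cong: if_cong)
  qed
  also have "\<dots> = (\<Sum>u\<in>offline I. weight I u * (\<Sum>j<horizon I. 1 * measure_pmf.prob (opt_pmf I opt) {M. (u, j) \<in> M}))"
    unfolding expectation_sum_finite[OF finite_opt_pmf] by simp
  finally show ?thesis
    by (simp add: prob_opt_pmf sel.total_def)
qed

lemma fractional_ratio:
  "0.731 * opt_value I opt
    \<le> measure_pmf.expectation (types_pmf I) (fractional_value I (resampling_estimator I opt))"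
proof -
  have "0.731 * opt_value I opt = (\<Sum>u\<in>offline I. weight I u * ((731 / 1000) * sel.total u))"
    by (simp add: opt_value_eq sum_distrib_left mult.left_commute)
  also have "\<dots> \<le> (\<Sum>u\<in>offline I. weight I u * sel.expect (\<lambda>t. min (\<Sum>j<horizon I. est u j t) 1))"
    by (intro sum_mono mult_left_mono sel.expect_min_ge weight_nonneg)
  also have "\<dots> = measure_pmf.expectation (types_pmf I) (fractional_value I (resampling_estimator I opt))"
    unfolding fractional_value_def expectation_sum_finite[OF finite_types_pmf]
    by (simp add: expectation_total_mass[of "\<lambda>y. min y 1"])
  finally show ?thesis .
qed

end

text \<open>A vertex becomes matched at its first selection and stays so; hence the selection
  guarantee bounds the probability of being matched.\<close>

lemma fst_match_selected: "fst ` match_selected M j ss = fst ` M \<union> {u. Some u \<in> set ss}"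
  by (induction ss arbitrary: M j) (auto split: option.splits)

text \<open>Gives finite support of the selections, so that expectations commute with the weighted
  sum over offline vertices.\<close>

lemma selections_from_subset:
  assumes S: "\<And>h x. fractional_vector L x \<Longrightarrow> set_pmf (S L h x) \<subseteq> Some ` L \<union> {None}"
    and "\<And>x. x \<in> set xs \<Longrightarrow> fractional_vector L x"
  shows "set_pmf (selections_from S L h xs) \<subseteq> {ss. set ss \<subseteq> Some ` L \<union> {None} \<and> length ss = length xs}"
  using assms(2)
proof (induction xs arbitrary: h)
  case (Cons x xs)
  have "fractional_vector L x" "\<And>y. y \<in> set xs \<Longrightarrow> fractional_vector L y"
    using Cons.prems by auto
  then have sub: "set_pmf (S L h x) \<subseteq> Some ` L \<union> {None}"
    and IH: "\<And>h. set_pmf (selections_from S L h xs)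
      \<subseteq> {ss. set ss \<subseteq> Some ` L \<union> {None} \<and> length ss = length xs}"
    using S Cons.IH by blast+
  have "set (s # ss) \<subseteq> Some ` L \<union> {None} \<and> length (s # ss) = length (x # xs)"
    if "s \<in> set_pmf (S L h x)" "ss \<in> set_pmf (selections_from S L (h @ [(x, s)]) xs)" for s ss
    using that sub IH[of "h @ [(x, s)]"] by auto
  then show ?case
    by (simp only: selections_from.simps set_bind_pmf set_map_pmf) blast
qed simp

context osm_rule
begin

text \<open>Given the types, the fractional run is a fixed sequence, so the OCS guarantee applies
  for each type list separately and is averaged over the types afterwards.\<close>

lemma integral_ratio:
  assumes S: "multiway_ocs S"
  shows "0.704 * opt_value I opt
    \<le> measure_pmf.expectation (bind_pmf (types_pmf I) (ocs_rounding S I (resampling_estimator I opt))) (matching_weight I)"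
proof -
  let ?run = "fractional_run I (resampling_estimator I opt)"
  let ?sel = "\<lambda>ts. selections S (offline I) (?run ts)"
  have frac: "fractional_vector (offline I) x" if "x \<in> set (?run ts)" for x ts
    using that by (auto simp: fractional_run_def fractional_vector_estimator)
  have sub: "set_pmf (S (offline I) h x) \<subseteq> Some ` offline I \<union> {None}" if "fractional_vector (offline I) x" for h x
  proof -
    have "set_pmf (S (offline I) h x)
        \<subseteq> Some ` {u \<in> offline I. x u > 0} \<union> (if (\<Sum>u\<in>offline I. x u) < 1 then {None} else {})"
      using S that finite_offline unfolding multiway_ocs_def by blast
    also have "\<dots> \<subseteq> Some ` offline I \<union> {None}"
      by auto
    finally show ?thesis .
  qed
  have sel_subset: "set_pmf (?sel ts) \<subseteq> {ss. set ss \<subseteq> Some ` offline I \<union> {None} \<and> length ss = length (?run ts)}" for ts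
    unfolding selections_def using sub frac by (rule selections_from_subset)
  have fin_sel: "finite (set_pmf (?sel ts))" for ts
    using sel_subset by (rule finite_subset) (intro finite_lists_length_eq, simp add: finite_offline)
  have ts_bound: "(\<Sum>u\<in>offline I. weight I u * ocs_bound (total_mass (?run ts) u))
      \<le> measure_pmf.expectation (ocs_rounding S I (resampling_estimator I opt) ts) (matching_weight I)" for ts
  proof -
    have "(\<Sum>u\<in>offline I. weight I u * ocs_bound (total_mass (?run ts) u))
        \<le> (\<Sum>u\<in>offline I. weight I u * measure_pmf.prob (?sel ts) {ss. Some u \<in> set ss})"
    proof (intro sum_mono mult_left_mono weight_nonneg)
      fix u assume "u \<in> offline I"
      then show "ocs_bound (total_mass (?run ts) u) \<le> measure_pmf.prob (?sel ts) {ss. Some u \<in> set ss}"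
        using S finite_offline frac unfolding multiway_ocs_def by blast
    qed
    also have "\<dots> = (\<Sum>u\<in>offline I. weight I u * measure_pmf.expectation (?sel ts) (indicator {ss. Some u \<in> set ss}))"
      by simp
    also have "\<dots> = measure_pmf.expectation (?sel ts) (\<lambda>ss. \<Sum>u\<in>offline I. weight I u * indicator {ss. Some u \<in> set ss} ss)"
      by (rule expectation_sum_finite[OF fin_sel, symmetric])
    also have "\<dots> = measure_pmf.expectation (?sel ts) (\<lambda>ss. matching_weight I (match_selected {} 0 ss))"
    proof (rule expectation_cong_support)
      fix ss assume "ss \<in> set_pmf (?sel ts)"
      then have "{u. Some u \<in> set ss} \<subseteq> offline I"
        using sel_subset[of ts] by auto
      then show "(\<Sum>u\<in>offline I. weight I u * indicator {ss. Some u \<in> set ss} ss) = matching_weight I (match_selected {} 0 ss)"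
        unfolding matching_weight_def fst_match_selected using finite_offline
        by (simp add: indicator_def of_bool_def if_distrib[of "(*) _"] sum.If_cases Int_absorb1 cong: if_cong)
    qed
    also have "\<dots> = measure_pmf.expectation (ocs_rounding S I (resampling_estimator I opt) ts) (matching_weight I)"
      by (simp add: ocs_rounding_def)
    finally show ?thesis .
  qed
  have "0.704 * opt_value I opt = (\<Sum>u\<in>offline I. weight I u * ((704 / 1000) * sel.total u))"
    by (simp add: opt_value_eq sum_distrib_left mult.left_commute)
  also have "\<dots> \<le> (\<Sum>u\<in>offline I. weight I u * sel.expect (\<lambda>t. ocs_bound (\<Sum>j<horizon I. est u j t)))"
    by (intro sum_mono mult_left_mono sel.expect_ocs_bound_ge weight_nonneg)
  also have "\<dots> = measure_pmf.expectation (types_pmf I) (\<lambda>ts. \<Sum>u\<in>offline I. weight I u * ocs_bound (total_mass (?run ts) u))"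
    unfolding expectation_sum_finite[OF finite_types_pmf] by (simp add: expectation_total_mass)
  also have "\<dots> \<le> measure_pmf.expectation (types_pmf I)
      (\<lambda>ts. measure_pmf.expectation (ocs_rounding S I (resampling_estimator I opt) ts) (matching_weight I))"
    using finite_types_pmf ts_bound by (rule expectation_mono_finite)
  also have "\<dots> = measure_pmf.expectation (bind_pmf (types_pmf I) (ocs_rounding S I (resampling_estimator I opt))) (matching_weight I)"
    using finite_types_pmf fin_sel by (intro expectation_bind_finite[symmetric]) (auto simp: ocs_rounding_def)
  finally show ?thesis .
qed

end

theorem theorem3:
  fixes opt :: "('u, 't) osm \<Rightarrow> 't list \<Rightarrow> ('u \<times> nat) set pmf"
  assumes "\<And>I. osm_instance I \<Longrightarrow> symmetric_opt_rule I (opt I)"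
  shows "\<exists>x :: ('u, 't) osm \<Rightarrow> 't list \<Rightarrow> 'u \<Rightarrow> real.
           (\<forall>I. osm_instance I \<longrightarrow> unbiased_estimator I (opt I) (x I)) \<and>
           fractional_competitive 0.731 opt x \<and>
           (\<forall>S. multiway_ocs S \<longrightarrow>
              integral_competitive 0.704 opt (\<lambda>I. ocs_rounding S I (x I)))"
proof -
  have rule: "osm_rule I (opt I)" if "osm_instance I" for I
    using that assms by unfold_locales
  show ?thesis
    unfolding fractional_competitive_def integral_competitive_def
    using osm_rule.unbiased_estimator_estimator[OF rule] osm_rule.fractional_ratio[OF rule]
      osm_rule.integral_ratio[OF rule]
    by (intro exI[of _ "\<lambda>I. resampling_estimator I (opt I)"]) blast
qed

end
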